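(* Assume $\frac{\mu^2}{\gamma}\le 1$, $\epsilon_\ell^2\lambda_\ell\le 1$ for all $1\le\ell\le L$, and $\frac{\mu^2}{\gamma}+\sum_{\ell=1}^L\frac{\rho^4\epsilon_\ell^2\lambda_\ell}{1-(1-\rho^4)\epsilon_\ell^2\lambda_\ell}>1+\epsilon$ for some constant $\epsilon>0$. Let $\aleph=\aleph_n$ satisfy $\aleph\to\infty$ and $\aleph=o\big(\frac{\log n}{\log\log n}\big)$. Fix any constant $0<c<1$ and set $\tau=c\cdot\mathbb E_{\mathbb P}[f_{\mathcal H}]$, where $f_{\mathcal H}$ is the weighted count of decorated cycles defined in the context. Then $$\mathbb P(f_{\mathcal H}\le\tau)+\mathbb Q(f_{\mathcal H}\ge\tau)=o(1)\quad\text{as } n\to\infty .$$ In particular, the test that outputs $1$ if $f_{\mathcal H}\ge\tau$ and $0$ if $f_{\mathcal H}<\tau$ achieves strong detection, i.e. the sum of its error probabilities $\mathbb P(\text{output }0)+\mathbb Q(\text{output }1)$ tends to $0$.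
   Context: Model. Fix an integer $L\ge 1$ and constants $\mu>0$, $\rho\in(0,1]$, $\gamma\in(0,\infty)$, $\lambda_1,\dots,\lambda_L>0$, $\epsilon_1,\dots,\epsilon_L\in(0,1)$. Asymptotics are as $n\to\infty$ with $p/n=1/\gamma$ (along $n$ for which $p=n/\gamma$ is an integer). Planted law $\mathbb P$: sample $\bm x\in\{-1,+1\}^n$ uniformly; independently sample $\bm z_1,\dots,\bm z_L\in\{-1,+1\}^n$ with all entries independent and $\Pr(\bm z_\ell(i)=1)=\frac{1+\rho}{2}$; set $\bm x_\ell(i)=\bm x(i)\bm z_\ell(i)$; sample $\bm u\sim\mathcal N(0,\mathbb I_p)$ independently. Conditionally on $\bm x,\bm x_1,\dots,\bm x_L$ the observations are independent: $\bm Y=\sqrt{\mu/n}\,\bm x\bm u^\top+\bm Z\in\mathbb R^{n\times p}$ with $\bm Z$ having i.i.d. $\mathcal N(0,1)$ entries, and $\bm G_\ell$ is a random graph on $[n]$ (identified with its adjacency matrix) in which each pair $i<j$ is an edge independently with probability $\frac{(1+\epsilon_\ell)\lambda_\ell}{n}$ if $\bm x_\ell(i)=\bm x_\ell(j)$ and $\frac{(1-\epsilon_\ell)\lambda_\ell}{n}$ otherwise. Null law $\mathbb Q$: $\bm Y$ has i.i.d. $\mathcal N(0,1)$ entries and $\bm G_\ell\sim\mathcal G(n,\lambda_\ell/n)$ are independent Erdős–Rényi graphs, independent of $\bm Y$. Decorated graphs. $\mathsf K_{n,p}$ is the graph with vertex set $V^{\mathsf a}\cup V^{\mathsf b}$,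 $V^{\mathsf a}=\{a_1,\dots,a_n\}$, $V^{\mathsf b}=\{b_1,\dots,b_p\}$, and edge set $E^{\mathsf a}\cup E^{\mathsf b}$, $E^{\mathsf a}=\{(a_i,a_j):i<j\}$, $E^{\mathsf b}=\{(a_i,b_k):i\in[n],k\in[p]\}$. A decorated graph is a subgraph $H\subset\mathsf K_{n,p}$ with a map $\chi_H:E(H)\to\{0,1,\dots,L\}$ such that $\chi_H(e)=0$ iff $e\in E^{\mathsf b}$. Put $V^{\mathsf a}(H)=V^{\mathsf a}\cap V(H)$, $V^{\mathsf b}(H)=V^{\mathsf b}\cap V(H)$, $E_\ell(H)=\{e\in E(H):\chi_H(e)=\ell\}$, and $V_\ell(H)$ = set of vertices of $H$ incident to an edge of $E_\ell(H)$. $H$ is a decorated cycle if $(V(H),E(H))$ is a cycle. Put $\mathsf{dif}_0(H)=V_0(H)\cap\bigcup_{1\le\ell\le L}V_\ell(H)$ and $\mathsf{dif}(H)=\bigcup_{1\le\ell<\ell'\le L}(V_\ell(H)\cap V_{\ell'}(H))$. Isomorphisms ($\cong$) and automorphisms of decorated graphs preserve vertex types ($\mathsf a$/$\mathsf b$) and decorations; $[H]$ is the isomorphism class and $|\mathsf{Aut}(H)|$ the number of automorphisms. Statistic. $\overline{\bm G}_\ell(i,j)=\frac{1}{\sqrt{\lambda_\ell/n}}\big(\bm G_\ell(i,j)-\frac{\lambda_\ell}{n}\big)$, and for a decorated graph $S$, $f_S=\prod_{(a_i,b_k)\in E_0(S)}\bm Y(i,k)\prod_{\ell=1}^L\prod_{(a_i,a_j)\in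 E_\ell(S)}\overline{\bm G}_\ell(i,j)$. Let $\Xi(H)=\rho^{|\mathsf{dif}_0(H)|+2|\mathsf{dif}(H)|}\big(\tfrac{\mu^2}{\gamma}\big)^{\frac14|E_0(H)|}\prod_{\ell=1}^L(\epsilon_\ell^2\lambda_\ell)^{\frac12|E_\ell(H)|}$. $\mathcal H=\mathcal H(\aleph)$ is the collection of isomorphism classes $[H]$ of decorated cycles with $|V^{\mathsf a}(H)|=\aleph$, $\beta_{\mathcal H}=\sum_{[H]\in\mathcal H}\frac{\Xi(H)^2}{|\mathsf{Aut}(H)|}$, and $$f_{\mathcal H}=\frac1{\sqrt{\beta_{\mathcal H}}}\sum_{[H]\in\mathcal H}\frac{\Xi(H)}{n^{\frac12\aleph}p^{\frac14|E_0(H)|}}\sum_{S\subset\mathsf K_{n,p},\,S\cong H}f_S ,$$ the inner sum being over decorated subgraphs $S$ of $\mathsf K_{n,p}$ isomorphic to $H$. *)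

theory Defs
  imports "HOL-Probability.Probability" "HOL-Library.Landau_Symbols"
begin

text \<open>
  Vertices are numbered from \<open>0\<close>: \<open>[n]\<close> is \<open>{..<n}\<close> and \<open>[p]\<close> is \<open>{..<p}\<close>; layers are \<open>{1..L}\<close>.
  An observation is a pair \<open>(Y, G)\<close>: \<open>Y (i, k)\<close> is a matrix entry, and \<open>G (l, i, j)\<close> for
  \<open>i < j\<close> says whether \<open>{i, j}\<close> is an edge of the graph of layer \<open>l\<close>.
\<close>

type_synonym obs = "(nat \<times> nat \<Rightarrow> real) \<times> (nat \<times> nat \<times> nat \<Rightarrow> bool)"

definition std_gauss :: "real measure" where
  "std_gauss = density lborel (\<lambda>t. ennreal (std_normal_density t))"

definition layer_pairs :: "nat \<Rightarrow> nat \<Rightarrow> (nat \<times> nat \<times> nat) set" where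
  "layer_pairs L n = {(l, i, j). l \<in> {1..L} \<and> i < j \<and> j < n}"

definition obs_space :: "nat \<Rightarrow> nat \<Rightarrow> obs measure" where
  "obs_space n p = (\<Pi>\<^sub>M ik\<in>{..<n} \<times> {..<p}. borel) \<Otimes>\<^sub>M count_space UNIV"

text \<open>
  The joint law of \<open>(x, z, G)\<close>. The success probabilities below are truncated to \<open>[0, 1]\<close> by
  \<open>bernoulli_pmf\<close>, which only matters for finitely many \<open>n\<close>.
\<close>

definition planted_discrete ::
  "nat \<Rightarrow> real \<Rightarrow> (nat \<Rightarrow> real) \<Rightarrow> (nat \<Rightarrow> real) \<Rightarrow> nat
    \<Rightarrow> ((nat \<Rightarrow> real) \<times> (nat \<times> nat \<Rightarrow> real) \<times> (nat \<times> nat \<times> nat \<Rightarrow> bool)) pmf" where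
  "planted_discrete L \<rho> lam eps n =
     do {
       x \<leftarrow> pmf_of_set ({..<n} \<rightarrow>\<^sub>E {- 1, 1});
       z \<leftarrow> Pi_pmf ({1..L} \<times> {..<n}) 0
              (\<lambda>_. map_pmf (\<lambda>b. if b then 1 else - 1) (bernoulli_pmf ((1 + \<rho>) / 2)));
       G \<leftarrow> Pi_pmf (layer_pairs L n) False
              (\<lambda>(l, i, j). bernoulli_pmf
                 (if x i * z (l, i) = x j * z (l, j)
                  then (1 + eps l) * lam l / real n
                  else (1 - eps l) * lam l / real n));
       return_pmf (x, z, G)
     }"

definition planted_law ::
  "nat \<Rightarrow> real \<Rightarrow> real \<Rightarrow> (nat \<Rightarrow> real) \<Rightarrow> (nat \<Rightarrow> real) \<Rightarrow> nat \<Rightarrow> nat \<Rightarrow> obs measure" where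
  "planted_law L \<mu> \<rho> lam eps n p =
     distr (measure_pmf (planted_discrete L \<rho> lam eps n)
              \<Otimes>\<^sub>M ((\<Pi>\<^sub>M k\<in>{..<p}. std_gauss) \<Otimes>\<^sub>M (\<Pi>\<^sub>M ik\<in>{..<n} \<times> {..<p}. std_gauss)))
       (obs_space n p)
       (\<lambda>((x, z, G), (u, Z)).
          (\<lambda>(i, k)\<in>{..<n} \<times> {..<p}. sqrt (\<mu> / real n) * x i * u k + Z (i, k), G))"

definition null_law :: "nat \<Rightarrow> (nat \<Rightarrow> real) \<Rightarrow> nat \<Rightarrow> nat \<Rightarrow> obs measure" where
  "null_law L lam n p =
     (\<Pi>\<^sub>M ik\<in>{..<n} \<times> {..<p}. std_gauss)
       \<Otimes>\<^sub>M measure_pmf (Pi_pmf (layer_pairs L n) False (\<lambda>(l, i, j). bernoulli_pmf (lam l / real n)))"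

datatype vertex = VA nat | VB nat

definition KVa :: "nat \<Rightarrow> vertex set" where "KVa n = VA ` {..<n}"
definition KVb :: "nat \<Rightarrow> vertex set" where "KVb p = VB ` {..<p}"

definition KEa :: "nat \<Rightarrow> vertex set set" where
  "KEa n = {{VA i, VA j} | i j. i < j \<and> j < n}"
definition KEb :: "nat \<Rightarrow> nat \<Rightarrow> vertex set set" where
  "KEb n p = {{VA i, VB k} | i k. i < n \<and> k < p}"

record dgraph =
  verts :: "vertex set"
  edges :: "vertex set set"
  dec :: "vertex set \<Rightarrow> nat"

text \<open>
  The decoration is required to be \<open>undefined\<close> off the edge set (\<open>\<rightarrow>\<^sub>E\<close>), so that a decorated graph
  is determined by its vertices, edges and the decorations of its edges.
\<close>

definition decorated_graph :: "nat \<Rightarrow> nat \<Rightarrow> nat \<Rightarrow> dgraph \<Rightarrow> bool" where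
  "decorated_graph L n p H \<longleftrightarrow>
     verts H \<subseteq> KVa n \<union> KVb p \<and>
     edges H \<subseteq> KEa n \<union> KEb n p \<and>
     (\<forall>e\<in>edges H. e \<subseteq> verts H) \<and>
     dec H \<in> edges H \<rightarrow>\<^sub>E {0..L} \<and>
     (\<forall>e\<in>edges H. dec H e = 0 \<longleftrightarrow> e \<in> KEb n p)"

definition Va :: "dgraph \<Rightarrow> vertex set" where
  "Va H = verts H \<inter> range VA"

definition El :: "dgraph \<Rightarrow> nat \<Rightarrow> vertex set set" where
  "El H l = {e \<in> edges H. dec H e = l}"

definition Vl :: "dgraph \<Rightarrow> nat \<Rightarrow> vertex set" where
  "Vl H l = {v \<in> verts H. \<exists>e\<in>El H l. v \<in> e}"

definition dif0 :: "nat \<Rightarrow> dgraph \<Rightarrow> vertex set" where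
  "dif0 L H = Vl H 0 \<inter> (\<Union>l\<in>{1..L}. Vl H l)"

definition dif :: "nat \<Rightarrow> dgraph \<Rightarrow> vertex set" where
  "dif L H = (\<Union>(l, l')\<in>{(l, l'). 1 \<le> l \<and> l < l' \<and> l' \<le> L}. Vl H l \<inter> Vl H l')"

definition is_cycle :: "dgraph \<Rightarrow> bool" where
  "is_cycle H \<longleftrightarrow>
     (\<exists>vs. 3 \<le> length vs \<and> distinct vs \<and> verts H = set vs \<and>
           edges H = {{vs ! i, vs ! ((i + 1) mod length vs)} | i. i < length vs})"

definition is_iso :: "(vertex \<Rightarrow> vertex) \<Rightarrow> dgraph \<Rightarrow> dgraph \<Rightarrow> bool" where
  "is_iso \<phi> H S \<longleftrightarrow>
     bij_betw \<phi> (verts H) (verts S) \<and>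
     (\<forall>v\<in>verts H. \<phi> v \<in> range VA \<longleftrightarrow> v \<in> range VA) \<and>
     edges S = (\<lambda>e. \<phi> ` e) ` edges H \<and>
     (\<forall>e\<in>edges H. dec S (\<phi> ` e) = dec H e)"

definition isomorphic :: "dgraph \<Rightarrow> dgraph \<Rightarrow> bool" where
  "isomorphic H S \<longleftrightarrow> (\<exists>\<phi>. is_iso \<phi> H S)"

definition Aut :: "dgraph \<Rightarrow> (vertex \<Rightarrow> vertex) set" where
  "Aut H = {\<phi> \<in> extensional (verts H). is_iso \<phi> H H}"

definition iso_rel :: "nat \<Rightarrow> nat \<Rightarrow> nat \<Rightarrow> (dgraph \<times> dgraph) set" where
  "iso_rel L n p =
     {(H, S). decorated_graph L n p H \<and> decorated_graph L n p S \<and> isomorphic H S}"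

definition cycle_classes :: "nat \<Rightarrow> nat \<Rightarrow> nat \<Rightarrow> nat \<Rightarrow> dgraph set set" where
  "cycle_classes L n p a =
     {H. decorated_graph L n p H \<and> is_cycle H \<and> card (Va H) = a} // iso_rel L n p"

text \<open>
  All quantities evaluated at \<open>rep C\<close> below are invariant under isomorphism, so the choice is immaterial.
\<close>

definition rep :: "dgraph set \<Rightarrow> dgraph" where
  "rep C = (SOME H. H \<in> C)"

definition Gbar :: "(nat \<Rightarrow> real) \<Rightarrow> nat \<Rightarrow> (nat \<times> nat \<times> nat \<Rightarrow> bool) \<Rightarrow> nat \<Rightarrow> nat \<Rightarrow> nat \<Rightarrow> real" where
  "Gbar lam n G l i j = (of_bool (G (l, i, j)) - lam l / real n) / sqrt (lam l / real n)"

definition f_graph :: "nat \<Rightarrow> (nat \<Rightarrow> real) \<Rightarrow> nat \<Rightarrow> dgraph \<Rightarrow> obs \<Rightarrow> real" where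
  "f_graph L lam n S = (\<lambda>(Y, G).
     (\<Prod>(i, k)\<in>{(i, k). {VA i, VB k} \<in> El S 0}. Y (i, k)) *
     (\<Prod>l\<in>{1..L}. \<Prod>(i, j)\<in>{(i, j). i < j \<and> {VA i, VA j} \<in> El S l}. Gbar lam n G l i j))"

definition Xi ::
  "nat \<Rightarrow> real \<Rightarrow> real \<Rightarrow> real \<Rightarrow> (nat \<Rightarrow> real) \<Rightarrow> (nat \<Rightarrow> real) \<Rightarrow> dgraph \<Rightarrow> real" where
  "Xi L \<mu> \<rho> \<gamma> lam eps H =
     \<rho> ^ (card (dif0 L H) + 2 * card (dif L H)) *
     (\<mu>\<^sup>2 / \<gamma>) powr (real (card (El H 0)) / 4) *
     (\<Prod>l\<in>{1..L}. ((eps l)\<^sup>2 * lam l) powr (real (card (El H l)) / 2))"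

definition beta ::
  "nat \<Rightarrow> real \<Rightarrow> real \<Rightarrow> real \<Rightarrow> (nat \<Rightarrow> real) \<Rightarrow> (nat \<Rightarrow> real) \<Rightarrow> nat \<Rightarrow> nat \<Rightarrow> nat \<Rightarrow> real" where
  "beta L \<mu> \<rho> \<gamma> lam eps n p a =
     (\<Sum>C\<in>cycle_classes L n p a. (Xi L \<mu> \<rho> \<gamma> lam eps (rep C))\<^sup>2 / real (card (Aut (rep C))))"

definition f_cycles ::
  "nat \<Rightarrow> real \<Rightarrow> real \<Rightarrow> real \<Rightarrow> (nat \<Rightarrow> real) \<Rightarrow> (nat \<Rightarrow> real) \<Rightarrow> nat \<Rightarrow> nat \<Rightarrow> nat \<Rightarrow> obs \<Rightarrow> real" where
  "f_cycles L \<mu> \<rho> \<gamma> lam eps n p a \<omega> =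
     1 / sqrt (beta L \<mu> \<rho> \<gamma> lam eps n p a) *
     (\<Sum>C\<in>cycle_classes L n p a.
        Xi L \<mu> \<rho> \<gamma> lam eps (rep C) /
          (real n powr (real a / 2) * real p powr (real (card (El (rep C) 0)) / 4)) *
        (\<Sum>S\<in>{S. decorated_graph L n p S \<and> isomorphic S (rep C)}. f_graph L lam n S \<omega>))"

text \<open>
  Limits are taken as \<open>n \<rightarrow> \<infinity>\<close> along those \<open>n\<close> for which \<open>n / \<gamma>\<close> is an integer. The filter is
  trivial if there are no arbitrarily large such \<open>n\<close> (i.e. if \<open>\<gamma>\<close> is irrational).
\<close>

definition admissible :: "real \<Rightarrow> nat filter" where
  "admissible \<gamma> = inf sequentially (principal {n. real n / \<gamma> \<in> \<nat>})"

definition pdim :: "real \<Rightarrow> nat \<Rightarrow> nat" where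
  "pdim \<gamma> n = nat \<lfloor>real n / \<gamma>\<rfloor>"

text \<open>A test outputs \<open>1\<close> to decide for the planted law \<open>P\<close> and \<open>0\<close> to decide for the null law \<open>Q\<close>.\<close>

definition strong_detection ::
  "nat filter \<Rightarrow> (nat \<Rightarrow> 'a measure) \<Rightarrow> (nat \<Rightarrow> 'a measure) \<Rightarrow> (nat \<Rightarrow> 'a \<Rightarrow> nat) \<Rightarrow> bool" where
  "strong_detection F P Q T \<longleftrightarrow>
     (\<forall>\<^sub>F n in F. T n \<in> measurable (P n) (count_space {0, 1}) \<and>
                 T n \<in> measurable (Q n) (count_space {0, 1})) \<and>
     ((\<lambda>n. measure (P n) {\<omega> \<in> space (P n). T n \<omega> = 0} +
           measure (Q n) {\<omega> \<in> space (Q n). T n \<omega> = 1}) \<longlongrightarrow> 0) F"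

end

theory Submission
  imports Defs "HOL-Real_Asymp.Real_Asymp"
begin

text \<open>
  Every decorated cycle \<open>S\<close> is \<open>2\<close>-regular, so conditioning on \<open>(x, z, u)\<close> and multiplying the conditional
  means vertex by vertex shows that the coefficient of \<open>f\<^sub>S\<close> in the statistic is exactly \<open>E\<^sub>P f\<^sub>S\<close>. Hence
  \<open>f = \<beta>\<^bsup>-1/2\<^esup> \<Sum>\<^sub>S (E\<^sub>P f\<^sub>S) f\<^sub>S\<close>, and an orbit count gives \<open>B = \<Sum>\<^sub>S (E\<^sub>P f\<^sub>S)\<^sup>2 \<in> [\<beta>/2, \<beta>]\<close>. Therefore
  \<open>E\<^sub>P f = \<beta>\<^bsup>-1/2\<^esup> B\<close>, and \<open>E\<^sub>Q f\<^sup>2 \<le> 1\<close> by orthogonality of the \<open>f\<^sub>S\<close> under \<open>Q\<close>.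

  In \<open>E\<^sub>P f\<^sup>2\<close>, vertex-disjoint pairs \<open>(S, K)\<close> factorise and contribute at most \<open>(E\<^sub>P f)\<^sup>2\<close>; the diagonal contributes
  \<open>O(1)\<close>, because \<open>E\<^sub>P f\<^sub>S\<^sup>2 \<le> 4\<close> (in the expansion of \<open>\<Prod>(A + B \<sigma>)\<close> over the edges only the empty set and the whole
  cycle are even); the other pairs share at least one more vertex than edges, which costs a factor \<open>1/n\<close> that beats
  the number \<open>N\<^bsup>O(N)\<^esup>\<close> of overlap patterns for \<open>N = o(log n / log log n)\<close>. So \<open>Var\<^sub>P f = O(1)\<close>.

  Finally \<open>\<beta>\<close> is, up to a factor \<open>N\<^sup>2\<close>, a cyclic word sum, i.e. the trace of the \<open>N\<close>-th power of a transfer matrix.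
  The signal condition provides an explicit vector on which this matrix expands by \<open>1 + \<epsilon> \<rho>\<^sup>4\<close>, so \<open>\<beta> \<rightarrow> \<infinity>\<close> and
  Chebyshev's inequality concludes.
\<close>

section \<open>Coding edges\<close>

text \<open>Overlapping pairs of cycles are not classified by pattern. Up to a factor C^N, the
  coefficients of a pair (T, T') carry n^(-1/2) per edge and the conditional means another n^(-1/2)
  per unshared edge, together n^(-|T u T'|); the only geometric input is |T u T'| \<ge> |V u V'| +
  1. Pairs are grouped by U = V u V': choosing m vertices costs (g n)^m, which cancels n^(-m), and
  the cycles inside at most 4 N vertices number N^O(N), which the spare factor 1/n absorbs.
  Connectedness is stated as minimality among nonempty even edge sets, because this one property
  leaves two terms in the diagonal second moment and makes the overlap inequality strict.

  The sum over isomorphism classes that defines \<beta> has no product form. A word with one letter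
  per step between consecutive a-vertices describes a cycle, and a class with automorphism group A
  comes from at most N^2 / |A| words, since an isomorphism onto a word graph is fixed by two
  consecutive a-vertices. So \<beta> is at least N^(-2) times a sum over cyclic words whose weights
  are products over adjacent letters.\<close>

text \<open>
  An edge of a decorated graph is coded by \<open>(l, i, j)\<close>: layer \<open>0\<close> stands for \<open>(a_i, b_j)\<close>, a layer
  \<open>l \<ge> 1\<close> for \<open>(a_i, a_j)\<close> with \<open>i < j\<close> and decoration \<open>l\<close>.
\<close>

definition ends :: "nat \<times> nat \<times> nat \<Rightarrow> vertex set" where
  "ends = (\<lambda>(l, i, j). {VA i, if l = 0 then VB j else VA j})"

definition codes :: "nat \<Rightarrow> nat \<Rightarrow> nat \<Rightarrow> (nat \<times> nat \<times> nat) set" where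
  "codes L n p = (\<lambda>(i, k). (0, i, k)) ` ({..<n} \<times> {..<p}) \<union> layer_pairs L n"

definition obsv :: "(nat \<Rightarrow> real) \<Rightarrow> nat \<Rightarrow> obs \<Rightarrow> nat \<times> nat \<times> nat \<Rightarrow> real" where
  "obsv lam n \<omega> = (\<lambda>(l, i, j). if l = 0 then fst \<omega> (i, j) else Gbar lam n (snd \<omega>) l i j)"

definition monom_of :: "(nat \<Rightarrow> real) \<Rightarrow> nat \<Rightarrow> (nat \<times> nat \<times> nat) set \<Rightarrow> obs \<Rightarrow> real" where
  "monom_of lam n T \<omega> = (\<Prod>t\<in>T. obsv lam n \<omega> t)"

definition deg :: "(nat \<times> nat \<times> nat) set \<Rightarrow> vertex \<Rightarrow> nat" where
  "deg T v = card {t\<in>T. v \<in> ends t}"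

definition ldeg :: "(nat \<times> nat \<times> nat) set \<Rightarrow> nat \<Rightarrow> nat \<Rightarrow> nat" where
  "ldeg T l i = card {t\<in>T. fst t = l \<and> VA i \<in> ends t}"

text \<open>Each counted pair leaves one unpaired factor z(l, i), of mean \<rho>, in the product of
  the edge signs, so \<open>\<rho> ^ odd_count L n T\<close> is the attenuation of the signal. Layer
  0 is excluded because its edges carry x without z.\<close>

definition odd_count :: "nat \<Rightarrow> nat \<Rightarrow> (nat \<times> nat \<times> nat) set \<Rightarrow> nat" where
  "odd_count L n T = card {(l, i) \<in> {1..L} \<times> {..<n}. odd (ldeg T l i)}"

lemma mem_codes:
  "(l, i, j) \<in> codes L n p \<longleftrightarrow>
    (if l = 0 then i < n \<and> j < p else l \<le> L \<and> i < j \<and> j < n)"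
  by (auto simp: codes_def layer_pairs_def)

lemma finite_codes [simp]: "finite (codes L n p)"
  by (rule finite_subset[of _ "{..L} \<times> {..<n} \<times> {..<n+p}"])
    (auto simp: mem_codes split: if_splits)

lemma VB_in_ends: "VB k \<in> ends t \<longleftrightarrow> fst t = 0 \<and> snd (snd t) = k"
  by (auto simp: ends_def split: prod.splits)

lemma VA_in_ends: "VA i \<in> ends t \<longleftrightarrow> i = fst (snd t) \<or> fst t \<noteq> 0 \<and> i = snd (snd t)"
  by (auto simp: ends_def split: prod.splits)

lemma prod_codes:
  fixes g :: "nat \<times> nat \<times> nat \<Rightarrow> real"
  shows "(\<Prod>t\<in>codes L n p. g t) = (\<Prod>t\<in>{..<n}\<times>{..<p}. g (0, t)) * (\<Prod>t\<in>layer_pairs L n. g t)"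
proof -
  have fin: "finite (layer_pairs L n)"
    by (rule finite_subset[OF _ finite_codes[of L n p]]) (simp add: codes_def)
  have "(\<Prod>t\<in>codes L n p. g t) = (\<Prod>t\<in>(\<lambda>(i, k). (0, i, k)) ` ({..<n} \<times> {..<p}). g t) * (\<Prod>t\<in>layer_pairs L n. g t)"
    unfolding codes_def by (rule prod.union_disjoint) (simp_all add: fin, auto simp: layer_pairs_def)
  also have "(\<Prod>t\<in>(\<lambda>(i, k). (0, i, k)) ` ({..<n} \<times> {..<p}). g t) = (\<Prod>t\<in>{..<n}\<times>{..<p}. g (0, t))"
    by (subst prod.reindex) (auto simp: inj_on_def case_prod_beta)
  finally show ?thesis .
qed

section \<open>Gaussian and discrete expectations\<close>

text \<open>Independence of the coordinates. Centred edge variables take both signs, so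
  integrability is drawn from the finite supports.\<close>

lemma expectation_prod_Pi_pmf_signed:
  fixes f :: "'a \<Rightarrow> 'b \<Rightarrow> real"
  assumes "finite A" and "\<And>x. x \<in> A \<Longrightarrow> finite (set_pmf (p x))"
  shows "measure_pmf.expectation (Pi_pmf A d p) (\<lambda>y. \<Prod>x\<in>A. f x (y x)) =
    (\<Prod>x\<in>A. measure_pmf.expectation (p x) (f x))"
proof -
  let ?M = "measure_pmf (Pi_pmf A d p)"
  have ind: "prob_space.indep_vars ?M (\<lambda>_. borel) (\<lambda>x y. f x (y x)) A"
    using prob_space.indep_vars_compose2[OF measure_pmf.prob_space_axioms indep_vars_Pi_pmf[OF assms(1), of d p],
        of f "\<lambda>_. borel"] by simp
  have fin: "finite (set_pmf (Pi_pmf A d p))"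
    using assms by (auto simp: set_Pi_pmf intro!: finite_PiE_dflt)
  have "measure_pmf.expectation (Pi_pmf A d p) (\<lambda>y. \<Prod>x\<in>A. f x (y x)) =
      (\<Prod>x\<in>A. measure_pmf.expectation (Pi_pmf A d p) (\<lambda>y. f x (y x)))"
    by (rule prob_space.indep_vars_lebesgue_integral[OF measure_pmf.prob_space_axioms assms(1) ind])
      (auto intro: integrable_measure_pmf_finite fin)
  also have "\<dots> = (\<Prod>x\<in>A. measure_pmf.expectation (p x) (f x))"
  proof (rule prod.cong[OF refl])
    fix x assume "x \<in> A"
    then have "p x = map_pmf (\<lambda>y. y x) (Pi_pmf A d p)"
      by (simp add: Pi_pmf_component assms(1))
    then show "measure_pmf.expectation (Pi_pmf A d p) (\<lambda>y. f x (y x)) = measure_pmf.expectation (p x) (f x)"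
      by simp
  qed
  finally show ?thesis .
qed

lemma prob_space_std_gauss: "prob_space std_gauss"
  unfolding std_gauss_def using prob_space_normal_density[of 1 0] by simp

lemma sets_std_gauss [simp, measurable_cong]: "sets std_gauss = sets borel"
  by (simp add: std_gauss_def)

lemma space_std_gauss [simp]: "space std_gauss = UNIV"
  by (simp add: std_gauss_def)

lemma integrable_std_gauss_iff:
  fixes f :: "real \<Rightarrow> real"
  assumes [measurable]: "f \<in> borel_measurable borel"
  shows "integrable std_gauss f \<longleftrightarrow> integrable lborel (\<lambda>x. std_normal_density x * f x)"
  unfolding std_gauss_def by (subst integrable_real_density) auto

lemma integral_std_gauss_eq:
  fixes f :: "real \<Rightarrow> real"
  assumes [measurable]: "f \<in> borel_measurable borel"
  shows "integral\<^sup>L std_gauss f = (\<integral>x. std_normal_density x * f x \<partial>lborel)"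
  unfolding std_gauss_def by (subst integral_real_density) auto

lemma integrable_std_gauss_power [simp]: "integrable std_gauss (\<lambda>t. t ^ k)"
  using integrable_std_normal_moment[of k] by (simp add: integrable_std_gauss_iff)

lemma integrable_std_gauss_abs_power: "integrable std_gauss (\<lambda>t. \<bar>t\<bar> ^ k)"
  using integrable_std_normal_moment_abs[of k] by (simp add: integrable_std_gauss_iff)

lemma integrable_std_gauss_const [simp]: "integrable std_gauss (\<lambda>_. (c::real))"
  using prob_space.finite_measure[OF prob_space_std_gauss] by (simp add: finite_measure.integrable_const)

lemma integrable_std_gauss_1_plus_abs: "integrable std_gauss (\<lambda>t. (1 + \<bar>t\<bar>) ^ k)"
  by (subst binomial_ring) (auto intro!: integrable_std_gauss_abs_power)

lemma measure_std_gauss_UNIV [simp]: "measure std_gauss UNIV = 1"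
  using prob_space.prob_space[OF prob_space_std_gauss] by simp

lemma integral_std_gauss_1 [simp]: "integral\<^sup>L std_gauss (\<lambda>t. t) = 0"
  using integral_std_normal_moment_odd[of 0] by (simp add: integral_std_gauss_eq)

lemma integral_std_gauss_2 [simp]: "integral\<^sup>L std_gauss (\<lambda>t. t\<^sup>2) = 1"
  using integral_std_normal_moment_even[of 1] by (simp add: integral_std_gauss_eq)

lemma integral_std_gauss_4 [simp]: "integral\<^sup>L std_gauss (\<lambda>t. t ^ 4) = 3"
  using integral_std_normal_moment_even[of 2] by (simp add: integral_std_gauss_eq fact_numeral)

text \<open>Conditional moment of a matrix entry, which given the signal is Gaussian with mean
  \<open>a\<close> and variance 1. A product of two square-free monomials leads to m = 0, 1, 2
  only.\<close>

definition shift_moment :: "nat \<Rightarrow> real \<Rightarrow> real" where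
  "shift_moment m a = (\<integral>t. (a + t) ^ m \<partial>std_gauss)"

lemma integrable_shift_power: "integrable std_gauss (\<lambda>t. (a + t) ^ m :: real)"
  by (subst binomial_ring) auto

lemma shift_moment_0 [simp]: "shift_moment 0 a = 1"
  by (simp add: shift_moment_def)

lemma shift_moment_1 [simp]: "shift_moment (Suc 0) a = a"
  using integrable_std_gauss_power[of 1] by (simp add: shift_moment_def)

lemma shift_moment_2 [simp]: "shift_moment 2 a = 1 + a\<^sup>2"
proof -
  have "(\<lambda>t. (a + t) ^ 2) = (\<lambda>t. a\<^sup>2 + (2 * a) * t + t\<^sup>2)"
    by (auto simp: power2_eq_square algebra_simps)
  then show ?thesis using integrable_std_gauss_power[of 1]
    by (simp add: shift_moment_def)
qed

lemma
  fixes f :: "'a \<Rightarrow> real" and g :: "'b \<Rightarrow> real"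
  assumes "prob_space M" "prob_space N" and f: "integrable M f" and g: "integrable N g"
  shows integrable_pair_mult: "integrable (M \<Otimes>\<^sub>M N) (\<lambda>(x, y). f x * g y)"
    and integral_pair_mult:
      "(\<integral>(x, y). f x * g y \<partial>(M \<Otimes>\<^sub>M N)) = integral\<^sup>L M f * integral\<^sup>L N g"
proof -
  interpret M: prob_space M by fact
  interpret N: prob_space N by fact
  interpret pair_sigma_finite M N ..
  have [measurable]: "f \<in> borel_measurable M" "g \<in> borel_measurable N" using f g by auto
  show 1: "integrable (M \<Otimes>\<^sub>M N) (\<lambda>(x, y). f x * g y)"
    by (rule Fubini_integrable) (use f g in \<open>auto simp: abs_mult\<close>)
  show "(\<integral>(x, y). f x * g y \<partial>(M \<Otimes>\<^sub>M N)) = integral\<^sup>L M f * integral\<^sup>L N g"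
    using integral_fst'[OF 1] by simp
qed

text \<open>With finitely many discrete values, joint integrability reduces to integrability of each
  slice.\<close>

lemma
  fixes f :: "'a \<times> 'b \<Rightarrow> real"
  assumes D: "finite (set_pmf D)" and N: "prob_space N"
    and [measurable]: "f \<in> borel_measurable (measure_pmf D \<Otimes>\<^sub>M N)"
    and f: "\<And>d. d \<in> set_pmf D \<Longrightarrow> integrable N (\<lambda>y. f (d, y))"
  shows integrable_finite_pmf_pair: "integrable (measure_pmf D \<Otimes>\<^sub>M N) f"
    and integral_finite_pmf_pair:
      "integral\<^sup>L (measure_pmf D \<Otimes>\<^sub>M N) f = measure_pmf.expectation D (\<lambda>d. \<integral>y. f (d, y) \<partial>N)"
proof -
  interpret N: prob_space N by fact
  interpret pair_sigma_finite "measure_pmf D" N ..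
  show 1: "integrable (measure_pmf D \<Otimes>\<^sub>M N) f"
    by (rule Fubini_integrable) (use D f in \<open>auto intro: integrable_measure_pmf_finite simp: AE_measure_pmf_iff\<close>)
  show "integral\<^sup>L (measure_pmf D \<Otimes>\<^sub>M N) f = measure_pmf.expectation D (\<lambda>d. \<integral>y. f (d, y) \<partial>N)"
    using integral_fst'[OF 1] by simp
qed

lemma expectation_bind_pmf_finite:
  fixes h :: "'b \<Rightarrow> real"
  assumes "finite (set_pmf p)" "\<And>x. x \<in> set_pmf p \<Longrightarrow> finite (set_pmf (f x))"
  shows "measure_pmf.expectation (p \<bind> f) h =
    measure_pmf.expectation p (\<lambda>a. measure_pmf.expectation (f a) h)"
  by (subst pmf_expectation_bind[of "set_pmf p"])
    (use assms in \<open>auto simp: integral_measure_pmf[of "set_pmf p"]\<close>)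

abbreviation gauss_prod :: "'i set \<Rightarrow> ('i \<Rightarrow> real) measure" where
  "gauss_prod I \<equiv> (\<Pi>\<^sub>M i\<in>I. std_gauss)"

interpretation gauss: product_sigma_finite "\<lambda>_. std_gauss"
  by unfold_locales (rule prob_space_imp_sigma_finite[OF prob_space_std_gauss, unfolded sigma_finite_measure_def])

lemma prob_space_gauss_prod: "prob_space (gauss_prod I)"
  by (rule prob_space_PiM) (rule prob_space_std_gauss)

lemma measurable_gauss_component: "k \<in> I \<Longrightarrow> (\<lambda>w. w k) \<in> borel_measurable (gauss_prod I)"
  using measurable_component_singleton[of k I "\<lambda>_. std_gauss"]
  unfolding measurable_cong_sets[OF refl sets_std_gauss] .

section \<open>The discrete part of the planted law: community signs and edges\<close>

lemma finite_layer_pairs [simp]: "finite (layer_pairs L n)"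
  by (rule finite_subset[of _ "{1..L} \<times> {..<n} \<times> {..<n}"]) (auto simp: layer_pairs_def)

lemma finite_set_pmf_bool [simp]: "finite (set_pmf (p :: bool pmf))"
  by (rule finite_subset[OF subset_UNIV]) simp

definition signs :: "nat \<Rightarrow> real \<Rightarrow> nat \<Rightarrow> ((nat \<Rightarrow> real) \<times> (nat \<times> nat \<Rightarrow> real)) pmf" where
  "signs L \<rho> n = pair_pmf (pmf_of_set ({..<n} \<rightarrow>\<^sub>E {- 1, 1}))
     (Pi_pmf ({1..L} \<times> {..<n}) 0
        (\<lambda>_. map_pmf (\<lambda>b. if b then 1 else - 1) (bernoulli_pmf ((1 + \<rho>) / 2))))"

definition edge_pmf ::
  "(nat \<Rightarrow> real) \<Rightarrow> (nat \<Rightarrow> real) \<Rightarrow> nat \<Rightarrow> (nat \<Rightarrow> real) \<Rightarrow> (nat \<times> nat \<Rightarrow> real) \<Rightarrow> nat \<times> nat \<times> nat \<Rightarrow> bool pmf"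
  where "edge_pmf lam eps n x z = (\<lambda>(l, i, j). bernoulli_pmf
                 (if x i * z (l, i) = x j * z (l, j)
                  then (1 + eps l) * lam l / real n
                  else (1 - eps l) * lam l / real n))"

text \<open>Given the signs, the edges are independent, so conditioning on the finitely supported
  \<open>signs\<close> turns edge expectations into products.\<close>

lemma planted_discrete_eq:
  "planted_discrete L \<rho> lam eps n =
     signs L \<rho> n \<bind> (\<lambda>(x, z). map_pmf (\<lambda>G. (x, z, G)) (Pi_pmf (layer_pairs L n) False (edge_pmf lam eps n x z)))"
  unfolding planted_discrete_def signs_def pair_pmf_def edge_pmf_def map_pmf_def
  by (simp add: bind_assoc_pmf bind_return_pmf)

lemma finite_sign_functions: "finite ({..<n :: nat} \<rightarrow>\<^sub>E {- 1, 1 :: real})"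
  by (intro finite_PiE) auto

lemma sign_functions_nonempty: "({..<n :: nat} \<rightarrow>\<^sub>E {- 1, 1 :: real}) \<noteq> {}"
  by (auto simp: PiE_eq_empty_iff)

lemma finite_set_signs: "finite (set_pmf (signs L \<rho> n))"
proof -
  have "finite (set_pmf (pmf_of_set ({..<n} \<rightarrow>\<^sub>E {- 1, 1 :: real})))"
    by (simp only: set_pmf_of_set[OF sign_functions_nonempty finite_sign_functions] finite_sign_functions)
  moreover have "finite (set_pmf (Pi_pmf ({1..L} \<times> {..<n}) 0
        (\<lambda>_. map_pmf (\<lambda>b. if b then 1 else - 1 :: real) (bernoulli_pmf ((1 + \<rho>) / 2)))))"
    by (subst set_Pi_pmf, simp, rule finite_PiE_dflt) (auto simp del: set_pmf_bernoulli)
  ultimately show ?thesis unfolding signs_def set_pair_pmf by (rule finite_cartesian_product)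
qed

lemma set_signsD:
  assumes "(x, z) \<in> set_pmf (signs L \<rho> n)"
  shows "i < n \<Longrightarrow> x i \<in> {-1, 1}" and "l \<in> {1..L} \<Longrightarrow> i < n \<Longrightarrow> z (l, i) \<in> {-1, 1}"
proof -
  have x: "x \<in> {..<n} \<rightarrow>\<^sub>E {- 1, 1}" and
    z: "z \<in> set_pmf (Pi_pmf ({1..L} \<times> {..<n}) 0
        (\<lambda>_. map_pmf (\<lambda>b. if b then 1 else - 1 :: real) (bernoulli_pmf ((1 + \<rho>) / 2))))"
    using assms unfolding signs_def set_pair_pmf
    by (simp_all only: set_pmf_of_set[OF sign_functions_nonempty finite_sign_functions] mem_Sigma_iff)
  show "x i \<in> {-1, 1}" if "i < n" using x that by (simp only: PiE_iff lessThan_iff)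
  show "z (l, i) \<in> {-1, 1}" if "l \<in> {1..L}" "i < n"
  proof -
    have "z (l, i) \<in> set_pmf (map_pmf (\<lambda>b. if b then 1 else - 1 :: real) (bernoulli_pmf ((1 + \<rho>) / 2)))"
      using z that by (subst (asm) set_Pi_pmf) (auto simp: PiE_dflt_def simp del: set_pmf_bernoulli set_map_pmf)
    then show ?thesis by (auto simp del: set_pmf_bernoulli)
  qed
qed

lemma finite_set_edges: "finite (set_pmf (Pi_pmf (layer_pairs L n) False (edge_pmf lam eps n x z)))"
  by (auto simp: set_Pi_pmf intro!: finite_PiE_dflt)

lemma finite_set_planted: "finite (set_pmf (planted_discrete L \<rho> lam eps n))"
  by (auto simp: planted_discrete_eq finite_set_signs finite_set_edges)

section \<open>Measurability and expectations of monomials under the two laws\<close>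

lemma measurable_obs_entry:
  "t \<in> {..<n}\<times>{..<p} \<Longrightarrow> (\<lambda>\<omega>. fst \<omega> t) \<in> borel_measurable (obs_space n p)"
  unfolding obs_space_def by (rule measurable_compose[OF measurable_fst measurable_component_singleton])

lemma measurable_obs_graph: "(\<lambda>\<omega>. h (snd \<omega>) :: real) \<in> borel_measurable (obs_space n p)"
  unfolding obs_space_def by (rule measurable_compose[OF measurable_snd]) simp

lemma measurable_obs_monomial:
  "(\<lambda>\<omega>. (\<Prod>t\<in>{..<n}\<times>{..<p}. fst \<omega> t ^ my t) * (h (snd \<omega>) :: real)) \<in> borel_measurable (obs_space n p)"
  by (rule borel_measurable_times[OF borel_measurable_prod[OF borel_measurable_power[OF measurable_obs_entry]]
        measurable_obs_graph])

definition plant :: "real \<Rightarrow> nat \<Rightarrow> nat \<Rightarrow>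
    ((nat \<Rightarrow> real) \<times> (nat \<times> nat \<Rightarrow> real) \<times> (nat \<times> nat \<times> nat \<Rightarrow> bool)) \<times> ((nat \<Rightarrow> real) \<times> (nat \<times> nat \<Rightarrow> real)) \<Rightarrow> obs" where
  "plant \<mu> n p = (\<lambda>((x, z, G), (u, Z)).
          (\<lambda>(i, k)\<in>{..<n} \<times> {..<p}. sqrt (\<mu> / real n) * x i * u k + Z (i, k), G))"

lemma planted_law_eq:
  "planted_law L \<mu> \<rho> lam eps n p =
     distr (measure_pmf (planted_discrete L \<rho> lam eps n) \<Otimes>\<^sub>M (gauss_prod {..<p} \<Otimes>\<^sub>M gauss_prod ({..<n} \<times> {..<p})))
       (obs_space n p) (plant \<mu> n p)"
  unfolding planted_law_def plant_def ..

lemma measurable_plant [measurable]: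
  "plant \<mu> n p \<in> measurable (measure_pmf D \<Otimes>\<^sub>M (gauss_prod {..<p} \<Otimes>\<^sub>M gauss_prod ({..<n} \<times> {..<p}))) (obs_space n p)"
proof -
  let ?M = "measure_pmf D \<Otimes>\<^sub>M (gauss_prod {..<p} \<Otimes>\<^sub>M gauss_prod ({..<n} \<times> {..<p}))"
  have eq: "plant \<mu> n p = (\<lambda>w. ((\<lambda>ik\<in>{..<n} \<times> {..<p}.
      sqrt (\<mu> / real n) * fst (fst w) (fst ik) * fst (snd w) (snd ik) + snd (snd w) ik), snd (snd (fst w))))"
    by (auto simp: plant_def fun_eq_iff)
  have 1: "(\<lambda>w. fst (fst w) i) \<in> borel_measurable ?M" for i
    by (rule measurable_compose[OF measurable_fst]) simp
  have 2: "(\<lambda>w. fst (snd w) k) \<in> borel_measurable ?M" if "k < p" for k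
    by (rule measurable_compose[OF measurable_snd], rule measurable_compose[OF measurable_fst],
        rule measurable_gauss_component) (use that in auto)
  have 3: "(\<lambda>w. snd (snd w) t) \<in> borel_measurable ?M" if "t \<in> {..<n} \<times> {..<p}" for t
    by (rule measurable_compose[OF measurable_snd], rule measurable_compose[OF measurable_snd],
        rule measurable_gauss_component) (use that in auto)
  have 4: "(\<lambda>w. snd (snd (fst w))) \<in> measurable ?M (count_space UNIV)"
    by (rule measurable_compose[OF measurable_fst]) simp
  show ?thesis unfolding eq obs_space_def
  proof (rule measurable_Pair[OF measurable_restrict 4])
    fix ik assume "ik \<in> {..<n} \<times> {..<p}"
    then show "(\<lambda>w. sqrt (\<mu> / real n) * fst (fst w) (fst ik) * fst (snd w) (snd ik) + snd (snd w) ik) \<in> borel_measurable ?M"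
      by (intro borel_measurable_add borel_measurable_times 1 2 3 borel_measurable_const) auto
  qed
qed

lemma
  assumes "finite I"
  shows integrable_gauss_shift:
    "integrable (gauss_prod I) (\<lambda>Z. \<Prod>t\<in>I. (a t + Z t) ^ m t)"
    and integral_gauss_shift:
    "(\<integral>Z. (\<Prod>t\<in>I. (a t + Z t) ^ m t) \<partial>gauss_prod I) = (\<Prod>t\<in>I. shift_moment (m t) (a t))"
proof -
  note 1 = gauss.product_integrable_prod[OF assms, of "\<lambda>t y. (a t + y) ^ m t"]
  note 2 = gauss.product_integral_prod[OF assms, of "\<lambda>t y. (a t + y) ^ m t"]
  show "integrable (gauss_prod I) (\<lambda>Z. \<Prod>t\<in>I. (a t + Z t) ^ m t)"
    using 1 by (simp add: integrable_shift_power)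
  show "(\<integral>Z. (\<Prod>t\<in>I. (a t + Z t) ^ m t) \<partial>gauss_prod I) = (\<Prod>t\<in>I. shift_moment (m t) (a t))"
    using 2 by (simp add: integrable_shift_power shift_moment_def)
qed

text \<open>Entries of one column share the variable u k, so the integrand is not a product over
  independent coordinates. It is dominated by one, through |b u + z| \<le> (1 + |b|) (1 + |u|) (1 +
  |z|).\<close>

lemma integrable_gauss_monomials:
  fixes b :: "nat \<Rightarrow> nat \<Rightarrow> real"
  shows "integrable (gauss_prod {..<p} \<Otimes>\<^sub>M gauss_prod ({..<n} \<times> {..<p}))
    (\<lambda>(u, Z). \<Prod>t\<in>{..<n}\<times>{..<p}. (b (fst t) (snd t) * u (snd t) + Z t) ^ m t)"
proof -
  let ?U = "gauss_prod {..<p}" and ?Z = "gauss_prod ({..<n} \<times> {..<p})" and ?I = "{..<n} \<times> {..<p}"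
  define C where "C = (\<Prod>t\<in>?I. (1 + \<bar>b (fst t) (snd t)\<bar>) ^ m t)"
  \<comment> \<open>Total exponent of column k: every entry (i, k) contributes its own power of 1 +
    |u k|.\<close>
  define d where "d k = (\<Sum>i<n. m (i, k))" for k
  have U: "integrable ?U (\<lambda>u. \<Prod>k<p. (1 + \<bar>u k\<bar>) ^ d k)"
    using gauss.product_integrable_prod[of "{..<p}" "\<lambda>k t. (1 + \<bar>t\<bar>) ^ d k"]
    by (simp add: integrable_std_gauss_1_plus_abs)
  have Z: "integrable ?Z (\<lambda>Z. \<Prod>t\<in>?I. (1 + \<bar>Z t\<bar>) ^ m t)"
    using gauss.product_integrable_prod[of ?I "\<lambda>k t. (1 + \<bar>t\<bar>) ^ m k"]
    by (simp add: integrable_std_gauss_1_plus_abs)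
  have *: "integrable (?U \<Otimes>\<^sub>M ?Z) (\<lambda>(u, Z). (\<Prod>k<p. (1 + \<bar>u k\<bar>) ^ d k) * (\<Prod>t\<in>?I. (1 + \<bar>Z t\<bar>) ^ m t))"
    by (rule integrable_pair_mult[OF prob_space_gauss_prod prob_space_gauss_prod U Z])
  have 1: "(\<lambda>w. fst w k) \<in> borel_measurable (?U \<Otimes>\<^sub>M ?Z)" if "k < p" for k
    by (rule measurable_compose[OF measurable_fst],
        rule measurable_gauss_component) (use that in auto)
  have 2: "(\<lambda>w. snd w t) \<in> borel_measurable (?U \<Otimes>\<^sub>M ?Z)" if "t \<in> ?I" for t
    by (rule measurable_compose[OF measurable_snd],
        rule measurable_gauss_component) (use that in auto)
  show ?thesis
  proof (rule Bochner_Integration.integrable_bound)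
    show "integrable (?U \<Otimes>\<^sub>M ?Z) (\<lambda>w. C * (case w of (u, Z) \<Rightarrow> (\<Prod>k<p. (1 + \<bar>u k\<bar>) ^ d k) * (\<Prod>t\<in>?I. (1 + \<bar>Z t\<bar>) ^ m t)))"
      using * by simp
    show "(\<lambda>(u, Z). \<Prod>t\<in>?I. (b (fst t) (snd t) * u (snd t) + Z t) ^ m t) \<in> borel_measurable (?U \<Otimes>\<^sub>M ?Z)"
      unfolding case_prod_beta by (intro borel_measurable_prod borel_measurable_power borel_measurable_add borel_measurable_times borel_measurable_const 1 2) auto
    have main: "\<bar>\<Prod>t\<in>?I. (b (fst t) (snd t) * u (snd t) + Z t) ^ m t\<bar> \<le>
        C * ((\<Prod>k<p. (1 + \<bar>u k\<bar>) ^ d k) * (\<Prod>t\<in>?I. (1 + \<bar>Z t\<bar>) ^ m t))" for u Z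
    proof -
      have 1: "\<bar>b i k * u k + Z t\<bar> \<le> (1 + \<bar>b i k\<bar>) * (1 + \<bar>u k\<bar>) * (1 + \<bar>Z t\<bar>)" for i k t
      proof -
        have "\<bar>b i k * u k + Z t\<bar> \<le> \<bar>b i k\<bar> * \<bar>u k\<bar> + \<bar>Z t\<bar>"
          by (metis abs_mult abs_triangle_ineq)
        also have "\<dots> \<le> (1 + \<bar>b i k\<bar>) * (1 + \<bar>u k\<bar>) * (1 + \<bar>Z t\<bar>)"
          by (simp add: algebra_simps)
        finally show ?thesis .
      qed
      have "\<bar>\<Prod>t\<in>?I. (b (fst t) (snd t) * u (snd t) + Z t) ^ m t\<bar> =
          (\<Prod>t\<in>?I. \<bar>b (fst t) (snd t) * u (snd t) + Z t\<bar> ^ m t)"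
        by (simp add: abs_prod power_abs)
      also have "\<dots> \<le> (\<Prod>t\<in>?I. ((1 + \<bar>b (fst t) (snd t)\<bar>) * (1 + \<bar>u (snd t)\<bar>) * (1 + \<bar>Z t\<bar>)) ^ m t)"
        by (intro prod_mono conjI power_mono 1) auto
      also have "\<dots> = C * ((\<Prod>t\<in>?I. (1 + \<bar>u (snd t)\<bar>) ^ m t) * (\<Prod>t\<in>?I. (1 + \<bar>Z t\<bar>) ^ m t))"
        unfolding C_def by (simp add: power_mult_distrib prod.distrib mult.assoc)
      also have "(\<Prod>t\<in>?I. (1 + \<bar>u (snd t)\<bar>) ^ m t) = (\<Prod>i<n. \<Prod>k<p. (1 + \<bar>u k\<bar>) ^ m (i, k))"
        by (subst prod.cartesian_product) (auto intro!: prod.cong)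
      also have "\<dots> = (\<Prod>k<p. (1 + \<bar>u k\<bar>) ^ d k)"
        by (subst prod.swap) (simp add: d_def power_sum)
      finally show ?thesis .
    qed
    have "C \<ge> 0" unfolding C_def by (intro prod_nonneg) auto
    show "AE w in ?U \<Otimes>\<^sub>M ?Z. norm (case w of (u, Z) \<Rightarrow> \<Prod>t\<in>?I. (b (fst t) (snd t) * u (snd t) + Z t) ^ m t) \<le>
        norm (C * (case w of (u, Z) \<Rightarrow> (\<Prod>k<p. (1 + \<bar>u k\<bar>) ^ d k) * (\<Prod>t\<in>?I. (1 + \<bar>Z t\<bar>) ^ m t)))"
      by (intro AE_I2) (auto intro: order_trans[OF main abs_ge_self])
  qed
qed

text \<open>Given x, z and u, all entries and edges are independent, so the conditional expectation
  is a product. The integral over u stays in front because a column shares u k, and the average over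
  signs because edges share vertices.\<close>

lemma
  fixes L n p :: nat and my :: "nat \<times> nat \<Rightarrow> nat" and h :: "nat \<times> nat \<times> nat \<Rightarrow> bool \<Rightarrow> real"
  defines "F \<equiv> \<lambda>\<omega>. (\<Prod>t\<in>{..<n}\<times>{..<p}. fst \<omega> t ^ my t) * (\<Prod>t\<in>layer_pairs L n. h t (snd \<omega> t))"
  shows integrable_planted_monomial: "integrable (planted_law L \<mu> \<rho> lam eps n p) F"
    and integral_planted_monomial:
      "integral\<^sup>L (planted_law L \<mu> \<rho> lam eps n p) F =
        measure_pmf.expectation (signs L \<rho> n) (\<lambda>(x, z).
          (\<integral>u. (\<Prod>t\<in>{..<n}\<times>{..<p}. shift_moment (my t) (sqrt (\<mu> / real n) * x (fst t) * u (snd t))) \<partial>gauss_prod {..<p}) *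
          (\<Prod>t\<in>layer_pairs L n. measure_pmf.expectation (edge_pmf lam eps n x z t) (h t)))"
proof -
  let ?D = "planted_discrete L \<rho> lam eps n"
  let ?U = "gauss_prod {..<p}" and ?Z = "gauss_prod ({..<n} \<times> {..<p})" and ?I = "{..<n} \<times> {..<p}"
  let ?c = "sqrt (\<mu> / real n)"
  interpret U: prob_space ?U by (rule prob_space_gauss_prod)
  interpret Z: prob_space ?Z by (rule prob_space_gauss_prod)
  interpret UZ: pair_prob_space ?U ?Z ..
  have UZ: "prob_space (?U \<Otimes>\<^sub>M ?Z)" by unfold_locales
  have F: "F \<in> borel_measurable (obs_space n p)"
    unfolding F_def by (rule measurable_obs_monomial)
  have Fp: "F (plant \<mu> n p ((x, z, G), y)) =
      (case y of (u, Z) \<Rightarrow> (\<Prod>t\<in>?I. (?c * x (fst t) * u (snd t) + Z t) ^ my t)) * (\<Prod>t\<in>layer_pairs L n. h t (G t))" for x z G y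
    by (cases y) (auto simp: F_def plant_def intro!: prod.cong)
  note int = integrable_gauss_monomials[of p n "\<lambda>i k. ?c * x i" my for x]
  have Fint: "integrable (?U \<Otimes>\<^sub>M ?Z) (\<lambda>y. F (plant \<mu> n p (d, y)))" for d
    using int[of "fst d"] by (cases d) (simp add: Fp)
  have meas: "(\<lambda>w. F (plant \<mu> n p w)) \<in> borel_measurable (measure_pmf ?D \<Otimes>\<^sub>M (?U \<Otimes>\<^sub>M ?Z))"
    using measurable_compose[OF measurable_plant F] .
  note a = integrable_finite_pmf_pair[OF finite_set_planted UZ meas Fint]
    and b = integral_finite_pmf_pair[OF finite_set_planted UZ meas Fint]
  show "integrable (planted_law L \<mu> \<rho> lam eps n p) F"
    unfolding planted_law_eq using a by (subst integrable_distr_eq) (auto intro: F)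
  have inner: "(\<integral>y. F (plant \<mu> n p ((x, z, G), y)) \<partial>(?U \<Otimes>\<^sub>M ?Z)) =
     (\<integral>u. (\<Prod>t\<in>?I. shift_moment (my t) (?c * x (fst t) * u (snd t))) \<partial>?U) * (\<Prod>t\<in>layer_pairs L n. h t (G t))" for x z G
  proof -
    have "(\<integral>y. F (plant \<mu> n p ((x, z, G), y)) \<partial>(?U \<Otimes>\<^sub>M ?Z)) =
      (\<integral>y. (case y of (u, Z) \<Rightarrow> (\<Prod>t\<in>?I. (?c * x (fst t) * u (snd t) + Z t) ^ my t)) \<partial>(?U \<Otimes>\<^sub>M ?Z)) * (\<Prod>t\<in>layer_pairs L n. h t (G t))"
      unfolding Fp by simp
    also have "(\<integral>y. (case y of (u, Z) \<Rightarrow> (\<Prod>t\<in>?I. (?c * x (fst t) * u (snd t) + Z t) ^ my t)) \<partial>(?U \<Otimes>\<^sub>M ?Z)) =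
      (\<integral>u. (\<integral>Z. (\<Prod>t\<in>?I. (?c * x (fst t) * u (snd t) + Z t) ^ my t) \<partial>?Z) \<partial>?U)"
      using UZ.integral_fst'[OF int[of x]] by simp
    finally show ?thesis by (simp add: integral_gauss_shift)
  qed
  have "integral\<^sup>L (planted_law L \<mu> \<rho> lam eps n p) F = measure_pmf.expectation ?D (\<lambda>d. \<integral>y. F (plant \<mu> n p (d, y)) \<partial>(?U \<Otimes>\<^sub>M ?Z))"
    unfolding planted_law_eq by (subst integral_distr) (auto intro: F simp: b)
  also have "\<dots> = measure_pmf.expectation ?D (\<lambda>(x, z, G). (\<integral>u. (\<Prod>t\<in>?I. shift_moment (my t) (?c * x (fst t) * u (snd t))) \<partial>?U) * (\<Prod>t\<in>layer_pairs L n. h t (G t)))"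
    by (intro Bochner_Integration.integral_cong) (auto simp: inner)
  also have "\<dots> = measure_pmf.expectation (signs L \<rho> n) (\<lambda>(x, z).
          (\<integral>u. (\<Prod>t\<in>?I. shift_moment (my t) (?c * x (fst t) * u (snd t))) \<partial>?U) *
          (\<Prod>t\<in>layer_pairs L n. measure_pmf.expectation (edge_pmf lam eps n x z t) (h t)))"
    unfolding planted_discrete_eq
    by (subst expectation_bind_pmf_finite)
      (auto simp: finite_set_signs finite_set_edges case_prod_unfold
        intro!: Bochner_Integration.integral_cong expectation_prod_Pi_pmf_signed)
  finally show "integral\<^sup>L (planted_law L \<mu> \<rho> lam eps n p) F =
        measure_pmf.expectation (signs L \<rho> n) (\<lambda>(x, z).
          (\<integral>u. (\<Prod>t\<in>?I. shift_moment (my t) (?c * x (fst t) * u (snd t))) \<partial>?U) *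
          (\<Prod>t\<in>layer_pairs L n. measure_pmf.expectation (edge_pmf lam eps n x z t) (h t)))" .
qed

lemma
  fixes L n p :: nat and my :: "nat \<times> nat \<Rightarrow> nat" and h :: "nat \<times> nat \<times> nat \<Rightarrow> bool \<Rightarrow> real"
  defines "F \<equiv> \<lambda>\<omega>. (\<Prod>t\<in>{..<n}\<times>{..<p}. fst \<omega> t ^ my t) * (\<Prod>t\<in>layer_pairs L n. h t (snd \<omega> t))"
  shows integrable_null_monomial: "integrable (null_law L lam n p) F"
    and integral_null_monomial:
      "integral\<^sup>L (null_law L lam n p) F = (\<Prod>t\<in>{..<n}\<times>{..<p}. shift_moment (my t) 0) *
          (\<Prod>t\<in>layer_pairs L n. measure_pmf.expectation (bernoulli_pmf (lam (fst t) / real n)) (h t))"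
proof -
  let ?Z = "gauss_prod ({..<n} \<times> {..<p})" and ?I = "{..<n} \<times> {..<p}"
  let ?G = "Pi_pmf (layer_pairs L n) False (\<lambda>(l, i, j). bernoulli_pmf (lam l / real n))"
  have fin: "finite (set_pmf ?G)"
    by (auto simp: set_Pi_pmf intro!: finite_PiE_dflt)
  have *: "F = (\<lambda>(Y, G). (\<Prod>t\<in>?I. Y t ^ my t) * (\<Prod>t\<in>layer_pairs L n. h t (G t)))"
    by (auto simp: F_def)
  have 1: "integrable ?Z (\<lambda>Y. \<Prod>t\<in>?I. Y t ^ my t)"
    using integrable_gauss_shift[of ?I "\<lambda>_. 0" my] by simp
  have 2: "integrable (measure_pmf ?G) (\<lambda>G. \<Prod>t\<in>layer_pairs L n. h t (G t))"
    by (rule integrable_measure_pmf_finite[OF fin])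
  show "integrable (null_law L lam n p) F"
    unfolding null_law_def *
    by (rule integrable_pair_mult[OF prob_space_gauss_prod measure_pmf.prob_space_axioms 1 2])
  have "integral\<^sup>L (null_law L lam n p) F = (\<integral>Y. (\<Prod>t\<in>?I. Y t ^ my t) \<partial>?Z) *
    measure_pmf.expectation ?G (\<lambda>G. \<Prod>t\<in>layer_pairs L n. h t (G t))"
    unfolding null_law_def *
    by (rule integral_pair_mult[OF prob_space_gauss_prod measure_pmf.prob_space_axioms 1 2])
  also have "(\<integral>Y. (\<Prod>t\<in>?I. Y t ^ my t) \<partial>?Z) = (\<Prod>t\<in>?I. shift_moment (my t) 0)"
    using integral_gauss_shift[of ?I "\<lambda>_. 0" my] by simp
  also have "measure_pmf.expectation ?G (\<lambda>G. \<Prod>t\<in>layer_pairs L n. h t (G t)) =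
    (\<Prod>t\<in>layer_pairs L n. measure_pmf.expectation (bernoulli_pmf (lam (fst t) / real n)) (h t))"
    by (subst expectation_prod_Pi_pmf_signed)
      (auto intro!: prod.cong)
  finally show "integral\<^sup>L (null_law L lam n p) F = (\<Prod>t\<in>{..<n}\<times>{..<p}. shift_moment (my t) 0) *
          (\<Prod>t\<in>layer_pairs L n. measure_pmf.expectation (bernoulli_pmf (lam (fst t) / real n)) (h t))" .
qed

section \<open>Moments of monomials\<close>

text \<open>Given x, z and u, the coordinate of the edge t has mean \<open>mean * sg * ufac\<close>:
  strength, community sign, and the factor u k of a matrix entry.\<close>

definition mean :: "real \<Rightarrow> nat \<Rightarrow> (nat \<Rightarrow> real) \<Rightarrow> (nat \<Rightarrow> real) \<Rightarrow> nat \<times> nat \<times> nat \<Rightarrow> real" where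
  "mean \<mu> n lam eps t = (if fst t = 0 then sqrt (\<mu> / real n) else eps (fst t) * sqrt (lam (fst t) / real n))"

definition sg :: "(nat \<Rightarrow> real) \<Rightarrow> (nat \<times> nat \<Rightarrow> real) \<Rightarrow> nat \<times> nat \<times> nat \<Rightarrow> real" where
  "sg x z = (\<lambda>(l, i, j). if l = 0 then x i else x i * z (l, i) * (x j * z (l, j)))"

definition ufac :: "(nat \<Rightarrow> real) \<Rightarrow> nat \<times> nat \<times> nat \<Rightarrow> real" where
  "ufac u = (\<lambda>(l, i, j). if l = 0 then u j else 1)"

text \<open>Conditional second moment of the coordinate. In layer 0 the sign disappears because x i
  squares to 1. For a graph edge with a = lam l / n and sign s it is ((1 + eps s) a (1 - a)^2 + (1 -
  (1 + eps s) a) a^2) / a, simplified.\<close>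

definition sqmean :: "real \<Rightarrow> nat \<Rightarrow> (nat \<Rightarrow> real) \<Rightarrow> (nat \<Rightarrow> real) \<Rightarrow> (nat \<Rightarrow> real) \<Rightarrow> (nat \<times> nat \<Rightarrow> real)
    \<Rightarrow> (nat \<Rightarrow> real) \<Rightarrow> nat \<times> nat \<times> nat \<Rightarrow> real" where
  "sqmean \<mu> n lam eps x z u t = (if fst t = 0 then 1 + \<mu> / real n * (ufac u t)\<^sup>2
     else (1 - lam (fst t) / real n) + eps (fst t) * (1 - 2 * lam (fst t) / real n) * sg x z t)"

lemma expectation_pmf_cong:
  fixes f g :: "'a \<Rightarrow> real"
  assumes "\<And>d. d \<in> set_pmf D \<Longrightarrow> f d = g d"
  shows "measure_pmf.expectation D f = measure_pmf.expectation D g"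
  by (rule integral_cong_AE) (simp_all add: AE_measure_pmf_iff assms)

lemma expectation_pair_pmf_mult:
  fixes f :: "'a \<Rightarrow> real" and g :: "'b \<Rightarrow> real"
  assumes "finite (set_pmf M)" "finite (set_pmf N)"
  shows "measure_pmf.expectation (pair_pmf M N) (\<lambda>(x, y). f x * g y) =
    measure_pmf.expectation M f * measure_pmf.expectation N g"
  unfolding pair_pmf_def using assms
  by (simp add: expectation_bind_pmf_finite)

text \<open>Even powers of a sign are 1; an odd power of a fair sign averages to 0, and an odd power
  of z to (1 + \<rho>) / 2 - (1 - \<rho>) / 2 = \<rho>.\<close>

lemma expectation_signs_monomial:
  assumes "0 \<le> \<rho>" "\<rho> \<le> 1"
  shows "measure_pmf.expectation (signs L \<rho> n) (\<lambda>(x, z). (\<Prod>i<n. x i ^ d i) * (\<Prod>t\<in>{1..L}\<times>{..<n}. z t ^ e t)) =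
    (\<Prod>i<n. of_bool (even (d i))) * (\<Prod>t\<in>{1..L}\<times>{..<n}. if even (e t) then 1 else \<rho>)"
proof -
  let ?X = "pmf_of_set ({..<n} \<rightarrow>\<^sub>E {- 1, 1 :: real})"
  let ?p = "\<lambda>_. map_pmf (\<lambda>b. if b then 1 else - 1 :: real) (bernoulli_pmf ((1 + \<rho>) / 2))"
  let ?Z = "Pi_pmf ({1..L} \<times> {..<n}) 0 ?p"
  \<comment> \<open>The uniform law on extensional sign functions is a product law with default
    value \<open>undefined\<close>; this supplies the independence of the x i.\<close>
  have X: "?X = Pi_pmf {..<n} undefined (\<lambda>_. pmf_of_set {-1, 1})"
  proof -
    have "PiE_dflt {..<n} undefined (\<lambda>_. {- 1, 1}) = ({..<n} \<rightarrow>\<^sub>E {- 1, 1 :: real})"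
      by (auto simp: PiE_dflt_def PiE_def extensional_def Pi_def)
    then show ?thesis by (subst Pi_pmf_of_set) auto
  qed
  have fX: "finite (set_pmf ?X)"
    by (simp only: set_pmf_of_set[OF sign_functions_nonempty finite_sign_functions] finite_sign_functions)
  have fZ: "finite (set_pmf ?Z)"
    by (subst set_Pi_pmf, simp, rule finite_PiE_dflt) (auto simp del: set_pmf_bernoulli)
  have 1: "measure_pmf.expectation ?X (\<lambda>x. \<Prod>i<n. x i ^ d i) = (\<Prod>i<n. of_bool (even (d i)))"
  proof -
    have "measure_pmf.expectation ?X (\<lambda>x. \<Prod>i<n. x i ^ d i) =
      (\<Prod>i<n. measure_pmf.expectation (pmf_of_set {-1, 1}) (\<lambda>x. x ^ d i))"
      unfolding X by (rule expectation_prod_Pi_pmf_signed) auto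
    also have "\<dots> = (\<Prod>i<n. of_bool (even (d i)))"
      by (intro prod.cong refl) (simp add: integral_pmf_of_set)
    finally show ?thesis .
  qed
  have 2: "measure_pmf.expectation ?Z (\<lambda>z. \<Prod>t\<in>{1..L}\<times>{..<n}. z t ^ e t) =
      (\<Prod>t\<in>{1..L}\<times>{..<n}. if even (e t) then 1 else \<rho>)"
  proof -
    have "measure_pmf.expectation ?Z (\<lambda>z. \<Prod>t\<in>{1..L}\<times>{..<n}. z t ^ e t) =
      (\<Prod>t\<in>{1..L}\<times>{..<n}. measure_pmf.expectation (?p t) (\<lambda>y. y ^ e t))"
      by (rule expectation_prod_Pi_pmf_signed[of _ "\<lambda>_. ?p ()"]) (auto simp del: set_pmf_bernoulli)
    also have "\<dots> = (\<Prod>t\<in>{1..L}\<times>{..<n}. if even (e t) then 1 else \<rho>)"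
      using assms by (intro prod.cong refl) (simp add: integral_bernoulli_pmf field_simps)
    finally show ?thesis .
  qed
  show ?thesis
    unfolding signs_def expectation_pair_pmf_mult[OF fX fZ] 1 2 ..
qed

text \<open>Indicator factors over all vertices and all pairs (layer, vertex) allow products over
  edges to be interchanged with products over vertices.\<close>

lemma sg_eq:
  assumes "t \<in> codes L n p"
  shows "sg x z t = (\<Prod>i<n. if VA i \<in> ends t then x i else 1) *
     (\<Prod>s\<in>{1..L}\<times>{..<n}. if fst t = fst s \<and> VA (snd s) \<in> ends t then z s else 1)"
proof -
  obtain l i j where t: "t = (l, i, j)" by (cases t)
  have 1: "(\<Prod>i<n. if VA i \<in> ends t then x i else 1) = (\<Prod>i\<in>{i\<in>{..<n}. VA i \<in> ends t}. x i)"
    by (simp only: prod.inter_filter finite_lessThan)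
  have 2: "(\<Prod>s\<in>{1..L}\<times>{..<n}. if fst t = fst s \<and> VA (snd s) \<in> ends t then z s else 1) =
      (\<Prod>s\<in>{s\<in>{1..L}\<times>{..<n}. fst t = fst s \<and> VA (snd s) \<in> ends t}. z s)"
    by (subst prod.inter_filter) auto
  show ?thesis
  proof (cases "l = 0")
    case True
    have "{i\<in>{..<n}. VA i \<in> ends t} = {i}" "{s\<in>{1..L}\<times>{..<n}. fst t = fst s \<and> VA (snd s) \<in> ends t} = {}"
      using assms True by (auto simp: t mem_codes VA_in_ends)
    then show ?thesis unfolding 1 2 using True by (simp only: sg_def t case_prod_conv if_True) simp
  next
    case False
    have "i \<noteq> j" using assms False by (auto simp: t mem_codes)
    moreover have "{i\<in>{..<n}. VA i \<in> ends t} = {i, j}" "{s\<in>{1..L}\<times>{..<n}. fst t = fst s \<and> VA (snd s) \<in> ends t} = {(l, i), (l, j)}"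
      using assms False by (auto simp: t mem_codes VA_in_ends)
    ultimately show ?thesis unfolding 1 2 using False by (simp add: sg_def t)
  qed
qed

lemma prod_sg_eq:
  assumes "F \<subseteq> codes L n p"
  shows "(\<Prod>t\<in>F. sg x z t) = (\<Prod>i<n. x i ^ deg F (VA i)) * (\<Prod>s\<in>{1..L}\<times>{..<n}. z s ^ ldeg F (fst s) (snd s))"
proof -
  have fin: "finite F" using assms finite_subset finite_codes by blast
  have "(\<Prod>t\<in>F. sg x z t) = (\<Prod>t\<in>F. (\<Prod>i<n. if VA i \<in> ends t then x i else 1) *
     (\<Prod>s\<in>{1..L}\<times>{..<n}. if fst t = fst s \<and> VA (snd s) \<in> ends t then z s else 1))"
    using assms by (intro prod.cong refl sg_eq) auto
  also have "\<dots> = (\<Prod>i<n. \<Prod>t\<in>F. if VA i \<in> ends t then x i else 1) *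
     (\<Prod>s\<in>{1..L}\<times>{..<n}. \<Prod>t\<in>F. if fst t = fst s \<and> VA (snd s) \<in> ends t then z s else 1)"
    unfolding prod.distrib by (rule arg_cong2[where f = times]; rule prod.swap)
  also have "\<dots> = (\<Prod>i<n. x i ^ deg F (VA i)) * (\<Prod>s\<in>{1..L}\<times>{..<n}. z s ^ ldeg F (fst s) (snd s))"
    using fin by (simp add: prod.inter_filter[symmetric] deg_def ldeg_def)
  finally show ?thesis .
qed

lemma expectation_signs_sg:
  assumes "F \<subseteq> codes L n p" "0 \<le> \<rho>" "\<rho> \<le> 1"
  shows "measure_pmf.expectation (signs L \<rho> n) (\<lambda>(x, z). \<Prod>t\<in>F. sg x z t) =
     (if \<forall>i<n. even (deg F (VA i)) then \<rho> ^ odd_count L n F else 0)"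
proof -
  have "measure_pmf.expectation (signs L \<rho> n) (\<lambda>(x, z). \<Prod>t\<in>F. sg x z t) =
     (\<Prod>i<n. of_bool (even (deg F (VA i)))) * (\<Prod>s\<in>{1..L}\<times>{..<n}. if even (ldeg F (fst s) (snd s)) then 1 else \<rho>)"
    unfolding prod_sg_eq[OF assms(1)] by (rule expectation_signs_monomial[OF assms(2,3)])
  also have "(\<Prod>i<n. of_bool (even (deg F (VA i)))) = (of_bool (\<forall>i<n. even (deg F (VA i))) :: real)"
    by (auto simp: prod_zero_iff)
  also have "(\<Prod>s\<in>{1..L}\<times>{..<n}. if even (ldeg F (fst s) (snd s)) then 1 else \<rho>) =
      (\<Prod>s\<in>{1..L}\<times>{..<n}. if odd (ldeg F (fst s) (snd s)) then \<rho> else 1)"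
    by (intro prod.cong) auto
  also have "\<dots> = \<rho> ^ odd_count L n F"
    unfolding odd_count_def by (subst prod.inter_filter[symmetric]) (auto intro!: arg_cong[where f = "\<lambda>A. \<rho> ^ card A"])
  finally show ?thesis by simp
qed

text \<open>\<open>large\<close> keeps the edge probabilities at most 1, so that the truncation in
  \<open>bernoulli_pmf\<close> does nothing; \<open>mu_le\<close> bounds the squared signal strength
  of an entry by 1. Both hold for all large n.\<close>

locale planted_model =
  fixes L n p :: nat and \<mu> \<rho> :: real and lam eps :: "nat \<Rightarrow> real"
  assumes n_pos: "n > 0" and mu_pos: "\<mu> > 0" and rho: "0 < \<rho>" "\<rho> \<le> 1"
    and lam_pos: "\<And>l. l \<in> {1..L} \<Longrightarrow> lam l > 0"
    and eps01: "\<And>l. l \<in> {1..L} \<Longrightarrow> 0 < eps l \<and> eps l < 1"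
    and large: "\<And>l. l \<in> {1..L} \<Longrightarrow> (1 + eps l) * lam l \<le> real n" and mu_le: "\<mu> \<le> real n"
begin

abbreviation "PL \<equiv> planted_law L \<mu> \<rho> lam eps n p"
abbreviation "QL \<equiv> null_law L lam n p"
abbreviation "mo \<equiv> monom_of lam n"
abbreviation "mn \<equiv> mean \<mu> n lam eps"
abbreviation "sq \<equiv> sqmean \<mu> n lam eps"
abbreviation "US \<equiv> gauss_prod {..<p}"
abbreviation "cds \<equiv> codes L n p"

definition mlt :: "(nat \<times> nat \<times> nat) set \<Rightarrow> (nat \<times> nat \<times> nat) set \<Rightarrow> nat \<times> nat \<times> nat \<Rightarrow> nat" where
  "mlt S K t = of_bool (t \<in> S) + of_bool (t \<in> K)"

definition gfun :: "nat \<Rightarrow> nat \<times> nat \<times> nat \<Rightarrow> bool \<Rightarrow> real" where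
  "gfun m t b = ((of_bool b - lam (fst t) / real n) / sqrt (lam (fst t) / real n)) ^ m"

lemma lam_le: "l \<in> {1..L} \<Longrightarrow> lam l \<le> real n"
proof -
  assume l: "l \<in> {1..L}"
  have "lam l * 1 \<le> lam l * (1 + eps l)"
    using eps01[OF l] lam_pos[OF l] by (intro mult_left_mono) auto
  then show ?thesis using large[OF l] by (simp add: mult.commute)
qed

text \<open>One Bernoulli variable with success probability (1 + eps s) a, where s is the edge sign
  and a = lam l / n, carries all three moments. The \<open>u\<close> in the last one is arbitrary:
  \<open>sqmean\<close> depends on it in layer 0 only.\<close>

lemma edge_moments:
  assumes t: "t \<in> layer_pairs L n" and xz: "(x, z) \<in> set_pmf (signs L \<rho> n)"
  shows "measure_pmf.expectation (edge_pmf lam eps n x z t) (gfun 0 t) = 1"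
    and "measure_pmf.expectation (edge_pmf lam eps n x z t) (gfun (Suc 0) t) = mn t * sg x z t"
    and "measure_pmf.expectation (edge_pmf lam eps n x z t) (gfun 2 t) = sq x z u t"
proof -
  obtain l i j where tt: "t = (l, i, j)" by (cases t)
  have l: "l \<in> {1..L}" "i < n" "j < n" "l \<noteq> 0" using t by (auto simp: tt layer_pairs_def)
  define a where "a = lam l / real n"
  have a: "a > 0" using lam_pos[OF l(1)] n_pos by (simp add: a_def)
  note e = eps01[OF l(1)]
  have sa: "sqrt a * sqrt a = a" "sqrt a > 0" using a by auto
  have le1: "(1 + eps l) * a \<le> 1"
    using large[OF l(1)] n_pos by (simp add: a_def)
  then have le2: "(1 - eps l) * a \<le> 1"
    by (smt (verit, best) a e mult_right_mono)
  have sgn: "x i \<in> {-1, 1}" "x j \<in> {-1, 1}" "z (l, i) \<in> {-1, 1}" "z (l, j) \<in> {-1, 1}"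
    using set_signsD[OF xz] l by auto
  define s where "s = sg x z t"
  have s: "s = (if x i * z (l, i) = x j * z (l, j) then 1 else -1)"
    using sgn l by (auto simp: s_def sg_def tt)
  have E: "measure_pmf.expectation (edge_pmf lam eps n x z t) f =
      (1 + eps l * s) * a * f True + (1 - (1 + eps l * s) * a) * f False" for f :: "bool \<Rightarrow> real"
  proof -
    have "edge_pmf lam eps n x z t = bernoulli_pmf ((1 + eps l * s) * a)"
      by (simp add: edge_pmf_def tt s a_def)
    moreover have "0 \<le> (1 + eps l * s) * a" "(1 + eps l * s) * a \<le> 1"
      using le1 le2 a e by (auto simp: s)
    ultimately show ?thesis by (simp add: integral_bernoulli_pmf)
  qed
  show "measure_pmf.expectation (edge_pmf lam eps n x z t) (gfun 0 t) = 1"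
    unfolding E by (simp add: gfun_def)
  have "measure_pmf.expectation (edge_pmf lam eps n x z t) (gfun (Suc 0) t) = eps l * s * a / sqrt a"
    unfolding E using sa(2) by (simp add: gfun_def tt a_def[symmetric] field_simps)
  also have "\<dots> = eps l * sqrt a * s" using sa by (simp add: field_simps)
  finally show "measure_pmf.expectation (edge_pmf lam eps n x z t) (gfun (Suc 0) t) = mn t * sg x z t"
    using l by (simp add: mean_def tt a_def s_def)
  have "measure_pmf.expectation (edge_pmf lam eps n x z t) (gfun 2 t) =
      ((1 + eps l * s) * a * (1 - a)\<^sup>2 + (1 - (1 + eps l * s) * a) * a\<^sup>2) / a"
    unfolding E using a by (simp add: gfun_def tt a_def[symmetric] power_divide add_divide_distrib)
  also have "\<dots> = (1 - a) + eps l * (1 - 2 * a) * s"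
    using a by (simp add: field_simps power2_eq_square)
  finally show "measure_pmf.expectation (edge_pmf lam eps n x z t) (gfun 2 t) = sq x z u t"
    using l by (simp add: sqmean_def tt a_def s_def)
qed

lemma monom_mult_eq:
  assumes "S \<subseteq> cds" "K \<subseteq> cds"
  shows "mo S \<omega> * mo K \<omega> = (\<Prod>t\<in>{..<n}\<times>{..<p}. fst \<omega> t ^ mlt S K (0, t)) *
    (\<Prod>t\<in>layer_pairs L n. gfun (mlt S K t) t (snd \<omega> t))"
proof -
  have *: "mo T \<omega> = (\<Prod>t\<in>cds. obsv lam n \<omega> t ^ of_bool (t \<in> T))" if "T \<subseteq> cds" for T
    unfolding monom_of_def using that
    by (auto simp: prod.inter_restrict[symmetric] Int_absorb1 of_bool_def if_distrib[of "power _"] cong: if_cong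
      intro!: prod.mono_neutral_cong_left)
  have "mo S \<omega> * mo K \<omega> = (\<Prod>t\<in>cds. obsv lam n \<omega> t ^ mlt S K t)"
    using assms by (simp add: * prod.distrib[symmetric] mlt_def power_add)
  also have "\<dots> = (\<Prod>t\<in>{..<n}\<times>{..<p}. fst \<omega> t ^ mlt S K (0, t)) *
    (\<Prod>t\<in>layer_pairs L n. gfun (mlt S K t) t (snd \<omega> t))"
    unfolding prod_codes
    by (intro arg_cong2[where f = times] prod.cong refl)
      (auto simp: obsv_def layer_pairs_def gfun_def Gbar_def)
  finally show ?thesis .
qed

lemma integrable_planted_pair:
  assumes "S \<subseteq> cds" "K \<subseteq> cds"
  shows "integrable PL (\<lambda>\<omega>. mo S \<omega> * mo K \<omega>)"
  unfolding monom_mult_eq[OF assms] by (rule integrable_planted_monomial)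

lemma integrable_null_pair:
  assumes "S \<subseteq> cds" "K \<subseteq> cds"
  shows "integrable QL (\<lambda>\<omega>. mo S \<omega> * mo K \<omega>)"
  unfolding monom_mult_eq[OF assms] by (rule integrable_null_monomial)

lemma measurable_monom:
  assumes "S \<subseteq> cds"
  shows "mo S \<in> borel_measurable (obs_space n p)"
proof -
  \<comment> \<open>The empty monomial is 1, so the product form for pairs covers single
    monomials.\<close>
  have "mo S = (\<lambda>\<omega>. mo S \<omega> * mo {} \<omega>)" by (simp add: monom_of_def fun_eq_iff)
  then show ?thesis
    using monom_mult_eq[OF assms, of "{}"]
      measurable_obs_monomial[where my = "\<lambda>t. mlt S {} (0, t)" and h = "\<lambda>G. \<Prod>t\<in>layer_pairs L n. gfun (mlt S {} t) t (G t)"]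
    by simp
qed

text \<open>An edge in exactly one of S and K contributes its conditional mean, a shared edge its
  conditional second moment. Edges in a common column keep the integral over u from splitting edge
  by edge.\<close>

lemma integral_planted_pair:
  assumes "S \<subseteq> cds" "K \<subseteq> cds"
  shows "(\<integral>\<omega>. mo S \<omega> * mo K \<omega> \<partial>PL) =
     measure_pmf.expectation (signs L \<rho> n) (\<lambda>(x, z). \<integral>u. (\<Prod>t\<in>(S - K) \<union> (K - S). mn t * sg x z t * ufac u t) *
       (\<Prod>t\<in>S \<inter> K. sq x z u t) \<partial>US)"
proof -
  have eq: "(\<integral>u. (\<Prod>t\<in>{..<n}\<times>{..<p}. shift_moment (mlt S K (0, t)) (sqrt (\<mu> / real n) * x (fst t) * u (snd t))) \<partial>US) *
      (\<Prod>t\<in>layer_pairs L n. measure_pmf.expectation (edge_pmf lam eps n x z t) (gfun (mlt S K t) t)) =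
      (\<integral>u. (\<Prod>t\<in>(S - K) \<union> (K - S). mn t * sg x z t * ufac u t) * (\<Prod>t\<in>S \<inter> K. sq x z u t) \<partial>US)"
    if xz: "(x, z) \<in> set_pmf (signs L \<rho> n)" for x z
  proof -
    define c where "c u t = (if t \<in> S \<inter> K then sq x z u t else if t \<in> S \<union> K then mn t * sg x z t * ufac u t else 1)" for u t
    have 1: "shift_moment (mlt S K (0, t)) (sqrt (\<mu> / real n) * x (fst t) * u (snd t)) = c u (0, t)"
      if "t \<in> {..<n}\<times>{..<p}" for t u
    proof -
      have "x (fst t) \<in> {-1, 1}" by (rule set_signsD(1)[OF xz]) (use that in auto)
      then have "(x (fst t))\<^sup>2 = 1" by auto
      moreover have f: "sg x z (0, t) = x (fst t)" "ufac u (0, t) = u (snd t)"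
        by (cases t; simp add: sg_def ufac_def)+
      moreover have "(sqrt (\<mu> / real n))\<^sup>2 = \<mu> / real n" using mu_pos by simp
      ultimately have "shift_moment 2 (sqrt (\<mu> / real n) * x (fst t) * u (snd t)) = sq x z u (0, t)"
        by (simp add: sqmean_def power_mult_distrib)
      moreover have "sqrt (\<mu> / real n) * x (fst t) * u (snd t) = mn (0, t) * sg x z (0, t) * ufac u (0, t)"
        by (simp add: mean_def f)
      moreover have "mlt S K (0, t) = 0 \<and> c u (0, t) = 1
        \<or> mlt S K (0, t) = Suc 0 \<and> c u (0, t) = mn (0, t) * sg x z (0, t) * ufac u (0, t)
        \<or> mlt S K (0, t) = 2 \<and> c u (0, t) = sq x z u (0, t)"
        unfolding c_def mlt_def by (cases "(0, t) \<in> S"; cases "(0, t) \<in> K") simp_all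
      ultimately show ?thesis by (elim disjE conjE) simp_all
    qed
    have 2: "measure_pmf.expectation (edge_pmf lam eps n x z t) (gfun (mlt S K t) t) = c u t"
      if "t \<in> layer_pairs L n" for t u
    proof -
      have "ufac u t = 1" using that by (auto simp: ufac_def layer_pairs_def)
      then show ?thesis
        using edge_moments(1,2)[OF that xz] edge_moments(3)[OF that xz, of u]
        by (cases "t \<in> S"; cases "t \<in> K") (simp_all add: c_def mlt_def numeral_2_eq_2)
    qed
    have c: "(\<Prod>t\<in>cds. c u t) = (\<Prod>t\<in>(S - K) \<union> (K - S). mn t * sg x z t * ufac u t) * (\<Prod>t\<in>S \<inter> K. sq x z u t)" for u
    proof -
      have fin: "finite S" "finite K"
        using finite_subset[OF assms(1) finite_codes] finite_subset[OF assms(2) finite_codes] .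
      have "(\<Prod>t\<in>cds. c u t) = (\<Prod>t\<in>((S - K) \<union> (K - S)) \<union> (S \<inter> K). c u t)"
      proof -
        have sub: "(S - K) \<union> (K - S) \<union> (S \<inter> K) \<subseteq> cds" using assms by blast
        have 1: "\<forall>t\<in> cds - ((S - K) \<union> (K - S) \<union> (S \<inter> K)). c u t = 1"
          by (auto simp only: c_def Un_iff Int_iff Diff_iff simp_thms if_False)
        show ?thesis
          by (rule prod.mono_neutral_right[OF finite_codes sub 1])
      qed
      also have "\<dots> = (\<Prod>t\<in>(S - K) \<union> (K - S). c u t) * (\<Prod>t\<in>S \<inter> K. c u t)"
        by (rule prod.union_disjoint) (simp add: fin, simp add: fin, blast)
      also have "\<dots> = (\<Prod>t\<in>(S - K) \<union> (K - S). mn t * sg x z t * ufac u t) * (\<Prod>t\<in>S \<inter> K. sq x z u t)"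
        by (rule arg_cong2[where f = times]; rule prod.cong; simp add: c_def) blast
      finally show ?thesis .
    qed
    have "(\<integral>u. (\<Prod>t\<in>{..<n}\<times>{..<p}. shift_moment (mlt S K (0, t)) (sqrt (\<mu> / real n) * x (fst t) * u (snd t))) \<partial>US) *
      (\<Prod>t\<in>layer_pairs L n. measure_pmf.expectation (edge_pmf lam eps n x z t) (gfun (mlt S K t) t)) =
      (\<integral>u. (\<Prod>t\<in>{..<n}\<times>{..<p}. shift_moment (mlt S K (0, t)) (sqrt (\<mu> / real n) * x (fst t) * u (snd t))) *
      (\<Prod>t\<in>layer_pairs L n. measure_pmf.expectation (edge_pmf lam eps n x z t) (gfun (mlt S K t) t)) \<partial>US)"
      by simp
    also have "\<dots> = (\<integral>u. (\<Prod>t\<in>cds. c u t) \<partial>US)"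
      unfolding prod_codes
      by (intro Bochner_Integration.integral_cong arg_cong2[where f = times] prod.cong refl) (auto simp only: 1 2)
    also have "\<dots> = (\<integral>u. (\<Prod>t\<in>(S - K) \<union> (K - S). mn t * sg x z t * ufac u t) * (\<Prod>t\<in>S \<inter> K. sq x z u t) \<partial>US)"
      by (simp only: c)
    finally show ?thesis .
  qed
  show ?thesis
    unfolding monom_mult_eq[OF assms]
      integral_planted_monomial[where my = "\<lambda>t. mlt S K (0, t)" and h = "\<lambda>t. gfun (mlt S K t) t"]
    by (rule expectation_pmf_cong) (simp only: split_paired_all case_prod_conv eq)
qed

end

section \<open>Bounds for planted means, squares and mixed moments, and null moments\<close>

lemma integrable_std_gauss_1_plus_sq: "integrable std_gauss (\<lambda>t. (1 + a * t\<^sup>2) ^ k :: real)"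
proof -
  have "(\<lambda>t :: real. (1 + a * t\<^sup>2) ^ k) = (\<lambda>t. \<Sum>j\<le>k. (real (k choose j) * a ^ (k - j)) * t ^ (2 * (k - j)))"
    by (simp add: binomial_ring power_mult_distrib power_mult mult.assoc)
  then show ?thesis by simp
qed

text \<open>The exponent 4 is the largest degree of a b-vertex in the union of two cycles, each of
  which has degree at most 2 there.\<close>

definition gauss_const :: real where
  "gauss_const = (\<integral>t. (1 + t\<^sup>2) ^ 4 \<partial>std_gauss)"

lemma integral_1_plus_sq_le:
  assumes "d \<le> 4"
  shows "(\<integral>t. (1 + t\<^sup>2) ^ d \<partial>std_gauss) \<le> gauss_const"
  unfolding gauss_const_def
  using integrable_std_gauss_1_plus_sq[of 1] assms
  by (intro integral_mono power_increasing) auto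

lemma gauss_const_ge_1: "gauss_const \<ge> 1"
  using integral_1_plus_sq_le[of 0] by simp

lemma integral_gauss_prod_prod:
  fixes f :: "nat \<Rightarrow> real \<Rightarrow> real"
  assumes "\<And>k. k < p \<Longrightarrow> integrable std_gauss (f k)"
  shows "(\<integral>u. (\<Prod>k<p. f k (u k)) \<partial>gauss_prod {..<p}) = (\<Prod>k<p. integral\<^sup>L std_gauss (f k))"
  by (rule gauss.product_integral_prod) (use assms in auto)

lemma integrable_gauss_prod_prod:
  fixes f :: "nat \<Rightarrow> real \<Rightarrow> real"
  assumes "\<And>k. k < p \<Longrightarrow> integrable std_gauss (f k)"
  shows "integrable (gauss_prod {..<p}) (\<lambda>u. \<Prod>k<p. f k (u k))"
  by (rule gauss.product_integrable_prod) (use assms in auto)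

text \<open>Each layer-0 edge ends in exactly one column. Regrouping by column lets the independent
  u k be integrated one at a time.\<close>

lemma prod_layer0_eq:
  fixes g :: "nat \<Rightarrow> real"
  assumes "T \<subseteq> codes L n p"
  shows "(\<Prod>t\<in>T. if fst t = 0 then g (snd (snd t)) else 1) = (\<Prod>k<p. g k ^ deg T (VB k))"
proof -
  have fin: "finite T" by (rule finite_subset[OF assms finite_codes])
  have "(\<Prod>t\<in>T. if fst t = 0 then g (snd (snd t)) else 1) =
      (\<Prod>t\<in>T. \<Prod>k<p. if VB k \<in> ends t then g k else 1)"
  proof (rule prod.cong[OF refl])
    fix t assume "t \<in> T"
    then have t: "t \<in> codes L n p" using assms by auto
    show "(if fst t = 0 then g (snd (snd t)) else 1) = (\<Prod>k<p. if VB k \<in> ends t then g k else 1)"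
    proof (cases "fst t = 0")
      case True
      then have "snd (snd t) < p" using t by (cases t) (auto simp: mem_codes)
      then show ?thesis using True by (simp add: VB_in_ends)
    qed (simp add: VB_in_ends)
  qed
  also have "\<dots> = (\<Prod>k<p. \<Prod>t\<in>T. if VB k \<in> ends t then g k else 1)"
    by (rule prod.swap)
  also have "\<dots> = (\<Prod>k<p. g k ^ deg T (VB k))"
    using fin by (simp add: prod.inter_filter[symmetric] deg_def)
  finally show ?thesis .
qed

lemma card_touched_le:
  assumes "finite T"
  shows "card {k. k < p \<and> deg T (VB k) \<noteq> 0} \<le> card T"
proof -
  have "{k. k < p \<and> deg T (VB k) \<noteq> 0} \<subseteq> (\<lambda>t. snd (snd t)) ` T"
  proof
    fix k assume "k \<in> {k. k < p \<and> deg T (VB k) \<noteq> 0}"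
    then have "{t \<in> T. VB k \<in> ends t} \<noteq> {}" unfolding deg_def by force
    then obtain t where "t \<in> T" "snd (snd t) = k" by (auto simp: VB_in_ends)
    then show "k \<in> (\<lambda>t. snd (snd t)) ` T" by blast
  qed
  then show ?thesis using assms surj_card_le by blast
qed

context planted_model
begin

text \<open>For a cycle this is both the planted mean of its monomial
  (\<open>expectation_planted_monom\<close>) and its coefficient in the statistic before
  normalisation (\<open>coef_eq_val\<close>).\<close>

definition val :: "(nat \<times> nat \<times> nat) set \<Rightarrow> real" where
  "val T = (\<Prod>t\<in>T. mn t) * \<rho> ^ odd_count L n T"

lemma finite_cds_subset: "T \<subseteq> cds \<Longrightarrow> finite T"
  by (erule finite_subset) simp

lemma fst_cds: "t \<in> cds \<Longrightarrow> fst t \<noteq> 0 \<Longrightarrow> fst t \<in> {1..L}"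
  by (cases t) (auto simp: mem_codes)

lemma mean_nonneg: "t \<in> cds \<Longrightarrow> 0 \<le> mn t"
  using mu_pos fst_cds[of t] lam_pos[of "fst t"] eps01[of "fst t"] by (auto simp: mean_def)

lemma val_nonneg: "T \<subseteq> cds \<Longrightarrow> 0 \<le> val T"
  unfolding val_def using rho by (intro mult_nonneg_nonneg prod_nonneg mean_nonneg) auto

lemma monom_empty [simp]: "mo {} \<omega> = 1"
  by (simp add: monom_of_def)

lemma integrable_planted_monom: "T \<subseteq> cds \<Longrightarrow> integrable PL (mo T)"
  using integrable_planted_pair[of T "{}"] by simp

text \<open>Every u k occurs to the power 0 or 2 and has second moment 1, every x i occurs to an
  even power, and the odd powers of z account for the \<rho>-factor of \<open>val\<close>.\<close>

lemma expectation_planted_monom: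
  assumes T: "T \<subseteq> cds" and b: "\<And>k. k < p \<Longrightarrow> deg T (VB k) \<in> {0, 2}"
    and a: "\<And>i. i < n \<Longrightarrow> even (deg T (VA i))"
  shows "integral\<^sup>L PL (mo T) = val T"
proof -
  have u: "(\<integral>u. (\<Prod>t\<in>T. ufac u t) \<partial>US) = 1"
  proof -
    have "(\<Prod>t\<in>T. ufac u t) = (\<Prod>k<p. u k ^ deg T (VB k))" for u
      using prod_layer0_eq[OF T, of u] by (simp add: ufac_def case_prod_beta)
    moreover have "integral\<^sup>L std_gauss (\<lambda>t. t ^ deg T (VB k)) = 1" if "k < p" for k
      using b[OF that] by auto
    ultimately show ?thesis
      using integral_gauss_prod_prod[of p "\<lambda>k t. t ^ deg T (VB k)"] by simp
  qed
  have "integral\<^sup>L PL (mo T) = (\<integral>\<omega>. mo T \<omega> * mo {} \<omega> \<partial>PL)" by simp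
  also have "\<dots> = measure_pmf.expectation (signs L \<rho> n) (\<lambda>(x, z). \<integral>u. (\<Prod>t\<in>T. mn t * sg x z t * ufac u t) \<partial>US)"
    by (subst integral_planted_pair) (use T in auto)
  also have "(\<lambda>(x, z). \<integral>u. (\<Prod>t\<in>T. mn t * sg x z t * ufac u t) \<partial>US) = (\<lambda>w. (\<Prod>t\<in>T. mn t) * (case w of (x, z) \<Rightarrow> \<Prod>t\<in>T. sg x z t))"
    by (auto simp: prod.distrib u)
  also have "measure_pmf.expectation (signs L \<rho> n) \<dots> = (\<Prod>t\<in>T. mn t) * measure_pmf.expectation (signs L \<rho> n) (\<lambda>(x, z). \<Prod>t\<in>T. sg x z t)"
    by simp
  also have "\<dots> = val T"
    using expectation_signs_sg[OF T] rho a by (simp add: val_def)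
  finally show ?thesis .
qed

lemma sqmean_bounds:
  assumes "t \<in> cds" "fst t \<noteq> 0"
  shows "0 \<le> 1 - lam (fst t) / real n" "1 - lam (fst t) / real n \<le> 1"
    "\<bar>eps (fst t) * (1 - 2 * lam (fst t) / real n)\<bar> \<le> 1"
proof -
  let ?l = "fst t"
  have l: "?l \<in> {1..L}" using fst_cds assms by blast
  have a: "0 < lam ?l / real n" "lam ?l / real n \<le> 1"
    using lam_pos[OF l] lam_le[OF l] n_pos by auto
  then show "0 \<le> 1 - lam (fst t) / real n" "1 - lam (fst t) / real n \<le> 1" by auto
  have "\<bar>1 - 2 * lam ?l / real n\<bar> \<le> 1" using a by (simp add: abs_if)
  then have "\<bar>eps ?l\<bar> * \<bar>1 - 2 * lam ?l / real n\<bar> \<le> 1 * 1"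
    using eps01[OF l] by (intro mult_mono) auto
  then show "\<bar>eps (fst t) * (1 - 2 * lam (fst t) / real n)\<bar> \<le> 1" by (simp add: abs_mult)
qed

text \<open>Layer-0 edges have sign-free conditional second moments and cost only a column factor,
  so the expansion concerns graph layers alone. A set of graph-layer edges that is even at all
  a-vertices is even everywhere, having no b-end, so \<open>conn\<close> leaves at most two terms,
  each bounded by 1.\<close>

lemma second_moment_planted:
  assumes T: "T \<subseteq> cds" and b: "\<And>k. k < p \<Longrightarrow> deg T (VB k) \<in> {0, 2}"
    and conn: "\<And>F. F \<subseteq> T \<Longrightarrow> F \<noteq> {} \<Longrightarrow> (\<And>v. even (deg F v)) \<Longrightarrow> F = T"
  shows "(\<integral>\<omega>. mo T \<omega> * mo T \<omega> \<partial>PL) \<le> 2 * (1 + 5 * \<mu> / real n) ^ card T"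
proof -
  define Ta where "Ta = {t\<in>T. fst t \<noteq> 0}"
  have Ta: "Ta \<subseteq> cds" "finite Ta" using T finite_cds_subset[OF T] by (auto simp: Ta_def)
  define A where "A t = 1 - lam (fst t) / real n" for t :: "nat \<times> nat \<times> nat"
  define B where "B t = eps (fst t) * (1 - 2 * lam (fst t) / real n)" for t :: "nat \<times> nat \<times> nat"
  have AB: "0 \<le> A t" "A t \<le> 1" "\<bar>B t\<bar> \<le> 1" if "t \<in> Ta" for t
    using sqmean_bounds[of t] that T unfolding A_def B_def Ta_def by auto
  define c where "c = \<mu> / real n"
  have c: "0 \<le> c" "c \<le> 1" using mu_pos mu_le n_pos by (auto simp: c_def)
  define m where "m = (\<Prod>k<p. \<integral>t. (1 + c * t\<^sup>2) ^ deg T (VB k) \<partial>std_gauss)"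
  \<comment> \<open>Since c \<le> 1, this is at most 1 + 5 c, the factor charged to each column that
    T touches.\<close>
  have m2: "(\<integral>t. (1 + c * t\<^sup>2) ^ 2 \<partial>std_gauss) = 1 + 2 * c + 3 * c\<^sup>2"
  proof -
    have "(\<lambda>t. (1 + c * t\<^sup>2) ^ 2) = (\<lambda>t. 1 + (2 * c) * t\<^sup>2 + c\<^sup>2 * t ^ 4)"
      by (auto simp: power2_eq_square power4_eq_xxxx algebra_simps)
    then show ?thesis by simp
  qed
  have m: "0 \<le> m" "m \<le> (1 + 5 * c) ^ card T"
  proof -
    have i: "0 \<le> (\<integral>t. (1 + c * t\<^sup>2) ^ deg T (VB k) \<partial>std_gauss)
       \<and> (\<integral>t. (1 + c * t\<^sup>2) ^ deg T (VB k) \<partial>std_gauss) \<le> (if deg T (VB k) \<noteq> 0 then 1 + 5 * c else 1)" if "k < p" for k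
    proof -
      have "c\<^sup>2 \<le> c" using c mult_left_mono[of c 1 c] by (simp add: power2_eq_square)
      then show ?thesis using b[OF that] m2 c by auto
    qed
    show "0 \<le> m" unfolding m_def using i by (intro prod_nonneg) auto
    have "m \<le> (\<Prod>k<p. if deg T (VB k) \<noteq> 0 then 1 + 5 * c else 1)"
      unfolding m_def using i by (intro prod_mono) auto
    also have "\<dots> = (1 + 5 * c) ^ card {k. k < p \<and> deg T (VB k) \<noteq> 0}"
      by (subst prod.inter_filter[symmetric]) (auto intro!: arg_cong[where f = "\<lambda>A. _ ^ card A"])
    also have "\<dots> \<le> (1 + 5 * c) ^ card T"
      using c card_touched_le[OF finite_cds_subset[OF T]] by (intro power_increasing) auto
    finally show "m \<le> (1 + 5 * c) ^ card T" .
  qed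
  have inner: "(\<integral>u. (\<Prod>t\<in>T. sq x z u t) \<partial>US) = m * (\<Prod>t\<in>Ta. A t + B t * sg x z t)" for x z
  proof -
    have "(\<Prod>t\<in>T. sq x z u t) = (\<Prod>k<p. (1 + c * (u k)\<^sup>2) ^ deg T (VB k)) * (\<Prod>t\<in>Ta. A t + B t * sg x z t)" for u
    proof -
      have "(\<Prod>t\<in>T. sq x z u t) = (\<Prod>t\<in>T. (if fst t = 0 then 1 + c * (u (snd (snd t)))\<^sup>2 else 1) * (if fst t \<noteq> 0 then A t + B t * sg x z t else 1))"
        by (intro prod.cong refl) (auto simp: sqmean_def c_def A_def B_def ufac_def split: prod.splits)
      also have "\<dots> = (\<Prod>k<p. (1 + c * (u k)\<^sup>2) ^ deg T (VB k)) * (\<Prod>t\<in>Ta. A t + B t * sg x z t)"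
        unfolding prod.distrib prod_layer0_eq[OF T, of "\<lambda>k. 1 + c * (u k)\<^sup>2"] Ta_def
        using finite_cds_subset[OF T] by (simp add: prod.inter_filter)
      finally show ?thesis .
    qed
    then show ?thesis
      using integral_gauss_prod_prod[of p "\<lambda>k t. (1 + c * t\<^sup>2) ^ deg T (VB k)"]
      by (simp add: integrable_std_gauss_1_plus_sq m_def)
  qed
  have summand: "\<bar>(\<Prod>t\<in>F. B t) * (\<Prod>t\<in>Ta - F. A t) * measure_pmf.expectation (signs L \<rho> n) (\<lambda>(x, z). \<Prod>t\<in>F. sg x z t)\<bar> \<le> (if F = {} \<or> F = T then 1 else 0)"
    if F: "F \<subseteq> Ta" for F
  proof -
    have Fc: "F \<subseteq> cds" using F Ta by auto
    have E: "measure_pmf.expectation (signs L \<rho> n) (\<lambda>(x, z). \<Prod>t\<in>F. sg x z t) =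
      (if \<forall>i<n. even (deg F (VA i)) then \<rho> ^ odd_count L n F else 0)"
      using expectation_signs_sg[OF Fc] rho by simp
    show ?thesis
    proof (cases "F = {} \<or> F = T")
      case True
      have "\<bar>\<Prod>t\<in>F. B t\<bar> \<le> 1" using F AB by (auto simp: abs_prod intro!: prod_le_1)
      moreover have "\<bar>\<Prod>t\<in>Ta - F. A t\<bar> \<le> 1" using AB by (auto simp: abs_prod intro!: prod_le_1)
      moreover have "\<bar>measure_pmf.expectation (signs L \<rho> n) (\<lambda>(x, z). \<Prod>t\<in>F. sg x z t)\<bar> \<le> 1"
        unfolding E using rho by (auto intro: power_le_one)
      ultimately have "\<bar>\<Prod>t\<in>F. B t\<bar> * \<bar>\<Prod>t\<in>Ta - F. A t\<bar> * \<bar>measure_pmf.expectation (signs L \<rho> n) (\<lambda>(x, z). \<Prod>t\<in>F. sg x z t)\<bar> \<le> 1 * 1 * 1"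
        by (intro mult_mono) auto
      then show ?thesis using True by (simp add: abs_mult)
    next
      case False
      have "\<exists>i<n. odd (deg F (VA i))"
      proof (rule ccontr)
        assume "\<not> ?thesis"
        then have ev: "even (deg F (VA i))" if "i < n" for i using that by auto
        have "even (deg F v)" for v
        proof (cases v)
          case (VA i)
          show ?thesis
          proof (cases "i < n")
            case False
            have "\<not> (t \<in> F \<and> VA i \<in> ends t)" for t
              using False Fc by (cases t) (auto simp: VA_in_ends mem_codes split: if_splits dest!: subsetD)
            then have emp: "{t\<in>F. VA i \<in> ends t} = {}" by blast
            show ?thesis unfolding VA deg_def emp by simp
          qed (use ev VA in auto)
        next
          case (VB k)
          have emp: "{t\<in>F. VB k \<in> ends t} = {}" using F by (auto simp: VB_in_ends Ta_def)
          show ?thesis unfolding VB deg_def emp by simp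
        qed
        moreover have "F \<subseteq> T" using F by (auto simp: Ta_def)
        ultimately show False using conn[of F] False by blast
      qed
      then show ?thesis unfolding E using False by auto
    qed
  qed
  have "(\<integral>\<omega>. mo T \<omega> * mo T \<omega> \<partial>PL) = measure_pmf.expectation (signs L \<rho> n) (\<lambda>(x, z). m * (\<Prod>t\<in>Ta. A t + B t * sg x z t))"
    using integral_planted_pair[OF T T] by (simp add: inner)
  also have "(\<lambda>(x, z). m * (\<Prod>t\<in>Ta. A t + B t * sg x z t)) =
      (\<lambda>w. m * (\<Sum>F\<in>Pow Ta. (\<Prod>t\<in>F. B t) * (\<Prod>t\<in>Ta - F. A t) * (case w of (x, z) \<Rightarrow> \<Prod>t\<in>F. sg x z t)))"
  proof
    fix w :: "(nat \<Rightarrow> real) \<times> (nat \<times> nat \<Rightarrow> real)"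
    obtain x z where w: "w = (x, z)" by (cases w)
    have "(\<Prod>t\<in>Ta. A t + B t * sg x z t) = (\<Prod>t\<in>Ta. B t * sg x z t + A t)" by (simp add: add.commute)
    also have "\<dots> = (\<Sum>F\<in>Pow Ta. (\<Prod>t\<in>F. B t * sg x z t) * (\<Prod>t\<in>Ta - F. A t))"
      by (rule prod_add[OF Ta(2)])
    finally show "(case w of (x, z) \<Rightarrow> m * (\<Prod>t\<in>Ta. A t + B t * sg x z t)) =
      m * (\<Sum>F\<in>Pow Ta. (\<Prod>t\<in>F. B t) * (\<Prod>t\<in>Ta - F. A t) * (case w of (x, z) \<Rightarrow> \<Prod>t\<in>F. sg x z t))"
      by (simp add: w prod.distrib mult.commute mult.left_commute)
  qed
  also have "measure_pmf.expectation (signs L \<rho> n) \<dots> =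
      m * (\<Sum>F\<in>Pow Ta. (\<Prod>t\<in>F. B t) * (\<Prod>t\<in>Ta - F. A t) * measure_pmf.expectation (signs L \<rho> n) (\<lambda>(x, z). \<Prod>t\<in>F. sg x z t))"
    by (simp add: Bochner_Integration.integral_sum integrable_measure_pmf_finite finite_set_signs)
  also have "\<dots> \<le> m * (\<Sum>F\<in>Pow Ta. if F = {} \<or> F = T then 1 else 0)"
    by (rule mult_left_mono[OF sum_mono m(1)], rule abs_le_D1, rule summand) (simp only: Pow_iff)
  also have "(\<Sum>F\<in>Pow Ta. if F = {} \<or> F = T then 1 else 0) \<le> (2::real)"
  proof -
    have "(\<Sum>F\<in>Pow Ta. if F = {} \<or> F = T then 1 else 0) = (\<Sum>F\<in>{F\<in>Pow Ta. F = {} \<or> F = T}. 1 :: real)"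
      using Ta by (subst sum.inter_filter) auto
    also have "\<dots> = real (card {F\<in>Pow Ta. F = {} \<or> F = T})" by simp
    also have "card {F\<in>Pow Ta. F = {} \<or> F = T} \<le> card {{}, T}"
      by (intro card_mono) auto
    also have "card {{}, T} \<le> 2" by (simp add: card_insert_if)
    finally show ?thesis by simp
  qed
  finally have "(\<integral>\<omega>. mo T \<omega> * mo T \<omega> \<partial>PL) \<le> m * 2" using m by (simp add: mult_left_mono)
  also have "\<dots> \<le> 2 * (1 + 5 * \<mu> / real n) ^ card T" using m by (simp add: c_def)
  finally show ?thesis .
qed

text \<open>Absolute values throughout, with signs bounded by 1. An unshared edge costs M, a shared
  one 2, and the dependence on u is dominated by powers of 1 + u^2 whose exponent at a column is its
  degree in the union, hence at most 4.\<close>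

lemma mixed_moment_planted:
  assumes S: "S \<subseteq> cds" and K: "K \<subseteq> cds" and M: "\<And>t. t \<in> cds \<Longrightarrow> mn t \<le> M"
    and d: "\<And>k. k < p \<Longrightarrow> deg S (VB k) \<le> 2" "\<And>k. k < p \<Longrightarrow> deg K (VB k) \<le> 2"
  shows "(\<integral>\<omega>. mo S \<omega> * mo K \<omega> \<partial>PL) \<le> M ^ card ((S - K) \<union> (K - S)) * 2 ^ card (S \<inter> K) * gauss_const ^ card (S \<union> K)"
proof -
  let ?D = "(S - K) \<union> (K - S)"
  define C where "C = M ^ card ?D * 2 ^ card (S \<inter> K)"
  have fin: "finite S" "finite K" using S K finite_cds_subset by auto
  have SK: "S \<union> K \<subseteq> cds" "?D \<subseteq> cds" "S \<inter> K \<subseteq> cds" using S K by blast+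
  \<comment> \<open>The nonnegative mean of any edge forces M \<ge> 0; if there is no edge code at
    all, M occurs to the power 0.\<close>
  have C0: "C \<ge> 0"
  proof (cases "cds = {}")
    case True
    then have "?D = {}" using SK(2) by simp
    then show ?thesis unfolding C_def by (simp only: card.empty power_0) simp
  next
    case False
    then obtain t where "t \<in> cds" by blast
    then have "0 \<le> M" using mean_nonneg M order_trans by blast
    then show ?thesis by (simp add: C_def)
  qed
  define e where "e k = deg (S \<union> K) (VB k)" for k
  have e4: "e k \<le> 4" if "k < p" for k
  proof -
    have "e k \<le> card ({t\<in>S. VB k \<in> ends t} \<union> {t\<in>K. VB k \<in> ends t})"
      unfolding e_def deg_def using fin by (intro card_mono) auto
    also have "\<dots> \<le> deg S (VB k) + deg K (VB k)" unfolding deg_def by (rule card_Un_le)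
    finally show ?thesis using d[OF that] by linarith
  qed
  define g where "g u = C * (\<Prod>k<p. (1 + (u k)\<^sup>2) ^ e k)" for u :: "nat \<Rightarrow> real"
  have gi: "integrable US g" unfolding g_def
    using integrable_gauss_prod_prod[of p "\<lambda>k t. (1 + t\<^sup>2) ^ e k"] integrable_std_gauss_1_plus_sq[of 1] by simp
  have ge: "integral\<^sup>L US g \<le> C * gauss_const ^ card (S \<union> K)"
  proof -
    have "integral\<^sup>L US g = C * (\<Prod>k<p. \<integral>t. (1 + t\<^sup>2) ^ e k \<partial>std_gauss)"
      unfolding g_def using integrable_std_gauss_1_plus_sq[of 1]
        integral_gauss_prod_prod[of p "\<lambda>k t. (1 + t\<^sup>2) ^ e k"] by simp
    also have "(\<Prod>k<p. \<integral>t. (1 + t\<^sup>2) ^ e k \<partial>std_gauss) \<le> (\<Prod>k<p. if e k \<noteq> 0 then gauss_const else 1)"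
      using integral_1_plus_sq_le e4 by (intro prod_mono) (auto intro!: integral_nonneg)
    also have "\<dots> = gauss_const ^ card {k. k < p \<and> deg (S \<union> K) (VB k) \<noteq> 0}"
      by (subst prod.inter_filter[symmetric]) (auto simp: e_def intro!: arg_cong[where f = "\<lambda>A. _ ^ card A"])
    also have "\<dots> \<le> gauss_const ^ card (S \<union> K)"
      using gauss_const_ge_1 card_touched_le[of "S \<union> K" p] fin by (intro power_increasing) auto
    finally show ?thesis using C0 by (simp add: mult_left_mono)
  qed
  have inner: "(\<integral>u. (\<Prod>t\<in>?D. mn t * sg x z t * ufac u t) * (\<Prod>t\<in>S \<inter> K. sq x z u t) \<partial>US) \<le> C * gauss_const ^ card (S \<union> K)"
    if xz: "(x, z) \<in> set_pmf (signs L \<rho> n)" for x z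
  proof -
    have sg1: "\<bar>sg x z t\<bar> \<le> 1" if t: "t \<in> cds" for t
    proof -
      obtain l i j where tt: "t = (l, i, j)" by (cases t)
      have x1: "\<bar>x i\<bar> = 1" if "i < n" for i using set_signsD(1)[OF xz that] by auto
      have z1: "\<bar>z (l, i)\<bar> = 1" if "l \<in> {1..L}" "i < n" for l i using set_signsD(2)[OF xz that] by auto
      show ?thesis using t x1 z1[of l] by (auto simp: tt sg_def mem_codes abs_mult split: if_splits)
    qed
    \<comment> \<open>One weight serves both kinds of factors: |u| \<le> 1 + u^2 for the means, and
      1 + (\<mu> / n) u^2 \<le> 1 + u^2 for the second moments.\<close>
    define w where "w u t = (if fst t = 0 then 1 + (u (snd (snd t)))\<^sup>2 else 1)" for u :: "nat \<Rightarrow> real" and t :: "nat \<times> nat \<times> nat"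
    have w1: "w u t \<ge> 1" for u t by (simp add: w_def)
    have b1: "\<bar>mn t * sg x z t * ufac u t\<bar> \<le> M * w u t" if t: "t \<in> cds" for t u
    proof -
      have "\<bar>ufac u t\<bar> \<le> w u t"
      proof -
        have "\<bar>y\<bar> \<le> 1 + y\<^sup>2" for y :: real
        proof -
          have "0 \<le> (\<bar>y\<bar> - 1)\<^sup>2" by simp
          then have "2 * \<bar>y\<bar> \<le> 1 + y\<^sup>2" by (simp add: power2_diff)
          then show ?thesis by linarith
        qed
        then show ?thesis by (auto simp: ufac_def w_def split: prod.splits)
      qed
      then have "\<bar>mn t\<bar> * \<bar>sg x z t\<bar> * \<bar>ufac u t\<bar> \<le> M * 1 * w u t"
        using M[OF t] mean_nonneg[OF t] sg1[OF t] by (intro mult_mono) auto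
      then show ?thesis by (simp add: abs_mult)
    qed
    have b2: "\<bar>sq x z u t\<bar> \<le> 2 * w u t" if t: "t \<in> cds" for t u
    proof (cases "fst t = 0")
      case True
      have "\<mu> / real n \<le> 1" "0 \<le> \<mu> / real n" using mu_le mu_pos n_pos by auto
      then have "\<mu> / real n * (u (snd (snd t)))\<^sup>2 \<le> 1 * (u (snd (snd t)))\<^sup>2" by (intro mult_right_mono) auto
      moreover have "0 \<le> \<mu> / real n * (u (snd (snd t)))\<^sup>2"
        using \<open>0 \<le> \<mu> / real n\<close> by (intro mult_nonneg_nonneg) auto
      moreover have "sq x z u t = 1 + \<mu> / real n * (u (snd (snd t)))\<^sup>2" "w u t = 1 + (u (snd (snd t)))\<^sup>2"
        using True by (auto simp: sqmean_def w_def ufac_def case_prod_beta)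
      moreover have "0 \<le> (u (snd (snd t)))\<^sup>2" by simp
      ultimately show ?thesis by linarith
    next
      case False
      have "\<bar>eps (fst t) * (1 - 2 * lam (fst t) / real n)\<bar> * \<bar>sg x z t\<bar> \<le> 1 * 1"
        using sqmean_bounds[OF t False] sg1[OF t] by (intro mult_mono) auto
      then have "\<bar>eps (fst t) * (1 - 2 * lam (fst t) / real n) * sg x z t\<bar> \<le> 1" by (simp add: abs_mult)
      then show ?thesis using False sqmean_bounds[OF t False] by (simp add: sqmean_def w_def)
    qed
    have bound: "\<bar>(\<Prod>t\<in>?D. mn t * sg x z t * ufac u t) * (\<Prod>t\<in>S \<inter> K. sq x z u t)\<bar> \<le> g u" for u
    proof -
      have "\<bar>(\<Prod>t\<in>?D. mn t * sg x z t * ufac u t) * (\<Prod>t\<in>S \<inter> K. sq x z u t)\<bar> =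
        (\<Prod>t\<in>?D. \<bar>mn t * sg x z t * ufac u t\<bar>) * (\<Prod>t\<in>S \<inter> K. \<bar>sq x z u t\<bar>)"
        by (simp only: abs_mult abs_prod)
      also have "\<dots> \<le> (\<Prod>t\<in>?D. M * w u t) * (\<Prod>t\<in>S \<inter> K. 2 * w u t)"
      proof (rule mult_mono)
        show "(\<Prod>t\<in>?D. \<bar>mn t * sg x z t * ufac u t\<bar>) \<le> (\<Prod>t\<in>?D. M * w u t)"
          by (rule prod_mono, rule conjI[OF abs_ge_zero b1], rule subsetD[OF SK(2)])
        show "(\<Prod>t\<in>S \<inter> K. \<bar>sq x z u t\<bar>) \<le> (\<Prod>t\<in>S \<inter> K. 2 * w u t)"
          by (rule prod_mono, rule conjI[OF abs_ge_zero b2], rule subsetD[OF SK(3)])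
        show "0 \<le> (\<Prod>t\<in>?D. M * w u t)"
          by (rule prod_nonneg, rule order_trans[OF abs_ge_zero b1], rule subsetD[OF SK(2)])
      qed (rule prod_nonneg, simp)
      also have "\<dots> = C * ((\<Prod>t\<in>?D. w u t) * (\<Prod>t\<in>S \<inter> K. w u t))"
        by (simp add: prod.distrib C_def)
      also have "(\<Prod>t\<in>?D. w u t) * (\<Prod>t\<in>S \<inter> K. w u t) = (\<Prod>t\<in>?D \<union> (S \<inter> K). w u t)"
        by (rule prod.union_disjoint[symmetric]) (use fin in \<open>simp, simp, blast\<close>)
      also have "?D \<union> (S \<inter> K) = S \<union> K" by blast
      also have "(\<Prod>t\<in>S \<union> K. w u t) = (\<Prod>k<p. (1 + (u k)\<^sup>2) ^ e k)"
        unfolding w_def e_def by (rule prod_layer0_eq[OF SK(1)])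
      finally show ?thesis by (simp add: g_def)
    qed
    have "(\<integral>u. (\<Prod>t\<in>?D. mn t * sg x z t * ufac u t) * (\<Prod>t\<in>S \<inter> K. sq x z u t) \<partial>US) \<le> integral\<^sup>L US g"
      by (rule integral_mono'[OF gi]) (use bound in \<open>auto intro: order_trans[OF abs_ge_self] order_trans[OF abs_ge_zero]\<close>)
    then show ?thesis using ge by linarith
  qed
  have "(\<integral>\<omega>. mo S \<omega> * mo K \<omega> \<partial>PL) \<le> measure_pmf.expectation (signs L \<rho> n) (\<lambda>_. C * gauss_const ^ card (S \<union> K))"
    unfolding integral_planted_pair[OF S K]
  proof (rule integral_mono_AE)
    show "AE w in measure_pmf (signs L \<rho> n). (case w of (x, z) \<Rightarrow>
        \<integral>u. (\<Prod>t\<in>?D. mn t * sg x z t * ufac u t) * (\<Prod>t\<in>S \<inter> K. sq x z u t) \<partial>US) \<le> C * gauss_const ^ card (S \<union> K)"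
      unfolding AE_measure_pmf_iff using inner by fast
  qed (rule integrable_measure_pmf_finite[OF finite_set_signs])+
  then show ?thesis by (simp add: C_def)
qed

text \<open>Under the null law the coordinates are centred and independent, so a single unshared
  edge kills the expectation. A shared matrix entry has second moment 1 but a shared graph edge only
  1 - lam l / n, hence the inequality on the diagonal.\<close>

lemma null_moment:
  assumes S: "S \<subseteq> cds" and K: "K \<subseteq> cds"
  shows "S \<noteq> K \<Longrightarrow> (\<integral>\<omega>. mo S \<omega> * mo K \<omega> \<partial>QL) = 0"
    and "S = K \<Longrightarrow> (\<integral>\<omega>. mo S \<omega> * mo K \<omega> \<partial>QL) \<le> 1"
proof -
  have Y: "shift_moment (mlt S K t) 0 = (if (t \<in> S) = (t \<in> K) then 1 else 0)" for t
    by (cases "t \<in> S"; cases "t \<in> K") (simp_all add: mlt_def numeral_2_eq_2[symmetric])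
  have G: "measure_pmf.expectation (bernoulli_pmf (lam (fst t) / real n)) (gfun (mlt S K t) t) =
     (if t \<in> S \<longleftrightarrow> t \<in> K then if t \<in> S then 1 - lam (fst t) / real n else 1 else 0)"
    "0 \<le> 1 - lam (fst t) / real n" "1 - lam (fst t) / real n \<le> 1" if "t \<in> layer_pairs L n" for t
  proof -
    define a where "a = lam (fst t) / real n"
    have l: "fst t \<in> {1..L}" using that by (auto simp: layer_pairs_def)
    have a: "0 < a" "a \<le> 1" using lam_pos[OF l] lam_le[OF l] n_pos by (auto simp: a_def)
    then show "0 \<le> 1 - lam (fst t) / real n" "1 - lam (fst t) / real n \<le> 1" by (auto simp: a_def)
    have e0: "measure_pmf.expectation (bernoulli_pmf a) (gfun 0 t) = 1"
      using a by (simp add: integral_bernoulli_pmf gfun_def)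
    have e1: "measure_pmf.expectation (bernoulli_pmf a) (gfun (Suc 0) t) = 0"
      using a by (simp add: integral_bernoulli_pmf gfun_def a_def[symmetric] field_simps)
    have e2: "measure_pmf.expectation (bernoulli_pmf a) (gfun 2 t) = 1 - a"
    proof -
      have "measure_pmf.expectation (bernoulli_pmf a) (gfun 2 t) = (a * (1 - a)\<^sup>2 + (1 - a) * a\<^sup>2) / a"
        using a by (simp add: integral_bernoulli_pmf gfun_def a_def[symmetric] power_divide add_divide_distrib)
      also have "\<dots> = 1 - a" using a by (simp add: field_simps power2_eq_square)
      finally show ?thesis .
    qed
    show "measure_pmf.expectation (bernoulli_pmf (lam (fst t) / real n)) (gfun (mlt S K t) t) =
     (if t \<in> S \<longleftrightarrow> t \<in> K then if t \<in> S then 1 - lam (fst t) / real n else 1 else 0)"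
      unfolding a_def[symmetric] using e0 e1 e2
      by (cases "t \<in> S"; cases "t \<in> K") (simp_all add: mlt_def numeral_2_eq_2)
  qed
  have E: "(\<integral>\<omega>. mo S \<omega> * mo K \<omega> \<partial>QL) = (\<Prod>t\<in>{..<n}\<times>{..<p}. if ((0, t) \<in> S) = ((0, t) \<in> K) then 1 else 0) *
     (\<Prod>t\<in>layer_pairs L n. if t \<in> S \<longleftrightarrow> t \<in> K then if t \<in> S then 1 - lam (fst t) / real n else 1 else 0)"
    unfolding monom_mult_eq[OF S K]
      integral_null_monomial[where my = "\<lambda>t. mlt S K (0, t)" and h = "\<lambda>t. gfun (mlt S K t) t"]
    by (simp add: Y G(1))
  show "(\<integral>\<omega>. mo S \<omega> * mo K \<omega> \<partial>QL) = 0" if ne: "S \<noteq> K"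
  proof -
    obtain t where t: "t \<in> cds" "(t \<in> S) \<noteq> (t \<in> K)" using ne S K by blast
    then consider i k where "t = (0, i, k)" "(i, k) \<in> {..<n}\<times>{..<p}" | "t \<in> layer_pairs L n"
      by (auto simp: codes_def)
    then show ?thesis
    proof cases
      case 1
      then have "(\<Prod>t\<in>{..<n}\<times>{..<p}. if ((0, t) \<in> S) = ((0, t) \<in> K) then 1 else 0 :: real) = 0"
        using t(2) by (intro prod_zero bexI[of _ "(i, k)"]) auto
      then show ?thesis unfolding E by simp
    next
      case 2
      then have "(\<Prod>t\<in>layer_pairs L n. if t \<in> S \<longleftrightarrow> t \<in> K then if t \<in> S then 1 - lam (fst t) / real n else 1 else 0) = 0"
        using t(2) by (intro prod_zero bexI[of _ t]) auto
      then show ?thesis unfolding E by simp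
    qed
  qed
  show "(\<integral>\<omega>. mo S \<omega> * mo K \<omega> \<partial>QL) \<le> 1" if "S = K"
    unfolding E using that G(2,3) by (auto intro!: prod_le_1)
qed

end

section \<open>Decorated cycles\<close>

definition code_of :: "nat \<Rightarrow> nat \<Rightarrow> nat \<Rightarrow> dgraph \<Rightarrow> (nat \<times> nat \<times> nat) set" where
  "code_of L n p S = {t \<in> codes L n p. ends t \<in> El S (fst t)}"

definition tverts :: "(nat \<times> nat \<times> nat) set \<Rightarrow> vertex set" where
  "tverts T = (\<Union>t\<in>T. ends t)"

text \<open>Minimality among nonempty even edge sets stands for connectedness, in the form in which
  parity expansions and intersections of cycles use it.\<close>

definition cyclic :: "(nat \<times> nat \<times> nat) set \<Rightarrow> bool" where
  "cyclic T \<longleftrightarrow> T \<noteq> {} \<and> (\<forall>v\<in>tverts T. deg T v = 2) \<and>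
     (\<forall>F\<subseteq>T. F \<noteq> {} \<longrightarrow> (\<forall>v. even (deg F v)) \<longrightarrow> F = T)"

lemma code_of_subset: "code_of L n p S \<subseteq> codes L n p"
  by (auto simp: code_of_def)

lemma finite_ends [simp]: "finite (ends t)"
  by (auto simp: ends_def split: prod.splits)

lemma card_ends: "t \<in> codes L n p \<Longrightarrow> card (ends t) = 2"
  by (cases t) (auto simp: ends_def mem_codes split: if_splits)

lemma finite_tverts: "finite T \<Longrightarrow> finite (tverts T)"
  by (auto simp: tverts_def)

text \<open>The layer has to be given, since a pair of a-vertices has a code in every graph layer.
  Within a layer, i < j fixes the order of the ends.\<close>

lemma ends_inject:
  assumes "t \<in> codes L n p" "t' \<in> codes L n p" "fst t = fst t'" "ends t = ends t'"
  shows "t = t'"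
  using assms by (cases t; cases t') (auto simp: ends_def mem_codes doubleton_eq_iff split: if_splits)

lemma KEb_not_KEa: "e \<in> KEb n p \<Longrightarrow> e \<notin> KEa n"
  by (auto simp: KEa_def KEb_def)

lemma edge_has_code:
  assumes S: "decorated_graph L n p S" and e: "e \<in> edges S"
  shows "\<exists>t\<in>code_of L n p S. ends t = e \<and> fst t = dec S e"
proof -
  have l: "dec S e \<in> {0..L}" "dec S e = 0 \<longleftrightarrow> e \<in> KEb n p" "e \<in> KEa n \<union> KEb n p"
    using S e by (auto simp: decorated_graph_def)
  show ?thesis
  proof (cases "e \<in> KEb n p")
    case True
    then obtain i k where "e = {VA i, VB k}" "i < n" "k < p" by (auto simp: KEb_def)
    then show ?thesis using True l e
      by (intro bexI[of _ "(0, i, k)"]) (auto simp: ends_def code_of_def mem_codes El_def)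
  next
    case False
    then obtain i j where "e = {VA i, VA j}" "i < j" "j < n" using l(3) by (auto simp: KEa_def)
    then show ?thesis using False l e
      by (intro bexI[of _ "(dec S e, i, j)"]) (auto simp: ends_def code_of_def mem_codes El_def)
  qed
qed

lemma code_of_bij:
  assumes S: "decorated_graph L n p S"
  shows "bij_betw ends (code_of L n p S) (edges S)"
proof (rule bij_betwI')
  fix t t' assume "t \<in> code_of L n p S" "t' \<in> code_of L n p S"
  then show "(ends t = ends t') = (t = t')"
    using ends_inject[of t L n p t'] by (auto simp: code_of_def El_def)
next
  fix t assume "t \<in> code_of L n p S"
  then show "ends t \<in> edges S" by (auto simp: code_of_def El_def)
next
  fix e assume "e \<in> edges S"
  then show "\<exists>t\<in>code_of L n p S. e = ends t" using edge_has_code[OF S] by force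
qed

lemma dec_code_of: "t \<in> code_of L n p S \<Longrightarrow> dec S (ends t) = fst t"
  by (simp add: code_of_def El_def)

lemma f_graph_eq:
  assumes S: "decorated_graph L n p S"
  shows "f_graph L lam n S \<omega> = monom_of lam n (code_of L n p S) \<omega>"
proof -
  define A where "A l = {(i, j). (l, i, j) \<in> code_of L n p S}" for l
  have sub: "code_of L n p S \<subseteq> {0..L} \<times> UNIV"
    by (auto simp: code_of_def mem_codes split: if_splits)
  have sig: "code_of L n p S = Sigma {0..L} A"
    using sub by (auto simp: A_def)
  have finA: "finite (A l)" for l
  proof -
    have "A l \<subseteq> snd ` codes L n p" by (force simp: A_def code_of_def)
    then show ?thesis by (rule finite_subset) simp
  qed
  have A0: "A 0 = {(i, k). {VA i, VB k} \<in> El S 0}"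
  proof -
    have "i < n \<and> k < p" if "{VA i, VB k} \<in> edges S" for i k
    proof -
      have "{VA i, VB k} \<in> KEa n \<union> KEb n p" using S that by (auto simp: decorated_graph_def)
      then show ?thesis by (auto simp: KEa_def KEb_def doubleton_eq_iff)
    qed
    then show ?thesis by (auto simp: A_def code_of_def mem_codes ends_def El_def)
  qed
  have A1: "A l = {(i, j). i < j \<and> {VA i, VA j} \<in> El S l}" if "l \<in> {1..L}" for l
  proof -
    have "i < j \<longrightarrow> j < n" if "{VA i, VA j} \<in> edges S" for i j
    proof -
      have "{VA i, VA j} \<in> KEa n \<union> KEb n p" using S that by (auto simp: decorated_graph_def)
      then show ?thesis by (auto simp: KEa_def KEb_def doubleton_eq_iff)
    qed
    then show ?thesis using that by (auto simp: A_def code_of_def mem_codes ends_def El_def)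
  qed
  have "monom_of lam n (code_of L n p S) \<omega> = (\<Prod>l\<in>{0..L}. \<Prod>t\<in>A l. obsv lam n \<omega> (l, t))"
    unfolding monom_of_def sig by (subst prod.Sigma) (auto simp: finA)
  also have "{0..L} = insert 0 {1..L}" by auto
  also have "(\<Prod>l\<in>insert 0 {1..L}. \<Prod>t\<in>A l. obsv lam n \<omega> (l, t)) =
      (\<Prod>t\<in>A 0. obsv lam n \<omega> (0, t)) * (\<Prod>l\<in>{1..L}. \<Prod>t\<in>A l. obsv lam n \<omega> (l, t))"
    by (rule prod.insert) auto
  also have "(\<Prod>t\<in>A 0. obsv lam n \<omega> (0, t)) = (\<Prod>(i, k)\<in>{(i, k). {VA i, VB k} \<in> El S 0}. fst \<omega> (i, k))"
    unfolding A0 by (intro prod.cong) (auto simp: obsv_def)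
  also have "(\<Prod>l\<in>{1..L}. \<Prod>t\<in>A l. obsv lam n \<omega> (l, t)) =
      (\<Prod>l\<in>{1..L}. \<Prod>(i, j)\<in>{(i, j). i < j \<and> {VA i, VA j} \<in> El S l}. Gbar lam n (snd \<omega>) l i j)"
    by (intro prod.cong refl A1) (auto simp: obsv_def)
  finally have "monom_of lam n (code_of L n p S) \<omega> = (\<Prod>(i, k)\<in>{(i, k). {VA i, VB k} \<in> El S 0}. fst \<omega> (i, k)) *
      (\<Prod>l\<in>{1..L}. \<Prod>(i, j)\<in>{(i, j). i < j \<and> {VA i, VA j} \<in> El S l}. Gbar lam n (snd \<omega>) l i j)" .
  then show ?thesis by (simp only: f_graph_def case_prod_unfold)
qed

section \<open>Degrees and connectedness of cycles\<close>

lemma cycle_degree: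
  assumes "is_cycle H" "v \<in> verts H"
  shows "card {e \<in> edges H. v \<in> e} = 2"
proof -
  from assms obtain vs where vs: "3 \<le> length vs" "distinct vs" "verts H = set vs"
    and E: "edges H = {{vs ! i, vs ! ((i + 1) mod length vs)} | i. i < length vs}"
    unfolding is_cycle_def by blast
  define m where "m = length vs"
  define s where "s i = (if i + 1 = m then 0 else i + 1)" for i
  have s: "(i + 1) mod m = s i" "s i < m" if "i < m" for i
    using that by (auto simp: s_def)
  have E': "edges H = (\<lambda>i. {vs ! i, vs ! s i}) ` {..<m}"
    unfolding E using s(1) by (auto simp: m_def[symmetric])
  have nth: "vs ! i = vs ! j \<longleftrightarrow> i = j" if "i < m" "j < m" for i j
    using vs(2) that by (auto simp: m_def nth_eq_iff_index_eq)
  obtain i where i: "i < m" "v = vs ! i"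
    using assms(2) vs(3) by (auto simp: in_set_conv_nth m_def)
  \<comment> \<open>Index of the predecessor on the cycle: the two edges at v are those that start
    at i and at r. They differ because a cycle has at least three vertices, whence
    \<open>s i \<noteq> r\<close>.\<close>
  define r where "r = (if i = 0 then m - 1 else i - 1)"
  have r: "r < m" "s r = i" "r \<noteq> i" "s i \<noteq> r" using i vs(1) by (auto simp: r_def s_def m_def)
  have si: "s j = i \<Longrightarrow> j < m \<Longrightarrow> j = r" for j
    using i by (auto simp: r_def s_def split: if_splits)
  have "{e \<in> edges H. v \<in> e} = {{vs ! i, vs ! s i}, {vs ! r, vs ! s r}}"
  proof (intro equalityI subsetI)
    fix e assume "e \<in> {e \<in> edges H. v \<in> e}"
    then obtain j where j: "j < m" "e = {vs ! j, vs ! s j}" "v \<in> e" unfolding E' by auto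
    then have "i = j \<or> i = s j" using i nth s(2) by auto
    then show "e \<in> {{vs ! i, vs ! s i}, {vs ! r, vs ! s r}}" using si j by auto
  next
    fix e assume "e \<in> {{vs ! i, vs ! s i}, {vs ! r, vs ! s r}}"
    then show "e \<in> {e \<in> edges H. v \<in> e}" unfolding E' using i r by auto
  qed
  moreover have "{vs ! i, vs ! s i} \<noteq> {vs ! r, vs ! s r}"
    using nth s(2) i r by (auto simp: doubleton_eq_iff)
  ultimately show ?thesis by simp
qed

lemma cycle_connected:
  assumes "is_cycle H" "U \<subseteq> verts H" "U \<noteq> {}"
    and closed: "\<And>e. e \<in> edges H \<Longrightarrow> e \<inter> U \<noteq> {} \<Longrightarrow> e \<subseteq> U"
  shows "U = verts H"
proof -
  from assms obtain vs where vs: "3 \<le> length vs" "distinct vs" "verts H = set vs"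
    and E: "edges H = {{vs ! i, vs ! ((i + 1) mod length vs)} | i. i < length vs}"
    unfolding is_cycle_def by blast
  define m where "m = length vs"
  obtain i where i: "i < m" "vs ! i \<in> U"
    using assms(2,3) vs(3) by (metis all_not_in_conv in_set_conv_nth m_def subsetD)
  have step: "vs ! ((i + k) mod m) \<in> U" for k
  proof (induction k)
    case (Suc k)
    have "(i + k) mod m < m" using i by simp
    then have "{vs ! ((i + k) mod m), vs ! (((i + k) mod m + 1) mod m)} \<in> edges H"
      unfolding E m_def by blast
    from closed[OF this] Suc have "vs ! (((i + k) mod m + 1) mod m) \<in> U" by auto
    then show ?case by (simp add: mod_Suc_eq)
  qed (use i in simp)
  have "vs ! j \<in> U" if "j < m" for j
    \<comment> \<open>Adding m before subtracting i keeps the natural subtraction exact and leaves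
      the residue unchanged.\<close>
    using step[of "m + j - i"] i that by simp
  then show ?thesis using assms(2) vs(3) by (auto simp: in_set_conv_nth m_def)
qed

lemma is_cycle_verts_nonempty: "is_cycle H \<Longrightarrow> verts H \<noteq> {}"
  by (auto simp: is_cycle_def)

lemma is_cycle_edges_subset:
  assumes "is_cycle H" "e \<in> edges H"
  shows "e \<subseteq> verts H"
proof -
  from assms obtain vs i where "3 \<le> length vs" "verts H = set vs" "i < length vs"
    "e = {vs ! i, vs ! ((i + 1) mod length vs)}"
    unfolding is_cycle_def by blast
  moreover have "(i + 1) mod length vs < length vs" using calculation(1) by (intro mod_less_divisor) auto
  ultimately show ?thesis by simp
qed

lemma deg_mono: "F \<subseteq> T \<Longrightarrow> finite T \<Longrightarrow> deg F v \<le> deg T v"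
  unfolding deg_def by (intro card_mono) auto

lemma deg_eq_0: "finite T \<Longrightarrow> deg T v = 0 \<longleftrightarrow> v \<notin> tverts T"
  unfolding deg_def tverts_def by (auto simp: card_eq_0_iff)

lemma finite_code_of [simp]: "finite (code_of L n p S)"
  by (rule finite_subset[OF code_of_subset finite_codes])

context
  fixes L n p S
  assumes S: "decorated_graph L n p S" and cyc: "is_cycle S"
begin

lemma deg_code_of: "v \<in> verts S \<Longrightarrow> deg (code_of L n p S) v = 2"
proof -
  assume v: "v \<in> verts S"
  have "ends ` {t \<in> code_of L n p S. v \<in> ends t} = {e \<in> edges S. v \<in> e}"
    using code_of_bij[OF S] by (auto simp: bij_betw_def)
  moreover have "inj_on ends {t \<in> code_of L n p S. v \<in> ends t}"
    using code_of_bij[OF S] by (auto simp: bij_betw_def intro: inj_on_subset)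
  ultimately show ?thesis
    unfolding deg_def using cycle_degree[OF cyc v] by (simp add: card_image[symmetric])
qed

lemma tverts_code_of: "tverts (code_of L n p S) = verts S"
proof -
  have 1: "tverts (code_of L n p S) = \<Union> (edges S)"
    using code_of_bij[OF S] by (auto simp: bij_betw_def tverts_def)
  have "v \<in> \<Union> (edges S)" if "v \<in> verts S" for v
  proof -
    have "{e \<in> edges S. v \<in> e} \<noteq> {}" using cycle_degree[OF cyc that] by force
    then show ?thesis by blast
  qed
  then show ?thesis using is_cycle_edges_subset[OF cyc] unfolding 1 by blast
qed

text \<open>At a vertex that F touches, its degree is even, positive and at most 2, so F contains
  both cycle edges there. The vertex set of F is then closed along edges and fills the
  cycle.\<close>

lemma cyclic_code_of: "cyclic (code_of L n p S)"
  unfolding cyclic_def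
proof (intro conjI ballI allI impI)
  let ?T = "code_of L n p S"
  show "?T \<noteq> {}"
    using tverts_code_of is_cycle_verts_nonempty[OF cyc] by (auto simp: tverts_def)
  show "deg ?T v = 2" if "v \<in> tverts ?T" for v
    using that deg_code_of tverts_code_of by simp
  fix F assume F: "F \<subseteq> ?T" "F \<noteq> {}" "\<forall>v. even (deg F v)"
  have fin: "finite F" by (rule finite_subset[OF F(1) finite_code_of])
  have sat: "t \<in> F" if t: "t \<in> ?T" "v \<in> ends t" "v \<in> tverts F" for t v
  proof -
    have "v \<in> tverts ?T" using t by (auto simp: tverts_def)
    then have "deg ?T v = 2" using deg_code_of tverts_code_of by simp
    moreover have "deg F v \<noteq> 0" using t(3) fin by (simp add: deg_eq_0)
    moreover have "even (deg F v)" using F(3) by simp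
    moreover have "deg F v \<le> deg ?T v" by (rule deg_mono[OF F(1)]) simp
    ultimately have "deg F v = deg ?T v" by presburger
    then have "{t \<in> F. v \<in> ends t} = {t \<in> ?T. v \<in> ends t}"
      unfolding deg_def using F(1) by (intro card_subset_eq) auto
    then show ?thesis using t by blast
  qed
  have "tverts F = verts S"
  proof (rule cycle_connected[OF cyc])
    show "tverts F \<subseteq> verts S" using F(1) tverts_code_of by (auto simp: tverts_def)
    show "tverts F \<noteq> {}" using F(2) by (auto simp: tverts_def ends_def split: prod.splits)
    fix e assume e: "e \<in> edges S" "e \<inter> tverts F \<noteq> {}"
    obtain t where t: "t \<in> ?T" "ends t = e" using edge_has_code[OF S e(1)] by blast
    then have "t \<in> F" using sat e(2) by blast
    then show "e \<subseteq> tverts F" using t by (auto simp: tverts_def)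
  qed
  then have eq: "tverts F = tverts ?T" by (simp add: tverts_code_of)
  have "t \<in> F" if t: "t \<in> ?T" for t
  proof -
    have v: "VA (fst (snd t)) \<in> ends t" by (simp add: VA_in_ends)
    then have "VA (fst (snd t)) \<in> tverts ?T" using t unfolding tverts_def by blast
    then show ?thesis using sat[OF t v] unfolding eq by blast
  qed
  then show "F = ?T" using F(1) by blast
qed

end

text \<open>A cycle has no isolated vertices, so its vertices can be read off the edges, and off the
  edges every decoration is \<open>undefined\<close>.\<close>

lemma code_of_inj:
  assumes "decorated_graph L n p S" "is_cycle S" "decorated_graph L n p S'" "is_cycle S'"
    "code_of L n p S = code_of L n p S'"
  shows "S = S'"
proof -
  have v: "verts S = verts S'"
    using tverts_code_of assms by metis
  have e: "edges S = edges S'"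
    using code_of_bij[OF assms(1)] code_of_bij[OF assms(3)] assms(5) by (simp add: bij_betw_def)
  have d: "dec S x = dec S' x" for x
  proof (cases "x \<in> edges S")
    case True
    then obtain t where "t \<in> code_of L n p S" "ends t = x" using edge_has_code[OF assms(1)] by blast
    then show ?thesis using dec_code_of[of t] assms(5) by metis
  next
    case False
    then show ?thesis using assms(1,3) e by (auto simp: decorated_graph_def PiE_def extensional_def)
  qed
  show ?thesis using v e d by (intro dgraph.equality) (auto intro: ext)
qed

section \<open>Double counting of vertices and edges\<close>

lemma handshake:
  assumes "T \<subseteq> codes L n p" "finite W" "tverts T \<subseteq> W"
  shows "(\<Sum>v\<in>W. deg T v) = 2 * card T"
proof -
  have fin: "finite T" by (rule finite_subset[OF assms(1) finite_codes])
  have "(\<Sum>v\<in>W. deg T v) = (\<Sum>v\<in>W. \<Sum>t\<in>T. if v \<in> ends t then 1 else 0)"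
    unfolding deg_def using fin by (simp add: sum.inter_filter[symmetric])
  also have "\<dots> = (\<Sum>t\<in>T. \<Sum>v\<in>W. if v \<in> ends t then 1 else 0)" by (rule sum.swap)
  also have "\<dots> = (\<Sum>t\<in>T. 2)"
  proof (rule sum.cong[OF refl])
    fix t assume t: "t \<in> T"
    have "(\<Sum>v\<in>W. if v \<in> ends t then 1 else 0) = card {v\<in>W. v \<in> ends t}"
      using assms(2) by (simp add: sum.inter_filter[symmetric])
    also have "{v\<in>W. v \<in> ends t} = ends t" using t assms(3) by (auto simp: tverts_def)
    also have "card (ends t) = 2" using t assms(1) card_ends by blast
    finally show "(\<Sum>v\<in>W. if v \<in> ends t then 1 else 0) = (2::nat)" .
  qed
  finally show ?thesis by simp
qed

lemma card_cyclic:
  assumes "T \<subseteq> codes L n p" "cyclic T"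
  shows "card (tverts T) = card T"
proof -
  have fin: "finite T" by (rule finite_subset[OF assms(1) finite_codes])
  have "2 * card T = (\<Sum>v\<in>tverts T. deg T v)"
    using handshake[OF assms(1) finite_tverts[OF fin]] by simp
  also have "\<dots> = 2 * card (tverts T)" using assms(2) by (simp add: cyclic_def)
  finally show ?thesis by simp
qed

text \<open>
  Each vertex common to two cycles has degree at most \<open>2\<close> in their intersection; connectedness
  forbids degree exactly \<open>2\<close> everywhere unless the cycles coincide.
\<close>

lemma cyclic_intersection:
  assumes T: "T \<subseteq> codes L n p" "cyclic T" and T': "T' \<subseteq> codes L n p" "cyclic T'"
    and "T \<noteq> T'" "tverts T \<inter> tverts T' \<noteq> {}"
  shows "card (T \<inter> T') + 1 \<le> card (tverts T \<inter> tverts T')"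
proof -
  let ?F = "T \<inter> T'" and ?W = "tverts T \<inter> tverts T'"
  have fin: "finite T" "finite T'" by (rule finite_subset[OF _ finite_codes], fact)+
  have finW: "finite ?W" using fin finite_tverts by blast
  show ?thesis
  proof (cases "?F = {}")
    case True
    then show ?thesis using assms(6) finW by (simp add: Suc_le_eq card_gt_0_iff)
  next
    case False
    have sub: "tverts ?F \<subseteq> ?W" by (auto simp: tverts_def)
    have hs: "(\<Sum>v\<in>?W. deg ?F v) = 2 * card ?F"
      by (rule handshake[OF _ finW sub]) (use T in blast)
    have le2: "deg ?F v \<le> 2" if "v \<in> ?W" for v
    proof -
      have "deg ?F v \<le> deg T v" by (rule deg_mono[OF _ fin(1)]) blast
      then show ?thesis using that T(2) by (auto simp: cyclic_def)
    qed
    have "\<exists>v\<in>?W. deg ?F v < 2"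
    proof (rule ccontr)
      assume "\<not> ?thesis"
      then have "deg ?F v = 2" if "v \<in> ?W" for v using le2[OF that] that by force
      moreover have "deg ?F v = 0" if "v \<notin> ?W" for v
        using that sub fin deg_eq_0[of ?F v] by auto
      ultimately have ev: "\<forall>v. even (deg ?F v)" by (metis even_zero even_numeral)
      have "?F = T" using T(2) False ev unfolding cyclic_def by (metis Int_lower1)
      moreover have "?F = T'" using T'(2) False ev unfolding cyclic_def by (metis Int_lower2)
      ultimately show False using assms(5) by blast
    qed
    then have "(\<Sum>v\<in>?W. deg ?F v) < (\<Sum>v\<in>?W. 2)"
      using le2 finW by (intro sum_strict_mono_ex1) auto
    then show ?thesis unfolding hs by simp
  qed
qed

section \<open>Isomorphism classes\<close>

lemma decorated_edges: "decorated_graph L n p H \<Longrightarrow> e \<in> edges H \<Longrightarrow> e \<subseteq> verts H"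
  by (simp add: decorated_graph_def)

lemma finite_verts: "decorated_graph L n p H \<Longrightarrow> finite (verts H)"
  by (rule finite_subset[of _ "KVa n \<union> KVb p"]) (auto simp: decorated_graph_def KVa_def KVb_def)

lemma is_iso_cong:
  assumes "decorated_graph L n p H" "\<And>v. v \<in> verts H \<Longrightarrow> \<phi> v = \<psi> v"
  shows "is_iso \<phi> H S \<longleftrightarrow> is_iso \<psi> H S"
proof -
  have e: "\<phi> ` e = \<psi> ` e" if "e \<in> edges H" for e
    using decorated_edges[OF assms(1) that] assms(2) by (intro image_cong) auto
  have "bij_betw \<phi> (verts H) (verts S) = bij_betw \<psi> (verts H) (verts S)"
    by (rule bij_betw_cong) (rule assms(2))
  moreover have "(\<lambda>e. \<phi> ` e) ` edges H = (\<lambda>e. \<psi> ` e) ` edges H"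
    by (rule image_cong[OF refl e])
  ultimately show ?thesis unfolding is_iso_def using e assms(2) by simp
qed

text \<open>Restriction to the vertex set makes isomorphisms extensional, so that they can be
  counted.\<close>

lemma is_iso_restrict:
  "decorated_graph L n p H \<Longrightarrow> is_iso (restrict \<phi> (verts H)) H S \<longleftrightarrow> is_iso \<phi> H S"
  by (rule is_iso_cong) auto

lemma is_iso_id: "is_iso (\<lambda>v. v) H H"
  by (auto simp: is_iso_def bij_betw_def)

lemma is_iso_comp:
  assumes "is_iso \<phi> H S" "is_iso \<psi> S R"
  shows "is_iso (\<psi> \<circ> \<phi>) H R"
proof -
  have \<phi>: "bij_betw \<phi> (verts H) (verts S)" "\<And>v. v \<in> verts H \<Longrightarrow> \<phi> v \<in> range VA \<longleftrightarrow> v \<in> range VA"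
    "edges S = (\<lambda>e. \<phi> ` e) ` edges H" "\<And>e. e \<in> edges H \<Longrightarrow> dec S (\<phi> ` e) = dec H e"
    using assms(1) by (auto simp: is_iso_def)
  have \<psi>: "bij_betw \<psi> (verts S) (verts R)" "\<And>v. v \<in> verts S \<Longrightarrow> \<psi> v \<in> range VA \<longleftrightarrow> v \<in> range VA"
    "edges R = (\<lambda>e. \<psi> ` e) ` edges S" "\<And>e. e \<in> edges S \<Longrightarrow> dec R (\<psi> ` e) = dec S e"
    using assms(2) by (auto simp: is_iso_def)
  show ?thesis unfolding is_iso_def
  proof (intro conjI ballI)
    show "bij_betw (\<psi> \<circ> \<phi>) (verts H) (verts R)" by (rule bij_betw_trans[OF \<phi>(1) \<psi>(1)])
    show "((\<psi> \<circ> \<phi>) v \<in> range VA) = (v \<in> range VA)" if "v \<in> verts H" for v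
      using \<phi>(2)[OF that] \<psi>(2)[of "\<phi> v"] bij_betwE[OF \<phi>(1)] that by auto
    show "edges R = (\<lambda>e. (\<psi> \<circ> \<phi>) ` e) ` edges H"
      unfolding \<psi>(3) \<phi>(3) by (simp add: image_comp comp_def image_image)
    show "dec R ((\<psi> \<circ> \<phi>) ` e) = dec H e" if "e \<in> edges H" for e
      using \<phi>(4)[OF that] \<psi>(4)[of "\<phi> ` e"] \<phi>(3) that by (simp add: image_comp)
  qed
qed

lemma is_iso_inv:
  assumes "decorated_graph L n p H" "is_iso \<phi> H S"
  shows "is_iso (inv_into (verts H) \<phi>) S H"
proof -
  let ?\<psi> = "inv_into (verts H) \<phi>"
  have \<phi>: "bij_betw \<phi> (verts H) (verts S)" "\<And>v. v \<in> verts H \<Longrightarrow> \<phi> v \<in> range VA \<longleftrightarrow> v \<in> range VA"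
    "edges S = (\<lambda>e. \<phi> ` e) ` edges H" "\<And>e. e \<in> edges H \<Longrightarrow> dec S (\<phi> ` e) = dec H e"
    using assms(2) by (auto simp: is_iso_def)
  have inj: "inj_on \<phi> (verts H)" and im: "\<phi> ` verts H = verts S" using \<phi>(1) by (auto simp: bij_betw_def)
  have e: "?\<psi> ` (\<phi> ` e) = e" if "e \<in> edges H" for e
    by (rule inv_into_image_cancel[OF inj decorated_edges[OF assms(1) that]])
  show ?thesis unfolding is_iso_def
  proof (intro conjI ballI)
    show "bij_betw ?\<psi> (verts S) (verts H)" by (rule bij_betw_inv_into[OF \<phi>(1)])
    show "(?\<psi> v \<in> range VA) = (v \<in> range VA)" if "v \<in> verts S" for v
      using \<phi>(2)[of "?\<psi> v"] that im by (metis f_inv_into_f inv_into_into)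
    show "edges H = (\<lambda>e. ?\<psi> ` e) ` edges S"
    proof (intro equalityI subsetI)
      fix e' assume "e' \<in> edges H"
      then show "e' \<in> (\<lambda>e. ?\<psi> ` e) ` edges S"
        unfolding \<phi>(3) by (intro image_eqI[of _ _ "\<phi> ` e'"] e[symmetric] imageI)
    next
      fix e' assume "e' \<in> (\<lambda>e. ?\<psi> ` e) ` edges S"
      then obtain f where "f \<in> edges H" "e' = ?\<psi> ` (\<phi> ` f)" unfolding \<phi>(3) by blast
      then show "e' \<in> edges H" using e by simp
    qed
    show "dec H (?\<psi> ` e) = dec S e" if "e \<in> edges S" for e
      using that e \<phi>(4) unfolding \<phi>(3) by auto
  qed
qed

lemma isomorphic_sym: "decorated_graph L n p H \<Longrightarrow> isomorphic H S \<Longrightarrow> isomorphic S H"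
  unfolding isomorphic_def using is_iso_inv by blast

lemma isomorphic_trans: "isomorphic H S \<Longrightarrow> isomorphic S R \<Longrightarrow> isomorphic H R"
  unfolding isomorphic_def using is_iso_comp by blast

lemma isomorphic_refl: "isomorphic H H"
  unfolding isomorphic_def using is_iso_id by blast

section \<open>Quantities invariant under isomorphism\<close>

context
  fixes L n p H S \<phi>
  assumes H: "decorated_graph L n p H" and S: "decorated_graph L n p S" and iso: "is_iso \<phi> H S"
begin

lemma iso_facts: "inj_on \<phi> (verts H)" "\<phi> ` verts H = verts S" "\<And>v. v \<in> verts H \<Longrightarrow> \<phi> v \<in> range VA \<longleftrightarrow> v \<in> range VA"
    "edges S = (\<lambda>e. \<phi> ` e) ` edges H" "\<And>e. e \<in> edges H \<Longrightarrow> dec S (\<phi> ` e) = dec H e"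
  using iso by (auto simp: is_iso_def bij_betw_def)

lemma iso_El: "El S l = (\<lambda>e. \<phi> ` e) ` El H l"
  unfolding El_def iso_facts(4) using iso_facts(5) by auto

lemma iso_card_El: "card (El S l) = card (El H l)"
proof -
  have "inj_on (\<lambda>e. \<phi> ` e) (El H l)"
    using decorated_edges[OF H] inj_on_image_eq_iff[OF iso_facts(1)]
    by (auto simp: inj_on_def El_def)
  then show ?thesis unfolding iso_El by (rule card_image)
qed

lemma iso_Vl: "Vl S l = \<phi> ` Vl H l"
proof -
  have *: "Vl R l = \<Union> (El R l)" if "decorated_graph L n p R" for R
    using decorated_edges[OF that] by (auto simp: Vl_def El_def)
  show ?thesis unfolding *[OF H] *[OF S] iso_El by auto
qed

lemma Vl_subset: "Vl H l \<subseteq> verts H"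
  by (auto simp: Vl_def)

lemma iso_image_Int: "A \<subseteq> verts H \<Longrightarrow> B \<subseteq> verts H \<Longrightarrow> \<phi> ` (A \<inter> B) = \<phi> ` A \<inter> \<phi> ` B"
  by (rule inj_on_image_Int[OF iso_facts(1)])

lemma iso_card_image: "A \<subseteq> verts H \<Longrightarrow> card (\<phi> ` A) = card A"
  by (rule card_image) (rule inj_on_subset[OF iso_facts(1)])

lemma iso_dif0: "card (dif0 L S) = card (dif0 L H)"
proof -
  have U: "(\<Union>l\<in>{1..L}. Vl H l) \<subseteq> verts H" using Vl_subset by blast
  have "dif0 L S = \<phi> ` dif0 L H"
    unfolding dif0_def iso_Vl iso_image_Int[OF Vl_subset U] by blast
  moreover have "dif0 L H \<subseteq> verts H" using Vl_subset unfolding dif0_def by blast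
  ultimately show ?thesis using iso_card_image by simp
qed

lemma iso_dif: "card (dif L S) = card (dif L H)"
proof -
  have "dif L S = \<phi> ` dif L H"
    unfolding dif_def iso_Vl image_UN
    by (rule SUP_cong[OF refl]) (auto simp only: split_paired_all case_prod_conv iso_image_Int[OF Vl_subset Vl_subset])
  moreover have "dif L H \<subseteq> verts H" unfolding dif_def using Vl_subset by blast
  ultimately show ?thesis using iso_card_image by simp
qed

lemma iso_Xi: "Xi L \<mu> \<rho> \<gamma> lam eps S = Xi L \<mu> \<rho> \<gamma> lam eps H"
  unfolding Xi_def iso_dif iso_dif0 iso_card_El ..

lemma iso_card_Va: "card (Va S) = card (Va H)"
proof -
  have "Va S = \<phi> ` Va H"
  proof (intro equalityI subsetI)
    fix w assume w: "w \<in> Va S"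
    then obtain v where "v \<in> verts H" "w = \<phi> v" using iso_facts(2) by (auto simp: Va_def)
    then show "w \<in> \<phi> ` Va H" using w iso_facts(3)[of v] by (simp add: Va_def)
  next
    fix w assume "w \<in> \<phi> ` Va H"
    then obtain v where "v \<in> verts H" "w = \<phi> v" "v \<in> range VA" by (auto simp: Va_def)
    then show "w \<in> Va S" using iso_facts(2) iso_facts(3)[of v] by (auto simp: Va_def)
  qed
  moreover have "Va H \<subseteq> verts H" by (auto simp: Va_def)
  ultimately show ?thesis using iso_card_image by simp
qed

lemma iso_is_cycle: "is_cycle H \<Longrightarrow> is_cycle S"
proof -
  assume "is_cycle H"
  then obtain vs where vs: "3 \<le> length vs" "distinct vs" "verts H = set vs"
    "edges H = {{vs ! i, vs ! ((i + 1) mod length vs)} | i. i < length vs}"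
    unfolding is_cycle_def by blast
  have len: "(i + 1) mod length vs < length vs" for i using vs(1) by (intro mod_less_divisor) auto
  have E: "edges H = (\<lambda>i. {vs ! i, vs ! ((i + 1) mod length vs)}) ` {..<length vs}"
    unfolding vs(4) by blast
  have "edges S = {{map \<phi> vs ! i, map \<phi> vs ! ((i + 1) mod length (map \<phi> vs))} | i. i < length (map \<phi> vs)}"
  proof -
    have "edges S = (\<lambda>i. \<phi> ` {vs ! i, vs ! ((i + 1) mod length vs)}) ` {..<length vs}"
      unfolding iso_facts(4) E by (rule image_image)
    also have "\<dots> = (\<lambda>i. {map \<phi> vs ! i, map \<phi> vs ! ((i + 1) mod length vs)}) ` {..<length vs}"
      by (rule image_cong[OF refl]) (simp only: image_insert image_empty lessThan_iff nth_map[OF len] nth_map)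
    finally show ?thesis unfolding length_map by blast
  qed
  moreover have "distinct (map \<phi> vs)" using vs(2,3) iso_facts(1) by (simp add: distinct_map)
  moreover have "verts S = set (map \<phi> vs)" using vs(3) iso_facts(2) by auto
  ultimately show "is_cycle S" unfolding is_cycle_def using vs(1) by (intro exI[of _ "map \<phi> vs"]) simp
qed

text \<open>Composition with the fixed isomorphism \<phi> maps the automorphisms of H bijectively
  onto the isomorphisms from H to S.\<close>

lemma card_Isos: "card {\<psi> \<in> extensional (verts H). is_iso \<psi> H S} = card (Aut H)"
proof -
  let ?V = "verts H" and ?i = "inv_into (verts H) \<phi>"
  have inv: "is_iso ?i S H" by (rule is_iso_inv[OF H iso])
  have "bij_betw (\<lambda>\<alpha>. restrict (\<phi> \<circ> \<alpha>) ?V) (Aut H) {\<psi> \<in> extensional ?V. is_iso \<psi> H S}"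
  proof (rule bij_betw_byWitness[of _ "\<lambda>\<beta>. restrict (?i \<circ> \<beta>) ?V"])
    show "\<forall>\<alpha>\<in>Aut H. restrict (?i \<circ> restrict (\<phi> \<circ> \<alpha>) ?V) ?V = \<alpha>"
    proof
      fix \<alpha> assume "\<alpha> \<in> Aut H"
      then have a: "\<alpha> \<in> extensional ?V" "bij_betw \<alpha> ?V ?V" by (auto simp: Aut_def is_iso_def)
      have "restrict (?i \<circ> restrict (\<phi> \<circ> \<alpha>) ?V) ?V v = \<alpha> v" for v
        using a bij_betwE[OF a(2)] by (auto simp: inv_into_f_f[OF iso_facts(1)] extensional_def)
      then show "restrict (?i \<circ> restrict (\<phi> \<circ> \<alpha>) ?V) ?V = \<alpha>" by (rule ext)
    qed
    show "\<forall>\<beta>\<in>{\<psi> \<in> extensional ?V. is_iso \<psi> H S}. restrict (\<phi> \<circ> restrict (?i \<circ> \<beta>) ?V) ?V = \<beta>"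
    proof
      fix \<beta> assume "\<beta> \<in> {\<psi> \<in> extensional ?V. is_iso \<psi> H S}"
      then have a: "\<beta> \<in> extensional ?V" "bij_betw \<beta> ?V (verts S)" by (auto simp: is_iso_def)
      have "restrict (\<phi> \<circ> restrict (?i \<circ> \<beta>) ?V) ?V v = \<beta> v" for v
        using a bij_betwE[OF a(2)] f_inv_into_f[of "\<beta> v" \<phi> ?V] iso_facts(2) by (auto simp: extensional_def)
      then show "restrict (\<phi> \<circ> restrict (?i \<circ> \<beta>) ?V) ?V = \<beta>" by (rule ext)
    qed
    show "(\<lambda>\<alpha>. restrict (\<phi> \<circ> \<alpha>) ?V) ` Aut H \<subseteq> {\<psi> \<in> extensional ?V. is_iso \<psi> H S}"
      using is_iso_comp[OF _ iso] by (auto simp: Aut_def is_iso_restrict[OF H])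
    show "(\<lambda>\<beta>. restrict (?i \<circ> \<beta>) ?V) ` {\<psi> \<in> extensional ?V. is_iso \<psi> H S} \<subseteq> Aut H"
      using is_iso_comp[OF _ inv] by (auto simp: Aut_def is_iso_restrict[OF H])
  qed
  then show ?thesis by (rule bij_betw_same_card[symmetric])
qed

end

section \<open>Counting the copies of a decorated graph\<close>

lemma card_inj_PiE:
  assumes "finite A" "finite B"
  shows "card {f \<in> A \<rightarrow>\<^sub>E B. inj_on f A} = (\<Prod>i<card A. card B - i)"
  using card_inj_on_subset_funcset[OF assms order_refl] by (simp add: atLeast0LessThan)

definition Embs :: "nat \<Rightarrow> nat \<Rightarrow> dgraph \<Rightarrow> (vertex \<Rightarrow> vertex) set" where
  "Embs n p H = {\<phi> \<in> extensional (verts H). inj_on \<phi> (verts H) \<and>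
     \<phi> ` Va H \<subseteq> KVa n \<and> \<phi> ` (verts H - Va H) \<subseteq> KVb p}"

lemma KVa_KVb_disjoint: "KVa n \<inter> KVb p = {}"
  by (auto simp: KVa_def KVb_def)

text \<open>The a-vertices and b-vertices are placed independently of each other. Natural
  subtraction makes a falling factorial vanish when there is not enough room, as the count
  does.\<close>

lemma card_Embs:
  assumes "finite (verts H)"
  shows "finite (Embs n p H)"
    and "card (Embs n p H) = (\<Prod>i<card (Va H). n - i) * (\<Prod>i<card (verts H - Va H). p - i)"
proof -
  let ?A = "Va H" and ?B = "verts H - Va H" and ?V = "verts H"
  have fA: "finite ?A" "finite ?B" using assms by (auto simp: Va_def)
  have AV: "?A \<subseteq> ?V" by (auto simp: Va_def)
  have cK: "card (KVa n) = n" "card (KVb p) = p" "finite (KVa n)" "finite (KVb p)"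
    by (auto simp: KVa_def KVb_def card_image inj_on_def)
  let ?IA = "{f \<in> ?A \<rightarrow>\<^sub>E KVa n. inj_on f ?A}" and ?IB = "{f \<in> ?B \<rightarrow>\<^sub>E KVb p. inj_on f ?B}"
  have "bij_betw (\<lambda>\<phi>. (restrict \<phi> ?A, restrict \<phi> ?B)) (Embs n p H) (?IA \<times> ?IB)"
  proof (rule bij_betw_byWitness[of _ "\<lambda>(f, g). (\<lambda>v\<in>?V. if v \<in> ?A then f v else g v)"])
    show "\<forall>\<phi>\<in>Embs n p H. (case (restrict \<phi> ?A, restrict \<phi> ?B) of (f, g) \<Rightarrow> \<lambda>v\<in>?V. if v \<in> ?A then f v else g v) = \<phi>"
      by (auto simp: Embs_def extensional_def fun_eq_iff)
    show "\<forall>fg\<in>?IA \<times> ?IB. (\<lambda>\<phi>. (restrict \<phi> ?A, restrict \<phi> ?B)) (case fg of (f, g) \<Rightarrow> \<lambda>v\<in>?V. if v \<in> ?A then f v else g v) = fg"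
      using AV by (auto simp: PiE_def extensional_def fun_eq_iff)
    show "(\<lambda>\<phi>. (restrict \<phi> ?A, restrict \<phi> ?B)) ` Embs n p H \<subseteq> ?IA \<times> ?IB"
    proof
      fix x assume "x \<in> (\<lambda>\<phi>. (restrict \<phi> ?A, restrict \<phi> ?B)) ` Embs n p H"
      then obtain \<phi> where \<phi>: "\<phi> \<in> Embs n p H" "x = (restrict \<phi> ?A, restrict \<phi> ?B)" by blast
      have "inj_on \<phi> ?A" "inj_on \<phi> ?B" using \<phi>(1) AV by (auto simp: Embs_def intro: inj_on_subset)
      then show "x \<in> ?IA \<times> ?IB" using \<phi> by (auto simp: Embs_def inj_on_restrict_eq)
    qed
    show "(\<lambda>(f, g). (\<lambda>v\<in>?V. if v \<in> ?A then f v else g v)) ` (?IA \<times> ?IB) \<subseteq> Embs n p H"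
    proof
      fix \<phi> assume "\<phi> \<in> (\<lambda>(f, g). (\<lambda>v\<in>?V. if v \<in> ?A then f v else g v)) ` (?IA \<times> ?IB)"
      then obtain fg where "fg \<in> ?IA \<times> ?IB" "\<phi> = (\<lambda>(f, g). (\<lambda>v\<in>?V. if v \<in> ?A then f v else g v)) fg" by (rule imageE)
      moreover obtain f g where "fg = (f, g)" by (rule prod.exhaust)
      ultimately have fg: "f \<in> ?IA" "g \<in> ?IB" "\<phi> = (\<lambda>v\<in>?V. if v \<in> ?A then f v else g v)"
        by (simp_all only: mem_Sigma_iff case_prod_conv)
      have f: "\<And>v. v \<in> ?A \<Longrightarrow> f v \<in> KVa n" "inj_on f ?A" and g: "\<And>v. v \<in> ?B \<Longrightarrow> g v \<in> KVb p" "inj_on g ?B"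
        using fg by auto
      have d: "f v \<noteq> g w" if "v \<in> ?A" "w \<in> ?B" for v w
        using f(1)[OF that(1)] g(1)[OF that(2)] KVa_KVb_disjoint[of n p] by force
      have vA: "\<phi> v = f v" if "v \<in> ?A" for v using that AV unfolding fg(3) by auto
      have vB: "\<phi> v = g v" if "v \<in> ?B" for v using that unfolding fg(3) by auto
      have "inj_on \<phi> ?V"
      proof (rule inj_onI)
        fix v w assume vw: "v \<in> ?V" "w \<in> ?V" "\<phi> v = \<phi> w"
        then show "v = w"
          using vA[of v] vA[of w] vB[of v] vB[of w] d[of v w] d[of w v] inj_onD[OF f(2), of v w] inj_onD[OF g(2), of v w]
          by (cases "v \<in> ?A"; cases "w \<in> ?A") auto
      qed
      moreover have "\<phi> ` ?A \<subseteq> KVa n" using vA f(1) by auto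
      moreover have "\<phi> ` ?B \<subseteq> KVb p" using vB g(1) by auto
      ultimately show "\<phi> \<in> Embs n p H" by (simp add: Embs_def fg(3))
    qed
  qed
  note bij = this
  have "finite (?A \<rightarrow>\<^sub>E KVa n)" "finite (?B \<rightarrow>\<^sub>E KVb p)" by (rule finite_PiE; use fA cK in simp)+
  then have fin: "finite (?IA \<times> ?IB)" by (intro finite_cartesian_product finite_Collect_conjI disjI1) simp_all
  then show "finite (Embs n p H)" using bij_betw_finite[OF bij] by blast
  show "card (Embs n p H) = (\<Prod>i<card ?A. n - i) * (\<Prod>i<card ?B. p - i)"
    using bij_betw_same_card[OF bij] card_inj_PiE[OF fA(1) cK(3)] card_inj_PiE[OF fA(2) cK(4)]
    by (simp add: card_cartesian_product cK)
qed

lemma is_iso_Embs: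
  assumes H: "decorated_graph L n p H" and S: "decorated_graph L n p S" and iso: "is_iso \<phi> H S" "\<phi> \<in> extensional (verts H)"
  shows "\<phi> \<in> Embs n p H"
proof -
  note f = iso_facts[OF H S iso(1)]
  have "verts S \<subseteq> KVa n \<union> KVb p" using S by (simp add: decorated_graph_def)
  then have *: "\<phi> v \<in> KVa n \<union> KVb p" if "v \<in> verts H" for v using f(2) that by blast
  have KA: "w \<in> KVa n" if "w \<in> KVa n \<union> KVb p" "w \<in> range VA" for w using that by (auto simp: KVb_def)
  have KB: "w \<in> KVb p" if "w \<in> KVa n \<union> KVb p" "w \<notin> range VA" for w using that by (auto simp: KVa_def)
  have "\<phi> ` Va H \<subseteq> KVa n"
  proof
    fix w assume "w \<in> \<phi> ` Va H"
    then obtain v where "v \<in> verts H" "v \<in> range VA" "w = \<phi> v" by (auto simp: Va_def)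
    then show "w \<in> KVa n" using KA[OF *] f(3) by blast
  qed
  moreover have "\<phi> ` (verts H - Va H) \<subseteq> KVb p"
  proof
    fix w assume "w \<in> \<phi> ` (verts H - Va H)"
    then obtain v where "v \<in> verts H" "v \<notin> range VA" "w = \<phi> v" unfolding Va_def by blast
    then show "w \<in> KVb p" using KB[OF *] f(3) by blast
  qed
  ultimately show ?thesis using f(1) iso(2) by (simp add: Embs_def)
qed

lemma KEaI:
  assumes "i \<noteq> j" "i < n" "j < n"
  shows "{VA i, VA j} \<in> KEa n"
proof (cases "i < j")
  case True
  then show ?thesis using assms unfolding KEa_def by blast
next
  case False
  then have "j < i" using assms by simp
  then have "{VA j, VA i} \<in> KEa n" using assms unfolding KEa_def by blast
  then show ?thesis by (simp only: insert_commute)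
qed

text \<open>The complete host graph contains every a-a and every a-b pair, so the image of a
  decorated graph is again one; its decoration is pulled back along \<open>inv_into\<close>.\<close>

lemma Embs_image_graph:
  assumes H: "decorated_graph L n p H" and \<phi>: "\<phi> \<in> Embs n p H"
  obtains S where "decorated_graph L n p S" "is_iso \<phi> H S"
proof -
  let ?V = "verts H" and ?i = "inv_into (verts H) \<phi>"
  define E where "E = (\<lambda>e. \<phi> ` e) ` edges H"
  define S :: dgraph where "S = \<lparr>verts = \<phi> ` ?V, edges = E, dec = (\<lambda>e\<in>E. dec H (?i ` e))\<rparr>"
  have inj: "inj_on \<phi> ?V" and A: "\<And>v. v \<in> Va H \<Longrightarrow> \<phi> v \<in> KVa n" and B: "\<And>v. v \<in> ?V - Va H \<Longrightarrow> \<phi> v \<in> KVb p"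
    using \<phi> by (auto simp: Embs_def)
  have cancel: "?i ` (\<phi> ` e) = e" if "e \<in> edges H" for e
    by (rule inv_into_image_cancel[OF inj decorated_edges[OF H that]])
  have edge: "\<phi> ` e \<in> KEa n \<union> KEb n p \<and> (\<phi> ` e \<in> KEb n p \<longleftrightarrow> e \<in> KEb n p)" if e: "e \<in> edges H" for e
  proof -
    have sub: "e \<subseteq> ?V" by (rule decorated_edges[OF H e])
    have "e \<in> KEa n \<or> e \<in> KEb n p" using H e by (auto simp: decorated_graph_def)
    then show ?thesis
    proof
      assume ea: "e \<in> KEa n"
      then obtain i j where ij: "e = {VA i, VA j}" "i < j" by (auto simp: KEa_def)
      then have "VA i \<in> Va H" "VA j \<in> Va H" "VA i \<in> ?V" "VA j \<in> ?V" using sub by (auto simp: Va_def)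
      moreover have "\<phi> (VA i) \<noteq> \<phi> (VA j)" using inj ij(2) \<open>VA i \<in> ?V\<close> \<open>VA j \<in> ?V\<close> by (auto dest: inj_onD)
      moreover obtain i' j' where "\<phi> (VA i) = VA i'" "i' < n" "\<phi> (VA j) = VA j'" "j' < n"
        using A[of "VA i"] A[of "VA j"] \<open>VA i \<in> Va H\<close> \<open>VA j \<in> Va H\<close> by (auto simp: KVa_def)
      ultimately have "\<phi> ` e = {VA i', VA j'}" "i' \<noteq> j'" "i' < n" "j' < n" using ij by auto
      then have "\<phi> ` e \<in> KEa n" using KEaI by simp
      then show ?thesis using ea KEb_not_KEa by blast
    next
      assume eb: "e \<in> KEb n p"
      then obtain i k where ij: "e = {VA i, VB k}" by (auto simp: KEb_def)
      then have "VA i \<in> Va H" "VB k \<in> ?V - Va H" using sub by (auto simp: Va_def)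
      then have "\<phi> (VA i) \<in> KVa n" "\<phi> (VB k) \<in> KVb p" using A B by auto
      then obtain i' k' where "\<phi> (VA i) = VA i'" "i' < n" "\<phi> (VB k) = VB k'" "k' < p"
        by (auto simp: KVa_def KVb_def)
      then have "\<phi> ` e \<in> KEb n p" using ij unfolding KEb_def by auto
      then show ?thesis using eb by blast
    qed
  qed
  have d: "decorated_graph L n p S"
    unfolding decorated_graph_def
  proof (intro conjI ballI)
    have "?V = Va H \<union> (?V - Va H)" by (auto simp: Va_def)
    then show "verts S \<subseteq> KVa n \<union> KVb p" using A B by (auto simp: S_def)
    show "edges S \<subseteq> KEa n \<union> KEb n p" using edge by (auto simp: S_def E_def)
    show "e \<subseteq> verts S" if "e \<in> edges S" for e
      using that decorated_edges[OF H] by (auto simp: S_def E_def)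
    show "dec S \<in> edges S \<rightarrow>\<^sub>E {0..L}"
      using H by (auto simp: S_def E_def cancel decorated_graph_def)
    show "(dec S e = 0) = (e \<in> KEb n p)" if "e \<in> edges S" for e
      using that edge H by (auto simp: S_def E_def cancel decorated_graph_def)
  qed
  have "(\<phi> v \<in> range VA) = (v \<in> range VA)" if "v \<in> ?V" for v
    using that A[of v] B[of v] by (cases "v \<in> Va H") (auto simp: Va_def KVa_def KVb_def)
  then have "is_iso \<phi> H S"
    using inj by (auto simp: is_iso_def S_def E_def bij_betw_def cancel)
  with d show thesis by (rule that)
qed

lemma is_iso_unique:
  assumes "decorated_graph L n p S" "decorated_graph L n p S'" "is_iso \<phi> H S" "is_iso \<phi> H S'"
  shows "S = S'"
proof -
  have e: "edges S = edges S'" "edges S = (\<lambda>e. \<phi> ` e) ` edges H" using assms(3,4) by (auto simp: is_iso_def)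
  have v: "verts S = verts S'" using assms(3,4) by (auto simp: is_iso_def bij_betw_def)
  have d: "dec S x = dec S' x" for x
  proof (cases "x \<in> edges S")
    case True
    then obtain e' where "e' \<in> edges H" "x = \<phi> ` e'" using e(2) by auto
    then show ?thesis using assms(3,4) by (simp add: is_iso_def)
  next
    case False
    then show ?thesis using assms(1,2) e(1) by (auto simp: decorated_graph_def PiE_def extensional_def)
  qed
  show ?thesis using v e(1) d by (intro dgraph.equality) (auto intro: ext)
qed

text \<open>Orbit counting: every embedding is an isomorphism onto exactly one graph, its image, and
  every graph of the class is the image of |Aut H| embeddings.\<close>

lemma card_iso_class:
  assumes H: "decorated_graph L n p H"
  shows "card {S. decorated_graph L n p S \<and> isomorphic H S} * card (Aut H) =
    (\<Prod>i<card (Va H). n - i) * (\<Prod>i<card (verts H - Va H). p - i)"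
proof -
  let ?C = "{S. decorated_graph L n p S \<and> isomorphic H S}"
  let ?I = "\<lambda>S. {\<psi> \<in> extensional (verts H). is_iso \<psi> H S}"
  note emb = card_Embs[OF finite_verts[OF H], of n p]
  have un: "Embs n p H = (\<Union>S\<in>?C. ?I S)"
  proof (intro equalityI subsetI)
    fix \<phi> assume "\<phi> \<in> Embs n p H"
    moreover then obtain S where "decorated_graph L n p S" "is_iso \<phi> H S" using Embs_image_graph[OF H] by blast
    ultimately show "\<phi> \<in> (\<Union>S\<in>?C. ?I S)" by (auto simp: isomorphic_def Embs_def)
  next
    fix \<phi> assume "\<phi> \<in> (\<Union>S\<in>?C. ?I S)"
    then show "\<phi> \<in> Embs n p H" using is_iso_Embs[OF H] by blast
  qed
  have ne: "?I S \<noteq> {}" if "S \<in> ?C" for S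
  proof -
    obtain \<phi> where "is_iso \<phi> H S" using \<open>S \<in> ?C\<close> by (auto simp: isomorphic_def)
    then have "restrict \<phi> (verts H) \<in> ?I S" by (simp add: is_iso_restrict[OF H])
    then show ?thesis by blast
  qed
  have disj: "?I S \<inter> ?I S' = {}" if "S \<in> ?C" "S' \<in> ?C" "S \<noteq> S'" for S S'
    using is_iso_unique[of L n p S S' _ H] that by blast
  \<comment> \<open>Different graphs have disjoint nonempty sets of isomorphisms, so finiteness
    passes from the embeddings to the class.\<close>
  have "inj_on ?I ?C"
  proof (rule inj_onI)
    fix S S' assume "S \<in> ?C" "S' \<in> ?C" "?I S = ?I S'"
    then show "S = S'" using ne[of S] disj[of S S'] by blast
  qed
  moreover have "finite (?I ` ?C)"
    by (rule finite_subset[of _ "Pow (Embs n p H)"]) (use un emb in auto)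
  ultimately have fin: "finite ?C" using finite_imageD by blast
  have "card (Embs n p H) = (\<Sum>S\<in>?C. card (?I S))"
    unfolding un
  proof (rule card_UN_disjoint[OF fin])
    show "\<forall>S\<in>?C. finite (?I S)"
    proof
      fix S assume "S \<in> ?C"
      then have "?I S \<subseteq> Embs n p H" unfolding un by blast
      then show "finite (?I S)" by (rule finite_subset[OF _ emb(1)])
    qed
  qed (use disj in blast)
  also have "\<dots> = (\<Sum>S\<in>?C. card (Aut H))"
    by (rule sum.cong) (use card_Isos[OF H] in \<open>auto simp: isomorphic_def\<close>)
  finally show ?thesis
    using emb(2) by simp
qed

section \<open>Cycles grouped into isomorphism classes\<close>

definition cycles :: "nat \<Rightarrow> nat \<Rightarrow> nat \<Rightarrow> nat \<Rightarrow> dgraph set" where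
  "cycles L n p a = {H. decorated_graph L n p H \<and> is_cycle H \<and> card (Va H) = a}"

lemma finite_cycles: "finite (cycles L n p a)"
proof (rule finite_imageD[of "code_of L n p"])
  show "finite (code_of L n p ` cycles L n p a)"
    by (rule finite_subset[of _ "Pow (codes L n p)"]) (auto dest: subsetD[OF code_of_subset])
  show "inj_on (code_of L n p) (cycles L n p a)"
    by (rule inj_onI) (auto simp: cycles_def intro: code_of_inj)
qed

lemma cycles_iso_closed:
  assumes "H \<in> cycles L n p a" "decorated_graph L n p S" "isomorphic H S"
  shows "S \<in> cycles L n p a"
  using assms iso_is_cycle[of L n p H S] iso_card_Va[of L n p H S] by (auto simp: cycles_def isomorphic_def)

lemma cycle_class_eq:
  assumes "C \<in> cycle_classes L n p a" "H \<in> C"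
  shows "H \<in> cycles L n p a" "C = {S. decorated_graph L n p S \<and> isomorphic H S}"
    "C = {S. decorated_graph L n p S \<and> isomorphic S H}"
proof -
  obtain R where R: "R \<in> cycles L n p a" "C = iso_rel L n p `` {R}"
    using assms(1) unfolding cycle_classes_def cycles_def by (rule quotientE)
  have dR: "decorated_graph L n p R" using R by (simp add: cycles_def)
  have H: "decorated_graph L n p H" "isomorphic R H" using assms(2) R(2) by (auto simp: iso_rel_def)
  show "H \<in> cycles L n p a" by (rule cycles_iso_closed[OF R(1) H])
  have "C = {S. decorated_graph L n p S \<and> isomorphic R S}" unfolding R(2) using dR by (auto simp: iso_rel_def)
  then show 1: "C = {S. decorated_graph L n p S \<and> isomorphic H S}"
    using isomorphic_trans[of R H] isomorphic_trans[of H R] isomorphic_sym[OF dR H(2)] H(2) by blast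
  then show "C = {S. decorated_graph L n p S \<and> isomorphic S H}"
    using isomorphic_sym[OF H(1)] isomorphic_sym[of L n p _ H] by blast
qed

lemma cycle_class_of:
  assumes "H \<in> cycles L n p a"
  shows "{S. decorated_graph L n p S \<and> isomorphic H S} \<in> cycle_classes L n p a"
proof -
  have "{S. decorated_graph L n p S \<and> isomorphic H S} = iso_rel L n p `` {H}"
    using assms by (auto simp: iso_rel_def cycles_def)
  then show ?thesis using assms unfolding cycle_classes_def cycles_def by (auto intro: quotientI)
qed

lemma rep_in_class:
  assumes "C \<in> cycle_classes L n p a"
  shows "rep C \<in> C"
proof -
  obtain R where R: "R \<in> cycles L n p a" "C = iso_rel L n p `` {R}"
    using assms(1) unfolding cycle_classes_def cycles_def by (rule quotientE)
  then have "R \<in> C" by (auto simp: iso_rel_def cycles_def isomorphic_refl)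
  then show ?thesis unfolding rep_def by (rule someI)
qed

text \<open>The classes partition the cycles; this removes the chosen representatives from the
  statistic.\<close>

lemma sum_cycle_classes:
  fixes g :: "dgraph \<Rightarrow> real"
  shows "(\<Sum>C\<in>cycle_classes L n p a. \<Sum>S\<in>C. g S) = (\<Sum>S\<in>cycles L n p a. g S)"
proof -
  have un: "\<Union> (cycle_classes L n p a) = cycles L n p a"
  proof (intro equalityI subsetI)
    fix H assume "H \<in> \<Union> (cycle_classes L n p a)"
    then show "H \<in> cycles L n p a" using cycle_class_eq(1) by blast
  next
    fix H assume H: "H \<in> cycles L n p a"
    then have "H \<in> {S. decorated_graph L n p S \<and> isomorphic H S}" by (simp add: cycles_def isomorphic_refl)
    then show "H \<in> \<Union> (cycle_classes L n p a)" using cycle_class_of[OF H] by blast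
  qed
  have "sum g (\<Union> (cycle_classes L n p a)) = (sum \<circ> sum) g (cycle_classes L n p a)"
  proof (rule sum.Union_disjoint)
    show "\<forall>C\<in>cycle_classes L n p a. finite C"
      using un finite_cycles[of L n p a] finite_subset[OF Union_upper] by metis
    show "\<forall>C\<in>cycle_classes L n p a. \<forall>D\<in>cycle_classes L n p a. C \<noteq> D \<longrightarrow> C \<inter> D = {}"
      using cycle_class_eq(2) by blast
  qed
  then show ?thesis by (simp add: un)
qed

lemma powr_half_nat:
  assumes "x > 0"
  shows "x powr (real e / 2) = sqrt x ^ e"
proof -
  have "sqrt x ^ e = (x powr (1 / 2)) ^ e" using assms by (simp add: powr_half_sqrt)
  also have "\<dots> = x powr (real e / 2)" using assms by (simp add: powr_power)
  finally show ?thesis by simp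
qed

section \<open>Edge counts and layer changes of a single cycle\<close>

context
  fixes L n p S N
  assumes SC: "S \<in> cycles L n p N"
begin

private lemma dec_cyc: "decorated_graph L n p S" "is_cycle S" "card (Va S) = N"
  using SC by (auto simp: cycles_def)

private abbreviation "T \<equiv> code_of L n p S"

lemma finite_verts_cycle: "finite (verts S)" "Va S \<subseteq> verts S"
  using finite_verts[OF dec_cyc(1)] by (auto simp: Va_def)

lemma card_El_code_of: "card (El S l) = card {t \<in> T. fst t = l}"
proof -
  have "bij_betw ends {t \<in> T. fst t = l} (El S l)"
  proof (rule bij_betw_subset[OF code_of_bij[OF dec_cyc(1)]])
    show "ends ` {t \<in> T. fst t = l} = El S l"
    proof (intro equalityI subsetI)
      fix e assume "e \<in> El S l"
      then show "e \<in> ends ` {t \<in> T. fst t = l}" using edge_has_code[OF dec_cyc(1), of e] by (auto simp: El_def)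
    qed (auto simp: code_of_def)
  qed auto
  then show ?thesis by (rule bij_betw_same_card[symmetric])
qed

lemma card_code_of: "card T = N + card (verts S - Va S)"
proof -
  have "card T = card (verts S)"
    using card_cyclic[OF code_of_subset cyclic_code_of[OF dec_cyc(1,2)]] tverts_code_of[OF dec_cyc(1,2)] by simp
  also have "\<dots> = card (Va S) + card (verts S - Va S)"
    using finite_verts_cycle by (metis card_Diff_subset card_mono finite_subset le_add_diff_inverse)
  finally show ?thesis using dec_cyc(3) by simp
qed

text \<open>Layer-0 edges are exactly the edges at b-vertices, each b-vertex has degree 2, and no
  edge has two b-ends.\<close>

lemma card_layer0: "card {t \<in> T. fst t = 0} = 2 * card (verts S - Va S)"
proof -
  let ?B = "verts S - Va S"
  have eq: "{t \<in> T. fst t = 0} = (\<Union>v\<in>?B. {t \<in> T. v \<in> ends t})"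
  proof (intro equalityI subsetI)
    fix t assume t: "t \<in> {t \<in> T. fst t = 0}"
    then have v: "VB (snd (snd t)) \<in> ends t" by (simp add: VB_in_ends)
    then have "VB (snd (snd t)) \<in> verts S"
      using t tverts_code_of[OF dec_cyc(1,2)] unfolding tverts_def by blast
    then have "VB (snd (snd t)) \<in> ?B" by (auto simp: Va_def)
    then show "t \<in> (\<Union>v\<in>?B. {t \<in> T. v \<in> ends t})" using t v by blast
  next
    fix t assume "t \<in> (\<Union>v\<in>?B. {t \<in> T. v \<in> ends t})"
    then obtain v where v: "v \<in> verts S" "v \<notin> Va S" "t \<in> T" "v \<in> ends t" by blast
    then obtain k where "v = VB k" by (cases v) (auto simp: Va_def)
    then show "t \<in> {t \<in> T. fst t = 0}" using v by (simp add: VB_in_ends)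
  qed
  have "card {t \<in> T. fst t = 0} = (\<Sum>v\<in>?B. card {t \<in> T. v \<in> ends t})"
    unfolding eq
  proof (rule card_UN_disjoint)
    show "\<forall>v\<in>?B. \<forall>w\<in>?B. v \<noteq> w \<longrightarrow> {t \<in> T. v \<in> ends t} \<inter> {t \<in> T. w \<in> ends t} = {}"
    proof (intro ballI impI)
      fix v w assume vw: "v \<in> ?B" "w \<in> ?B" "v \<noteq> w"
      then obtain k k' where "v = VB k" "w = VB k'" by (cases v; cases w) (auto simp: Va_def)
      then show "{t \<in> T. v \<in> ends t} \<inter> {t \<in> T. w \<in> ends t} = {}" using vw(3) by (auto simp: VB_in_ends)
    qed
  qed (use finite_verts_cycle in auto)
  also have "\<dots> = (\<Sum>v\<in>?B. 2)"
    using deg_code_of[OF dec_cyc(1,2)] by (intro sum.cong) (auto simp: deg_def)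
  finally show ?thesis by simp
qed

text \<open>Every edge has an a-end and each of the N a-vertices lies on two edges, so there are at
  most 2 N edges, while their number is N plus that of the b-vertices.\<close>

lemma card_Vb_le: "card (verts S - Va S) \<le> N"
proof -
  have "T = (\<Union>v\<in>Va S. {t \<in> T. v \<in> ends t})"
  proof (intro equalityI subsetI)
    fix t assume t: "t \<in> T"
    have v: "VA (fst (snd t)) \<in> ends t" by (simp add: VA_in_ends)
    then have "VA (fst (snd t)) \<in> Va S"
      using t tverts_code_of[OF dec_cyc(1,2)] unfolding tverts_def Va_def by blast
    then show "t \<in> (\<Union>v\<in>Va S. {t \<in> T. v \<in> ends t})" using t v by blast
  qed blast
  then have "card T = card (\<Union>v\<in>Va S. {t \<in> T. v \<in> ends t})" by simp
  also have "\<dots> \<le> (\<Sum>v\<in>Va S. card {t \<in> T. v \<in> ends t})"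
    using finite_subset[OF finite_verts_cycle(2,1)] by (rule card_UN_le)
  also have "\<dots> = (\<Sum>v\<in>Va S. 2)"
    using deg_code_of[OF dec_cyc(1,2)] finite_verts_cycle(2) by (intro sum.cong) (auto simp: deg_def)
  finally show ?thesis using card_code_of dec_cyc(3) by simp
qed

lemma Vl_code_of: "VA i \<in> Vl S l \<longleftrightarrow> (\<exists>t\<in>T. fst t = l \<and> VA i \<in> ends t)"
proof
  assume "VA i \<in> Vl S l"
  then obtain e where "e \<in> edges S" "dec S e = l" "VA i \<in> e" by (auto simp: Vl_def El_def)
  then show "\<exists>t\<in>T. fst t = l \<and> VA i \<in> ends t" using edge_has_code[OF dec_cyc(1), of e] by blast
next
  assume "\<exists>t\<in>T. fst t = l \<and> VA i \<in> ends t"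
  then obtain t where t: "t \<in> T" "fst t = l" "VA i \<in> ends t" by blast
  then have "ends t \<in> El S l" by (auto simp: code_of_def)
  moreover then have "VA i \<in> verts S" using t(3) decorated_edges[OF dec_cyc(1), of "ends t"] by (auto simp: El_def)
  ultimately show "VA i \<in> Vl S l" using t(3) by (auto simp: Vl_def)
qed

lemma Vl_pos_VA:
  assumes "v \<in> Vl S l" "l \<ge> 1"
  shows "v \<in> VA ` {..<n}"
proof -
  obtain e where e: "e \<in> edges S" "dec S e = l" "v \<in> e" using assms(1) by (auto simp: Vl_def El_def)
  then have "e \<notin> KEb n p" "e \<in> KEa n \<union> KEb n p" using dec_cyc(1) assms(2) by (auto simp: decorated_graph_def)
  then show ?thesis using e(3) by (auto simp: KEa_def)
qed

text \<open>At an a-vertex only the layers of its two edges matter. Equal layers pair off, layer 0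
  next to a graph layer leaves one unpaired z, two different graph layers leave two. This is the
  origin of the exponents 1 for \<open>dif0\<close> and 2 for \<open>dif\<close> in
  \<open>Xi\<close>.\<close>

lemma odd_count_code_of: "odd_count L n T = card (dif0 L S) + 2 * card (dif L S)"
proof -
  define D where "D i = {l \<in> {1..L}. odd (ldeg T l i)}" for i
  have "odd_count L n T = card (SIGMA i:{..<n}. D i)"
    unfolding odd_count_def D_def
    by (rule bij_betw_same_card[of prod.swap]) (auto simp: bij_betw_def inj_on_def image_iff)
  also have "\<dots> = (\<Sum>i<n. card (D i))" by (rule card_SigmaI) (auto simp: D_def)
  also have "\<dots> = (\<Sum>i<n. of_bool (VA i \<in> dif0 L S) + 2 * of_bool (VA i \<in> dif L S))"
  proof (rule sum.cong[OF refl])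
    fix i assume "i \<in> {..<n}"
    show "card (D i) = of_bool (VA i \<in> dif0 L S) + 2 * of_bool (VA i \<in> dif L S)"
    proof (cases "VA i \<in> verts S")
      case False
      then have no: "VA i \<notin> ends t" if "t \<in> T" for t
        using that tverts_code_of[OF dec_cyc(1,2)] unfolding tverts_def by blast
      then have emp: "{t\<in>T. fst t = l \<and> VA i \<in> ends t} = {}" for l by blast
      have "D i = {}" unfolding D_def ldeg_def emp by simp
      moreover have "VA i \<notin> dif0 L S" "VA i \<notin> dif L S"
        using False by (auto simp: dif0_def dif_def Vl_def)
      ultimately show ?thesis by simp
    next
      case True
      then have "card {t \<in> T. VA i \<in> ends t} = 2" using deg_code_of[OF dec_cyc(1,2)] by (simp add: deg_def)
      then obtain t1 t2 where t12: "{t \<in> T. VA i \<in> ends t} = {t1, t2}" "t1 \<noteq> t2" by (auto simp: card_2_iff)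
      have mem: "t1 \<in> T" "t2 \<in> T" using t12(1) by blast+
      define l1 l2 where "l1 = fst t1" and "l2 = fst t2"
      have lL: "l1 \<le> L" "l2 \<le> L" using mem by (cases t1; cases t2; auto simp: l1_def l2_def code_of_def mem_codes split: if_splits)+
      have V: "VA i \<in> Vl S l \<longleftrightarrow> l = l1 \<or> l = l2" for l
      proof -
        have "(\<exists>t\<in>T. fst t = l \<and> VA i \<in> ends t) \<longleftrightarrow> (\<exists>t\<in>{t \<in> T. VA i \<in> ends t}. fst t = l)" by blast
        also have "\<dots> \<longleftrightarrow> l = l1 \<or> l = l2" unfolding t12(1) l1_def l2_def by auto
        finally show ?thesis unfolding Vl_code_of .
      qed
      have "odd (ldeg T l i) \<longleftrightarrow> (l = l1) \<noteq> (l = l2)" for l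
      proof -
        have "{t\<in>T. fst t = l \<and> VA i \<in> ends t} = {t \<in> {t1, t2}. fst t = l}" unfolding t12(1)[symmetric] by blast
        also have "\<dots> = (if l = l1 then {t1} else {}) \<union> (if l = l2 then {t2} else {})"
          by (auto simp: l1_def l2_def)
        finally have eq: "{t\<in>T. fst t = l \<and> VA i \<in> ends t} = (if l = l1 then {t1} else {}) \<union> (if l = l2 then {t2} else {})" .
        show ?thesis unfolding ldeg_def eq using t12(2) by (cases "l = l1"; cases "l = l2") simp_all
      qed
      then have D: "D i = {l \<in> {1..L}. (l = l1) \<noteq> (l = l2)}" unfolding D_def by simp
      have d0: "VA i \<in> dif0 L S \<longleftrightarrow> (0 = l1 \<or> 0 = l2) \<and> (1 \<le> l1 \<or> 1 \<le> l2)"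
        using lL by (auto simp: dif0_def V)
      have d1: "VA i \<in> dif L S \<longleftrightarrow> 1 \<le> l1 \<and> 1 \<le> l2 \<and> l1 \<noteq> l2"
      proof
        assume r: "1 \<le> l1 \<and> 1 \<le> l2 \<and> l1 \<noteq> l2"
        have "VA i \<in> Vl S (min l1 l2) \<inter> Vl S (max l1 l2)" by (simp add: V min_def max_def)
        moreover have "1 \<le> min l1 l2" "min l1 l2 < max l1 l2" "max l1 l2 \<le> L" using r lL by auto
        ultimately show "VA i \<in> dif L S" unfolding dif_def by blast
      qed (auto simp: dif_def V)
      consider "l1 = l2" | "l1 \<noteq> l2" "l1 = 0" | "l1 \<noteq> l2" "l2 = 0" | "l1 \<noteq> l2" "l1 \<ge> 1" "l2 \<ge> 1" by linarith
      then show ?thesis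
      proof cases
        case 1
        then have "D i = {}" unfolding D by auto
        then show ?thesis using 1 by (auto simp: d0 d1)
      next
        case 2
        then have "D i = {l2}" using lL unfolding D by auto
        then show ?thesis using 2 by (auto simp: d0 d1)
      next
        case 3
        then have "D i = {l1}" using lL unfolding D by auto
        then show ?thesis using 3 by (auto simp: d0 d1)
      next
        case 4
        then have "D i = {l1, l2}" using lL unfolding D by auto
        then show ?thesis using 4 by (auto simp: d0 d1)
      qed
    qed
  qed
  also have "\<dots> = card {i\<in>{..<n}. VA i \<in> dif0 L S} + 2 * card {i\<in>{..<n}. VA i \<in> dif L S}"
    by (simp add: sum.distrib sum_distrib_left[symmetric] of_bool_def sum.inter_filter[symmetric])
  also have "card {i\<in>{..<n}. VA i \<in> dif0 L S} = card (dif0 L S)"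
  proof -
    have "VA ` {i\<in>{..<n}. VA i \<in> dif0 L S} = dif0 L S"
      using Vl_pos_VA by (force simp: dif0_def)
    then show ?thesis by (metis (no_types, lifting) card_image inj_onI vertex.inject(1))
  qed
  also have "card {i\<in>{..<n}. VA i \<in> dif L S} = card (dif L S)"
  proof -
    have "VA ` {i\<in>{..<n}. VA i \<in> dif L S} = dif L S"
      using Vl_pos_VA by (force simp: dif_def)
    then show ?thesis by (metis (no_types, lifting) card_image inj_onI vertex.inject(1))
  qed
  finally show ?thesis .
qed

end

section \<open>The coefficients of the statistic and the normalisation\<close>

locale planted_cycles = planted_model +
  fixes \<gamma> :: real and N :: nat
  assumes gamma_pos: "\<gamma> > 0" and p_eq: "real p = real n / \<gamma>"
begin

abbreviation "XI \<equiv> Xi L \<mu> \<rho> \<gamma> lam eps"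
abbreviation "BETA \<equiv> beta L \<mu> \<rho> \<gamma> lam eps n p N"

definition coef :: "dgraph \<Rightarrow> real" where
  "coef S = XI S / (real n powr (real N / 2) * real p powr (real (card (El S 0)) / 4))"

lemma p_pos: "p > 0"
proof -
  have "real p > 0" unfolding p_eq using gamma_pos n_pos by simp
  then show ?thesis by simp
qed

text \<open>With k b-vertices, layer 0 has 2 k edges, and \<mu>^2 / (\<gamma> p) = \<mu>^2 / n
  because p = n / \<gamma>. The factor n^(N/2) is split between the N - k graph edges and the k
  passages through b-vertices, so that each passage receives \<mu> / n.\<close>

lemma coef_eq_val:
  assumes S: "S \<in> cycles L n p N"
  shows "coef S = val (code_of L n p S)"
proof -
  let ?T = "code_of L n p S"
  define k where "k = card (verts S - Va S)"
  define e where "e l = card (El S l)" for l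
  have e: "e l = card {t \<in> ?T. fst t = l}" for l unfolding e_def by (rule card_El_code_of[OF S])
  have e0: "e 0 = 2 * k" using card_layer0[OF S] e by (simp add: k_def)
  have layers: "(\<Prod>t\<in>?T. g (fst t)) = (\<Prod>l\<in>{0..L}. g l ^ e l)" for g :: "nat \<Rightarrow> real"
  proof -
    have "(\<Prod>t\<in>?T. g (fst t)) = (\<Prod>l\<in>{0..L}. \<Prod>t\<in>{t\<in>?T. fst t = l}. g (fst t))"
      by (rule prod.group[symmetric]) (auto simp: code_of_def mem_codes split: if_splits)
    also have "\<dots> = (\<Prod>l\<in>{0..L}. g l ^ e l)" by (rule prod.cong[OF refl]) (simp add: e)
    finally show ?thesis .
  qed
  have split0: "{0..L} = insert 0 {1..L}" by auto
  have sum_e: "(\<Sum>l\<in>{1..L}. e l) + k = N"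
  proof -
    have "(\<Sum>l\<in>{0..L}. e l) = card ?T"
    proof -
      have "card ?T = (\<Sum>t\<in>?T. 1)" by simp
      also have "\<dots> = (\<Sum>l\<in>{0..L}. \<Sum>t\<in>{t\<in>?T. fst t = l}. 1)"
        by (rule sum.group[symmetric]) (auto simp: code_of_def mem_codes split: if_splits)
      finally show ?thesis by (simp add: e)
    qed
    then show ?thesis using card_code_of[OF S] e0 unfolding split0 by (simp add: k_def)
  qed
  define s where "s = sqrt (real n)"
  have s: "s > 0" "s * s = real n" using n_pos by (auto simp: s_def)
  have A: "(\<Prod>t\<in>?T. mn t) = (\<mu> / real n) ^ k * (\<Prod>l\<in>{1..L}. (eps l * sqrt (lam l / real n)) ^ e l)"
  proof -
    have "(\<Prod>t\<in>?T. mn t) = (\<Prod>l\<in>{0..L}. (if l = 0 then sqrt (\<mu> / real n) else eps l * sqrt (lam l / real n)) ^ e l)"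
      unfolding mean_def by (rule layers)
    also have "\<dots> = sqrt (\<mu> / real n) ^ e 0 * (\<Prod>l\<in>{1..L}. (eps l * sqrt (lam l / real n)) ^ e l)"
      unfolding split0 by (subst prod.insert) (auto intro!: prod.cong)
    also have "sqrt (\<mu> / real n) ^ e 0 = (\<mu> / real n) ^ k"
      using mu_pos by (simp add: e0 power_mult)
    finally show ?thesis .
  qed
  have B: "(\<Prod>l\<in>{1..L}. (eps l * sqrt (lam l / real n)) ^ e l) = (\<Prod>l\<in>{1..L}. ((eps l)\<^sup>2 * lam l) powr (real (e l) / 2)) / s ^ (\<Sum>l\<in>{1..L}. e l)"
  proof -
    have "((eps l)\<^sup>2 * lam l) powr (real (e l) / 2) = (eps l * sqrt (lam l)) ^ e l" if "l \<in> {1..L}" for l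
      using lam_pos[OF that] eps01[OF that] by (simp add: powr_half_nat real_sqrt_mult)
    then have "(\<Prod>l\<in>{1..L}. ((eps l)\<^sup>2 * lam l) powr (real (e l) / 2)) / s ^ (\<Sum>l\<in>{1..L}. e l) =
       (\<Prod>l\<in>{1..L}. (eps l * sqrt (lam l)) ^ e l / s ^ e l)"
      by (simp add: power_sum prod_dividef)
    also have "\<dots> = (\<Prod>l\<in>{1..L}. (eps l * sqrt (lam l / real n)) ^ e l)"
      by (intro prod.cong refl) (simp add: s_def real_sqrt_divide power_divide)
    finally show ?thesis by simp
  qed
  have C: "(\<mu>\<^sup>2 / \<gamma>) powr (real (e 0) / 4) / real p powr (real (e 0) / 4) = (\<mu> / s) ^ k"
  proof -
    have "real (e 0) / 4 = real k / 2" by (simp add: e0)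
    then have "(\<mu>\<^sup>2 / \<gamma>) powr (real (e 0) / 4) / real p powr (real (e 0) / 4) = (\<mu>\<^sup>2 / \<gamma>) powr (real k / 2) / real p powr (real k / 2)" by simp
    also have "\<dots> = (\<mu>\<^sup>2 / \<gamma> / real p) powr (real k / 2)"
      using mu_pos gamma_pos p_pos by (simp add: powr_divide powr_mult)
    also have "\<mu>\<^sup>2 / \<gamma> / real p = \<mu>\<^sup>2 / real n" using gamma_pos n_pos by (simp add: p_eq)
    also have "(\<mu>\<^sup>2 / real n) powr (real k / 2) = (\<mu> / s) ^ k"
      using mu_pos n_pos by (subst powr_half_nat) (simp_all add: s_def real_sqrt_divide)
    finally show ?thesis .
  qed
  have D: "real n powr (real N / 2) = s ^ N" using n_pos by (simp add: powr_half_nat s_def)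
  have "coef S = \<rho> ^ odd_count L n ?T * ((\<mu>\<^sup>2 / \<gamma>) powr (real (e 0) / 4) / real p powr (real (e 0) / 4)) *
      ((\<Prod>l\<in>{1..L}. ((eps l)\<^sup>2 * lam l) powr (real (e l) / 2)) / s ^ N)"
    unfolding coef_def Xi_def D odd_count_code_of[OF S] e_def by (simp add: field_simps)
  also have "\<dots> = \<rho> ^ odd_count L n ?T * (\<mu> / s) ^ k * ((\<Prod>l\<in>{1..L}. ((eps l)\<^sup>2 * lam l) powr (real (e l) / 2)) / s ^ N)"
    unfolding C ..
  also have "s ^ N = s ^ (\<Sum>l\<in>{1..L}. e l) * s ^ k" unfolding sum_e[symmetric] power_add ..
  also have "\<rho> ^ odd_count L n ?T * (\<mu> / s) ^ k * ((\<Prod>l\<in>{1..L}. ((eps l)\<^sup>2 * lam l) powr (real (e l) / 2)) / (s ^ (\<Sum>l\<in>{1..L}. e l) * s ^ k)) =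
      \<rho> ^ odd_count L n ?T * (\<mu> / (s * s)) ^ k * ((\<Prod>l\<in>{1..L}. ((eps l)\<^sup>2 * lam l) powr (real (e l) / 2)) / s ^ (\<Sum>l\<in>{1..L}. e l))"
    by (simp add: power_divide power_mult_distrib)
  also have "\<dots> = val ?T"
    unfolding val_def A B s(2) by simp
  finally show ?thesis .
qed

lemma coef_iso:
  assumes "decorated_graph L n p H" "decorated_graph L n p S" "isomorphic H S"
  shows "coef S = coef H" "XI S = XI H" "card (El S 0) = card (El H 0)"
proof -
  obtain \<phi> where iso: "is_iso \<phi> H S" using assms(3) by (auto simp: isomorphic_def)
  show "coef S = coef H" "XI S = XI H" "card (El S 0) = card (El H 0)"
    using iso_Xi[OF assms(1,2) iso] iso_card_El[OF assms(1,2) iso] by (auto simp: coef_def)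
qed

definition cycle_codes :: "(nat \<times> nat \<times> nat) set set" where
  "cycle_codes = code_of L n p ` cycles L n p N"

lemma sum_cycle_codes: "(\<Sum>T\<in>cycle_codes. g T) = (\<Sum>S\<in>cycles L n p N. g (code_of L n p S))" for g :: "_ \<Rightarrow> real"
  unfolding cycle_codes_def by (rule sum.reindex_cong[of "code_of L n p"]) (auto simp: inj_on_def cycles_def intro: code_of_inj)

lemma f_cycles_eq:
  "f_cycles L \<mu> \<rho> \<gamma> lam eps n p N \<omega> = 1 / sqrt BETA * (\<Sum>T\<in>cycle_codes. val T * mo T \<omega>)"
proof -
  have cl: "XI (rep C) / (real n powr (real N / 2) * real p powr (real (card (El (rep C) 0)) / 4)) *
        (\<Sum>S\<in>{S. decorated_graph L n p S \<and> isomorphic S (rep C)}. f_graph L lam n S \<omega>) =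
      (\<Sum>S\<in>C. val (code_of L n p S) * mo (code_of L n p S) \<omega>)" if C: "C \<in> cycle_classes L n p N" for C
  proof -
    note r = cycle_class_eq[OF C rep_in_class[OF C]]
    have "XI (rep C) / (real n powr (real N / 2) * real p powr (real (card (El (rep C) 0)) / 4)) *
        (\<Sum>S\<in>{S. decorated_graph L n p S \<and> isomorphic S (rep C)}. f_graph L lam n S \<omega>) =
        (\<Sum>S\<in>C. coef (rep C) * f_graph L lam n S \<omega>)"
      unfolding r(3)[symmetric] coef_def by (rule sum_distrib_left)
    also have "\<dots> = (\<Sum>S\<in>C. val (code_of L n p S) * mo (code_of L n p S) \<omega>)"
    proof (rule sum.cong[OF refl])
      fix S assume "S \<in> C"
      then have S: "S \<in> cycles L n p N" by (rule cycle_class_eq(1)[OF C])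
      then have d: "decorated_graph L n p S" by (simp add: cycles_def)
      have "decorated_graph L n p (rep C)" "isomorphic (rep C) S"
        using r(1,2) \<open>S \<in> C\<close> by (auto simp: cycles_def)
      then have "coef (rep C) = val (code_of L n p S)"
        using coef_iso(1)[OF _ d] coef_eq_val[OF S] by simp
      then show "coef (rep C) * f_graph L lam n S \<omega> = val (code_of L n p S) * mo (code_of L n p S) \<omega>"
        by (simp add: f_graph_eq[OF d])
    qed
    finally show ?thesis .
  qed
  have "f_cycles L \<mu> \<rho> \<gamma> lam eps n p N \<omega> =
      1 / sqrt BETA * (\<Sum>C\<in>cycle_classes L n p N. \<Sum>S\<in>C. val (code_of L n p S) * mo (code_of L n p S) \<omega>)"
    unfolding f_cycles_def using cl by simp
  then show ?thesis unfolding sum_cycle_classes sum_cycle_codes .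
qed

text \<open>Bernoulli's inequality for (1 - N / m)^k, with k N / m \<le> N^2 / m \<le> 1/4.\<close>

lemma falling_bounds:
  assumes "4 * N\<^sup>2 \<le> m" "k \<le> N"
  shows "3 / 4 * real m ^ k \<le> real (\<Prod>i<k. m - i)" "real (\<Prod>i<k. m - i) \<le> real m ^ k"
proof -
  have "(\<Prod>i<k. m - i) \<le> (\<Prod>i<k. m)" by (rule prod_mono) auto
  then have "real (\<Prod>i<k. m - i) \<le> real (m ^ k)" unfolding of_nat_le_iff by simp
  then show "real (\<Prod>i<k. m - i) \<le> real m ^ k" by simp
  show "3 / 4 * real m ^ k \<le> real (\<Prod>i<k. m - i)"
  proof (cases "m = 0")
    case True
    then have "N = 0" using assms by simp
    then show ?thesis using assms by simp
  next
    case False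
    have Nm: "real N \<le> real m"
    proof -
      have "N \<le> N\<^sup>2" by (simp add: power2_eq_square)
      then show ?thesis using assms(1) by linarith
    qed
    have "real m ^ k * (3 / 4) \<le> real m ^ k * (1 + real k * (- (real N / real m)))"
    proof (rule mult_left_mono)
      have "real k * real N \<le> real N * real N" using assms(2) by (intro mult_right_mono) auto
      also have "\<dots> \<le> real m / 4" using assms(1) by (simp add: power2_eq_square flip: of_nat_mult)
      finally have "real k * (real N / real m) \<le> 1 / 4" using False by (simp add: field_simps)
      then show "3 / 4 \<le> 1 + real k * (- (real N / real m))" by simp
    qed simp
    also have "\<dots> \<le> real m ^ k * (1 + - (real N / real m)) ^ k"
      by (rule mult_left_mono, rule Bernoulli_inequality) (use Nm False in auto)
    also have "\<dots> = (\<Prod>i<k. real m * (1 + - (real N / real m)))" by (simp add: power_mult_distrib)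
    also have "\<dots> \<le> (\<Prod>i<k. real (m - i))"
    proof (rule prod_mono)
      fix i assume "i \<in> {..<k}"
      then have "real m - real N \<le> real (m - i)" using Nm assms(2) by auto
      moreover have "real m * (1 + - (real N / real m)) = real m - real N" using False by (simp add: field_simps)
      ultimately show "0 \<le> real m * (1 + - (real N / real m)) \<and> real m * (1 + - (real N / real m)) \<le> real (m - i)"
        using Nm by simp
    qed
    finally show ?thesis by (simp add: mult.commute)
  qed
qed

text \<open>The class of R has F / |Aut R| members, all with squared coefficient XI(R)^2 / Q, where
  F is a product of falling factorials and Q the matching product of powers. It thus contributes its
  summand of \<open>BETA\<close> times F / Q, which lies between (3/4)^2 = 9/16 and 1.\<close>

lemma sum_val_sq:
  assumes n4: "4 * N\<^sup>2 \<le> n" and p4: "4 * N\<^sup>2 \<le> p"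
  shows "(\<Sum>T\<in>cycle_codes. (val T)\<^sup>2) \<le> BETA" "BETA / 2 \<le> (\<Sum>T\<in>cycle_codes. (val T)\<^sup>2)"
proof -
  let ?g = "\<lambda>C. (XI (rep C))\<^sup>2 / real (card (Aut (rep C)))"
  have cl: "(\<Sum>S\<in>C. (val (code_of L n p S))\<^sup>2) \<le> ?g C" "?g C / 2 \<le> (\<Sum>S\<in>C. (val (code_of L n p S))\<^sup>2)"
    if C: "C \<in> cycle_classes L n p N" for C
  proof -
    let ?R = "rep C"
    note r = cycle_class_eq[OF C rep_in_class[OF C]]
    have dR: "decorated_graph L n p ?R" "card (Va ?R) = N" using r(1) by (auto simp: cycles_def)
    define k where "k = card (verts ?R - Va ?R)"
    have kN: "k \<le> N" unfolding k_def by (rule card_Vb_le[OF r(1)])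
    have e0: "card (El ?R 0) = 2 * k" unfolding k_def using card_El_code_of[OF r(1)] card_layer0[OF r(1)] by simp
    have sum: "(\<Sum>S\<in>C. (val (code_of L n p S))\<^sup>2) = real (card C) * (coef ?R)\<^sup>2"
    proof -
      have "(\<Sum>S\<in>C. (val (code_of L n p S))\<^sup>2) = (\<Sum>S\<in>C. (coef ?R)\<^sup>2)"
      proof (rule sum.cong[OF refl])
        fix S assume "S \<in> C"
        then have S: "S \<in> cycles L n p N" by (rule cycle_class_eq(1)[OF C])
        then have d: "decorated_graph L n p S" by (simp add: cycles_def)
        have "isomorphic ?R S" using r(2) \<open>S \<in> C\<close> by auto
        then show "(val (code_of L n p S))\<^sup>2 = (coef ?R)\<^sup>2"
          using coef_iso(1)[OF dR(1) d] coef_eq_val[OF S] by simp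
      qed
      then show ?thesis by simp
    qed
    define F where "F = real (\<Prod>i<N. n - i) * real (\<Prod>i<k. p - i)"
    have card: "real (card C) * real (card (Aut ?R)) = F"
    proof -
      have "card C * card (Aut ?R) = (\<Prod>i<card (Va ?R). n - i) * (\<Prod>i<card (verts ?R - Va ?R). p - i)"
        using card_iso_class[OF dR(1)] unfolding r(2)[symmetric] .
      then show ?thesis unfolding F_def dR(2) k_def[symmetric] by (metis of_nat_mult)
    qed
    define Q where "Q = real n ^ N * real p ^ k"
    have Q: "Q > 0" using n_pos p_pos by (simp add: Q_def)
    have F: "F \<le> Q" "Q / 2 \<le> F"
    proof -
      note a = falling_bounds[OF n4 order_refl] and b = falling_bounds[OF p4 kN]
      show "F \<le> Q" unfolding F_def Q_def using a b by (intro mult_mono) auto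
      have "(3 / 4 * real n ^ N) * (3 / 4 * real p ^ k) \<le> F"
        unfolding F_def using a b by (intro mult_mono) auto
      then have "9 / 16 * Q \<le> F" by (simp add: Q_def)
      then show "Q / 2 \<le> F" using Q by linarith
    qed
    have A: "real (card (Aut ?R)) > 0" "real (card C) > 0"
    proof -
      have "real (card C) * real (card (Aut ?R)) > 0" using card F Q by linarith
      then show "real (card (Aut ?R)) > 0" "real (card C) > 0"
        by (auto simp: zero_less_mult_iff)
    qed
    have coef: "(coef ?R)\<^sup>2 = (XI ?R)\<^sup>2 / Q"
    proof -
      have "real (card (El ?R 0)) / 4 = real k / 2" by (simp add: e0)
      then have "coef ?R = XI ?R / (sqrt (real n) ^ N * sqrt (real p) ^ k)"
        unfolding coef_def using n_pos p_pos by (simp only: powr_half_nat of_nat_0_less_iff)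
      moreover have "(sqrt (real n) ^ N * sqrt (real p) ^ k)\<^sup>2 = Q"
        unfolding Q_def power_mult_distrib by (simp add: power_mult[symmetric] mult.commute[of _ 2]) (simp add: power_mult)
      ultimately show ?thesis by (simp add: power_divide)
    qed
    have eq: "(\<Sum>S\<in>C. (val (code_of L n p S))\<^sup>2) = ?g C * (F / Q)"
      unfolding sum coef card[symmetric] using A by simp
    have g0: "0 \<le> ?g C" by simp
    have "F / Q \<le> 1" "1 / 2 \<le> F / Q" using F Q by (auto simp: field_simps)
    then have "?g C * (F / Q) \<le> ?g C * 1" "?g C * (1 / 2) \<le> ?g C * (F / Q)"
      using g0 by (intro mult_left_mono; simp)+
    then show "(\<Sum>S\<in>C. (val (code_of L n p S))\<^sup>2) \<le> ?g C" "?g C / 2 \<le> (\<Sum>S\<in>C. (val (code_of L n p S))\<^sup>2)"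
      unfolding eq by simp_all
  qed
  have eq: "(\<Sum>T\<in>cycle_codes. (val T)\<^sup>2) = (\<Sum>C\<in>cycle_classes L n p N. \<Sum>S\<in>C. (val (code_of L n p S))\<^sup>2)"
    unfolding sum_cycle_codes sum_cycle_classes ..
  show "(\<Sum>T\<in>cycle_codes. (val T)\<^sup>2) \<le> BETA"
    unfolding eq beta_def by (rule sum_mono) (rule cl(1))
  show "BETA / 2 \<le> (\<Sum>T\<in>cycle_codes. (val T)\<^sup>2)"
    unfolding eq beta_def sum_divide_distrib by (rule sum_mono) (rule cl(2))
qed

end

section \<open>Second moment of the cycle statistic\<close>

lemma binomial_le_power: "n choose k \<le> n ^ k"
proof (cases "k \<le> n")
  case True
  then show ?thesis by (rule binomial_le_pow)
qed (simp add: binomial_eq_0)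

text \<open>Grouping pairs by the union U of their vertex sets separates two costs: a fixed U
  carries at most K^2 pairs, and there are at most |W|^m \<le> (g n)^m sets U of size m, which (1 /
  n)^m compensates.\<close>

lemma sum_pairs_union_bound:
  fixes V :: "'t \<Rightarrow> 'v set" and n g :: real and K :: nat
  assumes fin: "finite \<T>" "finite W" and V: "\<And>T. T \<in> \<T> \<Longrightarrow> V T \<subseteq> W \<and> card (V T) \<le> s"
    and K: "\<And>U. U \<subseteq> W \<Longrightarrow> card U \<le> 2 * s \<Longrightarrow> card {T \<in> \<T>. V T \<subseteq> U} \<le> K"
    and n: "n > 0" and g: "real (card W) \<le> g * n" "g \<ge> 1"
  shows "(\<Sum>T\<in>\<T>. \<Sum>T'\<in>\<T>. (1 / n) ^ card (V T \<union> V T')) \<le> real (2 * s + 1) * g ^ (2 * s) * (real K)\<^sup>2"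
proof -
  define \<U> where "\<U> = {U. U \<subseteq> W \<and> card U \<le> 2 * s}"
  have fU: "finite \<U>" unfolding \<U>_def using fin(2) by auto
  have u: "V T \<union> V T' \<in> \<U>" if "T \<in> \<T>" "T' \<in> \<T>" for T T'
  proof -
    have "card (V T \<union> V T') \<le> card (V T) + card (V T')" by (rule card_Un_le)
    then show ?thesis using V[OF that(1)] V[OF that(2)] by (auto simp: \<U>_def)
  qed
  have "(\<Sum>T\<in>\<T>. \<Sum>T'\<in>\<T>. (1 / n) ^ card (V T \<union> V T')) = (\<Sum>P\<in>\<T>\<times>\<T>. (1 / n) ^ card (V (fst P) \<union> V (snd P)))"
    by (simp add: sum.cartesian_product case_prod_unfold)
  also have "\<dots> = (\<Sum>U\<in>\<U>. \<Sum>P\<in>{P\<in>\<T>\<times>\<T>. V (fst P) \<union> V (snd P) = U}. (1 / n) ^ card (V (fst P) \<union> V (snd P)))"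
    by (rule sum.group[symmetric]) (use fin fU u in auto)
  also have "\<dots> \<le> (\<Sum>U\<in>\<U>. (real K)\<^sup>2 * (1 / n) ^ card U)"
  proof (rule sum_mono)
    fix U assume U: "U \<in> \<U>"
    let ?A = "{T \<in> \<T>. V T \<subseteq> U}"
    have sub: "{P\<in>\<T>\<times>\<T>. V (fst P) \<union> V (snd P) = U} \<subseteq> ?A \<times> ?A" by auto
    have "card {P\<in>\<T>\<times>\<T>. V (fst P) \<union> V (snd P) = U} \<le> card (?A \<times> ?A)"
      by (rule card_mono[OF _ sub]) (use fin in auto)
    also have "\<dots> \<le> K * K" unfolding card_cartesian_product
      using K[of U] U by (intro mult_mono) (auto simp: \<U>_def)
    finally have c: "real (card {P\<in>\<T>\<times>\<T>. V (fst P) \<union> V (snd P) = U}) \<le> (real K)\<^sup>2"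
      by (simp add: power2_eq_square flip: of_nat_mult)
    have "(\<Sum>P\<in>{P\<in>\<T>\<times>\<T>. V (fst P) \<union> V (snd P) = U}. (1 / n) ^ card (V (fst P) \<union> V (snd P))) =
      real (card {P\<in>\<T>\<times>\<T>. V (fst P) \<union> V (snd P) = U}) * (1 / n) ^ card U" by simp
    also have "\<dots> \<le> (real K)\<^sup>2 * (1 / n) ^ card U" using c n by (intro mult_right_mono) auto
    finally show "(\<Sum>P\<in>{P\<in>\<T>\<times>\<T>. V (fst P) \<union> V (snd P) = U}. (1 / n) ^ card (V (fst P) \<union> V (snd P))) \<le> (real K)\<^sup>2 * (1 / n) ^ card U" .
  qed
  also have "\<dots> = (real K)\<^sup>2 * (\<Sum>U\<in>\<U>. (1 / n) ^ card U)" by (simp add: sum_distrib_left)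
  also have "(real K)\<^sup>2 * (\<Sum>U\<in>\<U>. (1 / n) ^ card U) \<le> (real K)\<^sup>2 * (real (2 * s + 1) * g ^ (2 * s))"
  proof (rule mult_left_mono)
    have "(\<Sum>U\<in>\<U>. (1 / n) ^ card U) = (\<Sum>m\<in>{..2 * s}. \<Sum>U\<in>{U. U \<in> \<U> \<and> card U = m}. (1 / n) ^ card U)"
      by (rule sum.group[symmetric]) (use fU in \<open>auto simp: \<U>_def\<close>)
    also have "\<dots> \<le> (\<Sum>m\<in>{..2 * s}. g ^ (2 * s))"
    proof (rule sum_mono)
      fix m assume m: "m \<in> {..2 * s}"
      have "{U\<in>\<U>. card U = m} = {U. U \<subseteq> W \<and> card U = m}" using m by (auto simp: \<U>_def)
      then have "(\<Sum>U\<in>{U\<in>\<U>. card U = m}. (1 / n) ^ card U) = real (card W choose m) * (1 / n) ^ m"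
        using n_subsets[OF fin(2), of m] by simp
      also have "\<dots> \<le> real (card W) ^ m * (1 / n) ^ m"
        using n binomial_le_power[of "card W" m] by (intro mult_right_mono) (auto simp flip: of_nat_power)
      also have "\<dots> = (real (card W) / n) ^ m" by (simp add: power_divide)
      also have "\<dots> \<le> g ^ m" using g n by (intro power_mono) (auto simp: field_simps)
      also have "\<dots> \<le> g ^ (2 * s)" using g m by (intro power_increasing) auto
      finally show "(\<Sum>U\<in>{U\<in>\<U>. card U = m}. (1 / n) ^ card U) \<le> g ^ (2 * s)" .
    qed
    also have "\<dots> = real (2 * s + 1) * g ^ (2 * s)" by simp
    finally show "(\<Sum>U\<in>\<U>. (1 / n) ^ card U) \<le> real (2 * s + 1) * g ^ (2 * s)" .
  qed simp
  finally show ?thesis by (simp only: mult.commute)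
qed

lemma card_small_subsets:
  assumes "finite A" "card A \<le> w" "w \<ge> 1"
  shows "card {T. T \<subseteq> A \<and> card T \<le> r} \<le> (r + 1) * w ^ r"
proof -
  have "{T. T \<subseteq> A \<and> card T \<le> r} = (\<Union>j\<in>{..r}. {T. T \<subseteq> A \<and> card T = j})" by auto
  then have "card {T. T \<subseteq> A \<and> card T \<le> r} \<le> (\<Sum>j\<in>{..r}. card {T. T \<subseteq> A \<and> card T = j})"
    by (simp add: card_UN_le)
  also have "\<dots> \<le> (\<Sum>j\<in>{..r}. w ^ r)"
  proof (rule sum_mono)
    fix j assume j: "j \<in> {..r}"
    have "card {T. T \<subseteq> A \<and> card T = j} = card A choose j" by (rule n_subsets[OF assms(1)])
    also have "\<dots> \<le> card A ^ j" by (rule binomial_le_power)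
    also have "\<dots> \<le> w ^ j" using assms(2) by (intro power_mono) auto
    also have "\<dots> \<le> w ^ r" using assms(3) j by (intro power_increasing) auto
    finally show "card {T. T \<subseteq> A \<and> card T = j} \<le> w ^ r" .
  qed
  finally show ?thesis by simp
qed

text \<open>A code is recovered from its layer, one of L + 1, and its two ends in order.\<close>

lemma card_codes_within:
  assumes "finite U"
  shows "card {t \<in> codes L n p. ends t \<subseteq> U} \<le> (L + 1) * (card U)\<^sup>2"
proof -
  let ?f = "\<lambda>(l, i, j). (l, VA i, if l = 0 then VB j else VA j)"
  have "inj_on ?f {t \<in> codes L n p. ends t \<subseteq> U}"
    by (auto simp: inj_on_def split: if_splits)
  moreover have "?f ` {t \<in> codes L n p. ends t \<subseteq> U} \<subseteq> {..L} \<times> U \<times> U"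
    by (auto simp: ends_def mem_codes split: if_splits)
  ultimately have "card {t \<in> codes L n p. ends t \<subseteq> U} \<le> card ({..L} \<times> U \<times> U)"
    using assms by (intro card_inj_on_le[of ?f]) auto
  then show ?thesis by (simp add: card_cartesian_product power2_eq_square)
qed

lemma tverts_codes: "T \<subseteq> codes L n p \<Longrightarrow> tverts T \<subseteq> KVa n \<union> KVb p"
  by (fastforce simp: tverts_def ends_def codes_def layer_pairs_def KVa_def KVb_def split: if_splits)

section \<open>Vertex-disjoint unions\<close>

lemma tverts_disjoint:
  assumes "tverts S \<inter> tverts T = {}"
  shows "S \<inter> T = {}"
proof (rule ccontr)
  assume "S \<inter> T \<noteq> {}"
  then obtain t where "t \<in> S" "t \<in> T" by blast
  then have "VA (fst (snd t)) \<in> tverts S \<inter> tverts T" by (auto simp: tverts_def VA_in_ends)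
  then show False using assms by blast
qed

lemma deg_Un:
  assumes "finite S" "finite T" "S \<inter> T = {}"
  shows "deg (S \<union> T) v = deg S v + deg T v" "ldeg (S \<union> T) l i = ldeg S l i + ldeg T l i"
proof -
  have "{t \<in> S \<union> T. v \<in> ends t} = {t \<in> S. v \<in> ends t} \<union> {t \<in> T. v \<in> ends t}" by blast
  then show "deg (S \<union> T) v = deg S v + deg T v"
    unfolding deg_def using assms by (simp add: card_Un_disjoint disjoint_iff)
  have "{t \<in> S \<union> T. fst t = l \<and> VA i \<in> ends t} = {t \<in> S. fst t = l \<and> VA i \<in> ends t} \<union> {t \<in> T. fst t = l \<and> VA i \<in> ends t}" by blast
  then show "ldeg (S \<union> T) l i = ldeg S l i + ldeg T l i"
    unfolding ldeg_def using assms by (simp add: card_Un_disjoint disjoint_iff)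
qed

lemma ldeg_tverts: "ldeg S l i \<noteq> 0 \<Longrightarrow> VA i \<in> tverts S"
proof -
  assume "ldeg S l i \<noteq> 0"
  then have "{t \<in> S. fst t = l \<and> VA i \<in> ends t} \<noteq> {}" unfolding ldeg_def by force
  then show ?thesis by (auto simp: tverts_def)
qed

text \<open>At each a-vertex at most one of the two edge sets has positive layer degree, so their
  parities do not interact.\<close>

lemma odd_count_Un:
  assumes "finite S" "finite T" "tverts S \<inter> tverts T = {}"
  shows "odd_count L n (S \<union> T) = odd_count L n S + odd_count L n T"
proof -
  note u = deg_Un(2)[OF assms(1,2) tverts_disjoint[OF assms(3)]]
  let ?O = "\<lambda>S. {(l, i) \<in> {1..L} \<times> {..<n}. odd (ldeg S l i)}"
  have z: "ldeg S l i = 0 \<or> ldeg T l i = 0" for l i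
    using ldeg_tverts[of S l i] ldeg_tverts[of T l i] assms(3) by blast
  have "odd (ldeg (S \<union> T) l i) \<longleftrightarrow> odd (ldeg S l i) \<or> odd (ldeg T l i)" for l i
    using z[of l i] by (auto simp: u)
  then have "?O (S \<union> T) = ?O S \<union> ?O T" by auto
  moreover have "?O S \<inter> ?O T = {}"
  proof -
    have "\<not> (odd (ldeg S l i) \<and> odd (ldeg T l i))" for l i using z[of l i] by auto
    then show ?thesis by auto
  qed
  moreover have "finite (?O S)" for S by (rule finite_subset[of _ "{1..L} \<times> {..<n}"]) auto
  ultimately show ?thesis unfolding odd_count_def by (simp add: card_Un_disjoint)
qed

section \<open>Pairs of cycles under the planted law\<close>

context planted_cycles
begin

lemma cycle_codes_facts:
  assumes "T \<in> cycle_codes"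
  shows "T \<subseteq> cds" "cyclic T" "card T \<le> 2 * N" "deg T v \<in> {0, 2}"
proof -
  obtain S where S: "S \<in> cycles L n p N" "T = code_of L n p S" using assms by (auto simp: cycle_codes_def)
  then have d: "decorated_graph L n p S" "is_cycle S" by (auto simp: cycles_def)
  show 1: "T \<subseteq> cds" unfolding S(2) by (rule code_of_subset)
  show 2: "cyclic T" unfolding S(2) by (rule cyclic_code_of[OF d])
  show "card T \<le> 2 * N" using card_code_of[OF S(1)] card_Vb_le[OF S(1)] S(2) by simp
  show "deg T v \<in> {0, 2}"
    using 2 deg_eq_0[OF finite_cds_subset[OF 1], of v] by (cases "v \<in> tverts T") (auto simp: cyclic_def)
qed

lemma finite_cycle_codes: "finite cycle_codes"
  unfolding cycle_codes_def by (rule finite_imageI[OF finite_cycles])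

lemma planted_mean_cycle: "T \<in> cycle_codes \<Longrightarrow> integral\<^sup>L PL (mo T) = val T"
proof (rule expectation_planted_monom)
  assume T: "T \<in> cycle_codes"
  show "T \<subseteq> cds" by (rule cycle_codes_facts(1)[OF T])
  show "deg T (VB k) \<in> {0, 2}" for k by (rule cycle_codes_facts(4)[OF T])
  show "even (deg T (VA i))" for i using cycle_codes_facts(4)[OF T, of "VA i"] by auto
qed

text \<open>A union of two vertex-disjoint cycles still has all degrees 0 or 2, so its monomial
  obeys the same mean formula, and \<open>val\<close> is multiplicative on it.\<close>

lemma planted_disjoint_cycles:
  assumes T: "T \<in> cycle_codes" "T' \<in> cycle_codes" "tverts T \<inter> tverts T' = {}"
  shows "(\<integral>\<omega>. mo T \<omega> * mo T' \<omega> \<partial>PL) = val T * val T'"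
proof -
  note f = cycle_codes_facts[OF T(1)] and f' = cycle_codes_facts[OF T(2)]
  have fin: "finite T" "finite T'" using f(1) f'(1) finite_cds_subset by auto
  note dj = tverts_disjoint[OF T(3)]
  have z: "deg T v = 0 \<or> deg T' v = 0" for v
    using T(3) unfolding deg_eq_0[OF fin(1)] deg_eq_0[OF fin(2)] by blast
  have d: "deg (T \<union> T') v \<in> {0, 2}" for v
    using z[of v] f(4)[of v] f'(4)[of v] unfolding deg_Un[OF fin dj] by auto
  have "mo T \<omega> * mo T' \<omega> = mo (T \<union> T') \<omega>" for \<omega>
    unfolding monom_of_def by (rule prod.union_disjoint[OF fin dj, symmetric])
  then have "(\<integral>\<omega>. mo T \<omega> * mo T' \<omega> \<partial>PL) = integral\<^sup>L PL (mo (T \<union> T'))" by simp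
  also have "\<dots> = val (T \<union> T')"
  proof (rule expectation_planted_monom)
    show "T \<union> T' \<subseteq> cds" using f(1) f'(1) by blast
    show "deg (T \<union> T') (VB k) \<in> {0, 2}" for k by (rule d)
    show "even (deg (T \<union> T') (VA i))" for i using d[of "VA i"] by auto
  qed
  also have "\<dots> = val T * val T'"
    unfolding val_def odd_count_Un[OF fin T(3)] prod.union_disjoint[OF fin dj] by (simp add: power_add)
  finally show ?thesis .
qed

lemma planted_square_cycle:
  assumes T: "T \<in> cycle_codes" and small: "20 * real N * \<mu> \<le> real n"
  shows "(\<integral>\<omega>. mo T \<omega> * mo T \<omega> \<partial>PL) \<le> 4"
proof -
  note f = cycle_codes_facts[OF T]
  have "(\<integral>\<omega>. mo T \<omega> * mo T \<omega> \<partial>PL) \<le> 2 * (1 + 5 * \<mu> / real n) ^ card T"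
    by (rule second_moment_planted[OF f(1,4)]) (use f(2) in \<open>auto simp: cyclic_def\<close>)
  \<comment> \<open>With x = 5 \<mu> / n, (1 + x)^(2 N) \<le> exp (2 N x), and \<open>small\<close>
    gives 2 N x = 10 N \<mu> / n \<le> 1/2; this fixes the constant 20.\<close>
  also have "(1 + 5 * \<mu> / real n) ^ card T \<le> (1 + 5 * \<mu> / real n) ^ (2 * N)"
    using mu_pos n_pos f(3) by (intro power_increasing) auto
  also have "\<dots> \<le> exp (5 * \<mu> / real n) ^ (2 * N)"
    using mu_pos n_pos by (intro power_mono exp_ge_add_one_self) auto
  also have "\<dots> = exp (real (2 * N) * (5 * \<mu> / real n))" by (simp only: exp_of_nat_mult)
  also have "\<dots> \<le> exp (1 / 2)" using small n_pos by (simp add: field_simps)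
  also have "\<dots> \<le> 2" by (rule exp_half_le2)
  finally show ?thesis by simp
qed

text \<open>M bounds the edge means after 1 / sqrt n has been taken out and can be chosen
  independently of n. The condition \<open>M \<ge> 1\<close> allows exponents of M to be
  enlarged.\<close>

definition mean_bound :: "real \<Rightarrow> bool" where
  "mean_bound M \<longleftrightarrow> M \<ge> 1 \<and> sqrt \<mu> \<le> M \<and> (\<forall>l\<in>{1..L}. eps l * sqrt (lam l) \<le> M)"

lemma mean_le:
  assumes "mean_bound M" "t \<in> cds"
  shows "mn t \<le> M / sqrt (real n)"
proof (cases "fst t = 0")
  case True
  have "sqrt \<mu> / sqrt (real n) \<le> M / sqrt (real n)" using assms(1) by (intro divide_right_mono) (auto simp: mean_bound_def)
  then show ?thesis using True by (simp add: mean_def real_sqrt_divide)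
next
  case False
  have "eps (fst t) * sqrt (lam (fst t)) / sqrt (real n) \<le> M / sqrt (real n)"
    using assms fst_cds[OF assms(2) False] by (intro divide_right_mono) (auto simp: mean_bound_def)
  then show ?thesis using False by (simp add: mean_def real_sqrt_divide)
qed

lemma val_le:
  assumes "mean_bound M" "T \<subseteq> cds"
  shows "val T \<le> (M / sqrt (real n)) ^ card T"
proof -
  have "val T \<le> (\<Prod>t\<in>T. mn t) * 1"
    unfolding val_def using rho assms(2) by (intro mult_left_mono prod_nonneg power_le_one) (auto intro: mean_nonneg)
  also have "\<dots> \<le> (\<Prod>t\<in>T. M / sqrt (real n))"
    unfolding mult_1_right
    by (rule prod_mono, rule conjI[OF mean_nonneg mean_le[OF assms(1)]]; rule subsetD[OF assms(2)])
  finally show ?thesis by simp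
qed

text \<open>Powers of 1 / sqrt n: |T| + |T'| come from the coefficients and |T - T'| + |T' - T| from
  the conditional means, in total 2 |T u T'|. Cycles have as many vertices as edges, so
  \<open>cyclic_intersection\<close> turns |T u T'| into at least one more than the number of
  vertices in the union.\<close>

lemma planted_overlap_cycles:
  assumes M: "mean_bound M" and T: "T \<in> cycle_codes" "T' \<in> cycle_codes" "T \<noteq> T'" "tverts T \<inter> tverts T' \<noteq> {}"
  shows "val T * val T' * (\<integral>\<omega>. mo T \<omega> * mo T' \<omega> \<partial>PL) \<le>
    (2 * M\<^sup>2 * gauss_const) ^ (4 * N) * (1 / real n) ^ (card (tverts T \<union> tverts T') + 1)"
proof -
  note f = cycle_codes_facts[OF T(1)] and f' = cycle_codes_facts[OF T(2)]
  have fin: "finite T" "finite T'" using f(1) f'(1) finite_cds_subset by auto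
  have fv: "finite (tverts T)" "finite (tverts T')" using fin finite_tverts by auto
  let ?D = "(T - T') \<union> (T' - T)"
  define q where "q = M / sqrt (real n)"
  have M1: "M \<ge> 1" using M by (simp add: mean_bound_def)
  have q: "q \<ge> 0" "q\<^sup>2 = M\<^sup>2 * (1 / real n)" using M1 n_pos by (auto simp: q_def power_divide)
  have gc: "gauss_const \<ge> 1" by (rule gauss_const_ge_1)
  have E: "(\<integral>\<omega>. mo T \<omega> * mo T' \<omega> \<partial>PL) \<le> q ^ card ?D * 2 ^ card (T \<inter> T') * gauss_const ^ card (T \<union> T')"
    unfolding q_def
  proof (rule mixed_moment_planted[OF f(1) f'(1)])
    show "deg T (VB k) \<le> 2" for k using f(4)[of "VB k"] by auto
    show "deg T' (VB k) \<le> 2" for k using f'(4)[of "VB k"] by auto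
  qed (rule mean_le[OF M])
  have "val T * val T' * (\<integral>\<omega>. mo T \<omega> * mo T' \<omega> \<partial>PL) \<le> val T * val T' * (q ^ card ?D * 2 ^ card (T \<inter> T') * gauss_const ^ card (T \<union> T'))"
    using E val_nonneg[OF f(1)] val_nonneg[OF f'(1)] by (intro mult_left_mono) auto
  also have "\<dots> \<le> (q ^ card T * q ^ card T') * (q ^ card ?D * 2 ^ card (T \<inter> T') * gauss_const ^ card (T \<union> T'))"
    unfolding q_def using val_le[OF M f(1)] val_le[OF M f'(1)] val_nonneg[OF f(1)] val_nonneg[OF f'(1)] M1 gc
    by (intro mult_right_mono mult_mono) auto
  also have "\<dots> = q ^ (card T + card T' + card ?D) * 2 ^ card (T \<inter> T') * gauss_const ^ card (T \<union> T')"
    by (simp add: power_add)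
  also have "card T + card T' + card ?D = 2 * card (T \<union> T')"
  proof -
    have "card T = card (T - T') + card (T \<inter> T')" "card T' = card (T' - T) + card (T \<inter> T')"
      using fin by (simp_all add: card_Diff_subset_Int Int_commute card_mono)
    moreover have "card ?D = card (T - T') + card (T' - T)"
      by (rule card_Un_disjoint) (use fin in auto)
    moreover have "card T + card T' = card (T \<union> T') + card (T \<inter> T')" by (rule card_Un_Int[OF fin])
    ultimately show ?thesis by linarith
  qed
  also have "q ^ (2 * card (T \<union> T')) = (M\<^sup>2) ^ card (T \<union> T') * (1 / real n) ^ card (T \<union> T')"
    unfolding power_mult q(2) power_mult_distrib ..
  also have "(M\<^sup>2) ^ card (T \<union> T') * (1 / real n) ^ card (T \<union> T') * 2 ^ card (T \<inter> T') * gauss_const ^ card (T \<union> T') \<le>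
     (M\<^sup>2) ^ (4 * N) * (1 / real n) ^ (card (tverts T \<union> tverts T') + 1) * 2 ^ (4 * N) * gauss_const ^ (4 * N)"
  proof -
    have c1: "card (T \<union> T') \<le> 4 * N" using f(3) f'(3) card_Un_le[of T T'] by linarith
    have c2: "card (T \<inter> T') \<le> 4 * N" using c1 fin card_mono[of "T \<union> T'" "T \<inter> T'"] by (meson finite_UnI inf_sup_ord(1) le_supI1 order_trans)
    have c3: "card (tverts T \<union> tverts T') + 1 \<le> card (T \<union> T')"
    proof -
      have "card (T \<inter> T') + 1 \<le> card (tverts T \<inter> tverts T')"
        by (rule cyclic_intersection[OF f(1,2) f'(1,2) T(3,4)])
      moreover have "card T + card T' = card (T \<union> T') + card (T \<inter> T')" by (rule card_Un_Int[OF fin])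
      moreover have "card (tverts T) + card (tverts T') = card (tverts T \<union> tverts T') + card (tverts T \<inter> tverts T')"
        by (rule card_Un_Int[OF fv])
      moreover have "card (tverts T) = card T" "card (tverts T') = card T'"
        using card_cyclic[OF f(1,2)] card_cyclic[OF f'(1,2)] by auto
      ultimately show ?thesis by linarith
    qed
    show ?thesis
      using c1 c2 c3 M1 gc n_pos
      by (intro mult_mono power_increasing power_decreasing mult_nonneg_nonneg zero_le_power) auto
  qed
  finally show ?thesis by (simp add: power_mult_distrib mult.commute mult.left_commute)
qed

text \<open>Two cycles together use at most 4 N vertices, which carry at most (L + 1) (4 N)^2 codes,
  and a cycle is a set of at most 2 N of them.\<close>

definition within_bound :: nat where
  "within_bound = (2 * N + 1) * ((L + 1) * (4 * N)\<^sup>2) ^ (2 * N)"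

lemma card_cycle_codes_within:
  assumes U: "U \<subseteq> KVa n \<union> KVb p" "card U \<le> 2 * (2 * N)" and N1: "N \<ge> 1"
  shows "card {T \<in> cycle_codes. tverts T \<subseteq> U} \<le> within_bound"
proof -
  have fU: "finite U" by (rule finite_subset[OF U(1)]) (auto simp: KVa_def KVb_def)
  let ?A = "{t \<in> cds. ends t \<subseteq> U}"
  have "card ?A \<le> (L + 1) * (card U)\<^sup>2" by (rule card_codes_within[OF fU])
  also have "\<dots> \<le> (L + 1) * (4 * N)\<^sup>2" using U(2) by (intro mult_left_mono power_mono) auto
  finally have cA: "card ?A \<le> (L + 1) * (4 * N)\<^sup>2" .
  have "{T \<in> cycle_codes. tverts T \<subseteq> U} \<subseteq> {T. T \<subseteq> ?A \<and> card T \<le> 2 * N}"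
    using cycle_codes_facts(1,3) by (fastforce simp: tverts_def)
  then have "card {T \<in> cycle_codes. tverts T \<subseteq> U} \<le> card {T. T \<subseteq> ?A \<and> card T \<le> 2 * N}"
    by (rule card_mono[rotated]) simp
  also have "\<dots> \<le> (2 * N + 1) * ((L + 1) * (4 * N)\<^sup>2) ^ (2 * N)"
    by (rule card_small_subsets[OF _ cA]) (use N1 in \<open>auto simp: Suc_le_eq\<close>)
  finally show ?thesis by (simp add: within_bound_def)
qed

definition overlap_error :: "real \<Rightarrow> real" where
  "overlap_error M = (2 * M\<^sup>2 * gauss_const) ^ (4 * N) * (real (2 * (2 * N) + 1) * (1 + 1 / \<gamma>) ^ (2 * (2 * N)) * (real within_bound)\<^sup>2) / real n"

lemma second_moment_sum:
  assumes M: "mean_bound M" and small: "20 * real N * \<mu> \<le> real n" and N1: "N \<ge> 1"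
  shows "(\<Sum>T\<in>cycle_codes. \<Sum>T'\<in>cycle_codes. val T * val T' * (\<integral>\<omega>. mo T \<omega> * mo T' \<omega> \<partial>PL)) \<le>
    (\<Sum>T\<in>cycle_codes. (val T)\<^sup>2)\<^sup>2 + 4 * (\<Sum>T\<in>cycle_codes. (val T)\<^sup>2) + overlap_error M"
proof -
  define A where "A = (2 * M\<^sup>2 * gauss_const) ^ (4 * N) / real n"
  have A0: "A \<ge> 0" unfolding A_def using gauss_const_ge_1 by simp
  \<comment> \<open>All three terms on the right are nonnegative, so one bound covers equal,
    disjoint and overlapping pairs. Extending the first term to all pairs makes it sum to a perfect
    square, the squared mean up to normalisation.\<close>
  have "val T * val T' * (\<integral>\<omega>. mo T \<omega> * mo T' \<omega> \<partial>PL) \<le>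
    (val T)\<^sup>2 * (val T')\<^sup>2 + (if T' = T then 4 * (val T)\<^sup>2 else 0) + A * (1 / real n) ^ card (tverts T \<union> tverts T')"
    if T: "T \<in> cycle_codes" "T' \<in> cycle_codes" for T T'
  proof -
    have nn: "0 \<le> (val T)\<^sup>2 * (val T')\<^sup>2" "0 \<le> A * (1 / real n) ^ card (tverts T \<union> tverts T')" "0 \<le> (if T' = T then 4 * (val T)\<^sup>2 else 0)"
      using A0 by auto
    consider "T = T'" | "T \<noteq> T'" "tverts T \<inter> tverts T' = {}" | "T \<noteq> T'" "tverts T \<inter> tverts T' \<noteq> {}" by blast
    then show ?thesis
    proof cases
      case 1
      have "val T * val T * (\<integral>\<omega>. mo T \<omega> * mo T \<omega> \<partial>PL) \<le> val T * val T * 4"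
        using planted_square_cycle[OF T(1) small] by (intro mult_left_mono) auto
      moreover have "(if T' = T then 4 * (val T)\<^sup>2 else 0) = val T * val T * 4" using 1 by (simp add: power2_eq_square)
      ultimately show ?thesis using nn(1,2) unfolding 1 by linarith
    next
      case 2
      then show ?thesis using nn planted_disjoint_cycles[OF T 2(2)] by (simp add: power2_eq_square mult_ac)
    next
      case 3
      have "val T * val T' * (\<integral>\<omega>. mo T \<omega> * mo T' \<omega> \<partial>PL) \<le> A * (1 / real n) ^ card (tverts T \<union> tverts T')"
        using planted_overlap_cycles[OF M T 3] by (simp add: A_def)
      then show ?thesis using nn by linarith
    qed
  qed
  then have "(\<Sum>T\<in>cycle_codes. \<Sum>T'\<in>cycle_codes. val T * val T' * (\<integral>\<omega>. mo T \<omega> * mo T' \<omega> \<partial>PL)) \<le>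
    (\<Sum>T\<in>cycle_codes. \<Sum>T'\<in>cycle_codes. (val T)\<^sup>2 * (val T')\<^sup>2 + (if T' = T then 4 * (val T)\<^sup>2 else 0) + A * (1 / real n) ^ card (tverts T \<union> tverts T'))"
    by (intro sum_mono) auto
  also have "\<dots> = (\<Sum>T\<in>cycle_codes. (val T)\<^sup>2)\<^sup>2 + 4 * (\<Sum>T\<in>cycle_codes. (val T)\<^sup>2) + A * (\<Sum>T\<in>cycle_codes. \<Sum>T'\<in>cycle_codes. (1 / real n) ^ card (tverts T \<union> tverts T'))"
  proof -
    have "(\<Sum>T\<in>cycle_codes. \<Sum>T'\<in>cycle_codes. (val T)\<^sup>2 * (val T')\<^sup>2) = (\<Sum>T\<in>cycle_codes. (val T)\<^sup>2)\<^sup>2"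
      by (simp only: power2_eq_square[of "sum _ _"] sum_product)
    moreover have "(\<Sum>T\<in>cycle_codes. \<Sum>T'\<in>cycle_codes. (if T' = T then 4 * (val T)\<^sup>2 else 0)) = 4 * (\<Sum>T\<in>cycle_codes. (val T)\<^sup>2)"
      using finite_cycle_codes by (simp add: sum_distrib_left)
    moreover have "(\<Sum>T\<in>cycle_codes. \<Sum>T'\<in>cycle_codes. A * (1 / real n) ^ card (tverts T \<union> tverts T')) = A * (\<Sum>T\<in>cycle_codes. \<Sum>T'\<in>cycle_codes. (1 / real n) ^ card (tverts T \<union> tverts T'))"
      by (simp only: sum_distrib_left)
    ultimately show ?thesis by (simp only: sum.distrib)
  qed
  also have "A * (\<Sum>T\<in>cycle_codes. \<Sum>T'\<in>cycle_codes. (1 / real n) ^ card (tverts T \<union> tverts T')) \<le> A * (real (2 * (2 * N) + 1) * (1 + 1 / \<gamma>) ^ (2 * (2 * N)) * (real within_bound)\<^sup>2)"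
  proof (rule mult_left_mono[OF sum_pairs_union_bound[OF finite_cycle_codes] A0])
    show "finite (KVa n \<union> KVb p)" by (auto simp: KVa_def KVb_def)
    show "tverts T \<subseteq> KVa n \<union> KVb p \<and> card (tverts T) \<le> 2 * N" if "T \<in> cycle_codes" for T
      using cycle_codes_facts[OF that] tverts_codes[of T L n p] card_cyclic[of T L n p] by simp
    show "card {T \<in> cycle_codes. tverts T \<subseteq> U} \<le> within_bound" if "U \<subseteq> KVa n \<union> KVb p" "card U \<le> 2 * (2 * N)" for U
      by (rule card_cycle_codes_within[OF that N1])
    show "0 < real n" using n_pos by simp
    show "1 \<le> 1 + 1 / \<gamma>" using gamma_pos by simp
    have "card (KVa n \<union> KVb p) \<le> n + p"
      using card_Un_le[of "KVa n" "KVb p"] by (simp add: KVa_def KVb_def card_image inj_on_def)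
    then have "real (card (KVa n \<union> KVb p)) \<le> real n + real p" by linarith
    then show "real (card (KVa n \<union> KVb p)) \<le> (1 + 1 / \<gamma>) * real n" by (simp add: p_eq algebra_simps)
  qed
  finally show ?thesis by (simp add: overlap_error_def A_def)
qed

end

section \<open>Both error probabilities at fixed n\<close>

lemma sets_planted_law [simp]: "sets (planted_law L \<mu> \<rho> lam eps n p) = sets (obs_space n p)"
  by (simp add: planted_law_def)

lemma sets_null_law [simp]: "sets (null_law L lam n p) = sets (obs_space n p)"
proof -
  have "sets (\<Pi>\<^sub>M ik\<in>{..<n} \<times> {..<p}. std_gauss) = sets (\<Pi>\<^sub>M ik\<in>{..<n} \<times> {..<p}. (borel :: real measure))"
    by (rule sets_PiM_cong) auto
  then show ?thesis unfolding null_law_def obs_space_def by (rule sets_pair_measure_cong) simp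
qed

lemma prob_space_planted: "prob_space (planted_law L \<mu> \<rho> lam eps n p)"
proof -
  interpret U: prob_space "gauss_prod {..<p}" by (rule prob_space_gauss_prod)
  interpret Z: prob_space "gauss_prod ({..<n} \<times> {..<p})" by (rule prob_space_gauss_prod)
  interpret UZ: pair_prob_space "gauss_prod {..<p}" "gauss_prod ({..<n} \<times> {..<p})" ..
  interpret D: pair_prob_space "measure_pmf (planted_discrete L \<rho> lam eps n)" "gauss_prod {..<p} \<Otimes>\<^sub>M gauss_prod ({..<n} \<times> {..<p})" ..
  show ?thesis unfolding planted_law_eq by (rule D.prob_space_distr[OF measurable_plant])
qed

lemma prob_space_null: "prob_space (null_law L lam n p)"
proof -
  interpret Z: prob_space "gauss_prod ({..<n} \<times> {..<p})" by (rule prob_space_gauss_prod)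
  let ?G = "Pi_pmf (layer_pairs L n) False (\<lambda>(l, i, j). bernoulli_pmf (lam l / real n))"
  interpret D: pair_prob_space "gauss_prod ({..<n} \<times> {..<p})" "measure_pmf ?G" ..
  show ?thesis unfolding null_law_def by unfold_locales
qed

context planted_cycles
begin

abbreviation "stat \<equiv> f_cycles L \<mu> \<rho> \<gamma> lam eps n p N"
abbreviation "val_sq \<equiv> (\<Sum>T\<in>cycle_codes. (val T)\<^sup>2)"

lemma f_cycles_fun: "stat = (\<lambda>\<omega>. 1 / sqrt BETA * (\<Sum>T\<in>cycle_codes. val T * mo T \<omega>))"
  by (rule ext) (rule f_cycles_eq)

lemma f_cycles_sq: "0 \<le> BETA \<Longrightarrow> (stat \<omega>)\<^sup>2 = 1 / BETA * (\<Sum>T\<in>cycle_codes. \<Sum>T'\<in>cycle_codes. val T * val T' * (mo T \<omega> * mo T' \<omega>))"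
  unfolding f_cycles_fun power_mult_distrib power_divide
  by (simp add: power2_eq_square[of "sum _ _"] sum_product mult_ac)

lemma measurable_f_cycles: "stat \<in> borel_measurable (obs_space n p)"
  unfolding f_cycles_fun
  by (intro borel_measurable_times borel_measurable_const borel_measurable_sum measurable_monom cycle_codes_facts(1))

lemma integrable_PL_f_cycles: "integrable PL stat"
  unfolding f_cycles_fun
  by (intro integrable_mult_right Bochner_Integration.integrable_sum integrable_planted_monom cycle_codes_facts(1))

lemma integral_PL_f_cycles: "integral\<^sup>L PL stat = val_sq / sqrt BETA"
proof -
  have "integral\<^sup>L PL stat = 1 / sqrt BETA * (\<Sum>T\<in>cycle_codes. val T * integral\<^sup>L PL (mo T))"
    unfolding f_cycles_fun
    by (simp add: Bochner_Integration.integral_sum integrable_planted_monom cycle_codes_facts(1))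
  also have "(\<Sum>T\<in>cycle_codes. val T * integral\<^sup>L PL (mo T)) = val_sq"
    by (intro sum.cong refl) (simp add: planted_mean_cycle power2_eq_square)
  finally show ?thesis by simp
qed

lemma second_moments:
  assumes "0 \<le> BETA" and int: "\<And>S K. S \<subseteq> cds \<Longrightarrow> K \<subseteq> cds \<Longrightarrow> integrable M (\<lambda>\<omega>. mo S \<omega> * mo K \<omega>)"
  shows "integrable M (\<lambda>\<omega>. (stat \<omega>)\<^sup>2)"
    and "(\<integral>\<omega>. (stat \<omega>)\<^sup>2 \<partial>M) = 1 / BETA * (\<Sum>T\<in>cycle_codes. \<Sum>T'\<in>cycle_codes. val T * val T' * (\<integral>\<omega>. mo T \<omega> * mo T' \<omega> \<partial>M))"
proof -
  note i = int[OF cycle_codes_facts(1) cycle_codes_facts(1)]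
  show "integrable M (\<lambda>\<omega>. (stat \<omega>)\<^sup>2)"
    unfolding f_cycles_sq[OF assms(1)]
    by (intro integrable_mult_right Bochner_Integration.integrable_sum i)
  show "(\<integral>\<omega>. (stat \<omega>)\<^sup>2 \<partial>M) = 1 / BETA * (\<Sum>T\<in>cycle_codes. \<Sum>T'\<in>cycle_codes. val T * val T' * (\<integral>\<omega>. mo T \<omega> * mo T' \<omega> \<partial>M))"
    unfolding f_cycles_sq[OF assms(1)]
    by (simp add: Bochner_Integration.integral_sum Bochner_Integration.integrable_sum integrable_mult_right i)
qed

lemma null_second_moment:
  assumes "0 < BETA" "val_sq \<le> BETA"
  shows "(\<integral>\<omega>. (stat \<omega>)\<^sup>2 \<partial>QL) \<le> 1"
proof -
  have "(\<Sum>T\<in>cycle_codes. \<Sum>T'\<in>cycle_codes. val T * val T' * (\<integral>\<omega>. mo T \<omega> * mo T' \<omega> \<partial>QL)) \<le> (\<Sum>T\<in>cycle_codes. \<Sum>T'\<in>cycle_codes. if T' = T then (val T)\<^sup>2 else 0)"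
  proof (intro sum_mono)
    fix T T' assume T: "T \<in> cycle_codes" "T' \<in> cycle_codes"
    note m = null_moment[OF cycle_codes_facts(1)[OF T(1)] cycle_codes_facts(1)[OF T(2)]]
    show "val T * val T' * (\<integral>\<omega>. mo T \<omega> * mo T' \<omega> \<partial>QL) \<le> (if T' = T then (val T)\<^sup>2 else 0)"
    proof (cases "T = T'")
      case True
      have "val T * val T * (\<integral>\<omega>. mo T \<omega> * mo T' \<omega> \<partial>QL) \<le> val T * val T * 1"
        using m(2)[OF True] by (intro mult_left_mono) auto
      then show ?thesis using True by (simp add: power2_eq_square)
    qed (use m(1) in simp)
  qed
  also have "\<dots> = val_sq" using finite_cycle_codes by simp
  finally have le: "(\<Sum>T\<in>cycle_codes. \<Sum>T'\<in>cycle_codes. val T * val T' * (\<integral>\<omega>. mo T \<omega> * mo T' \<omega> \<partial>QL)) \<le> BETA" using assms(2) by linarith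
  have "(\<integral>\<omega>. (stat \<omega>)\<^sup>2 \<partial>QL) = 1 / BETA * (\<Sum>T\<in>cycle_codes. \<Sum>T'\<in>cycle_codes. val T * val T' * (\<integral>\<omega>. mo T \<omega> * mo T' \<omega> \<partial>QL))"
    by (rule second_moments(2)[OF less_imp_le[OF assms(1)]], erule (1) integrable_null_pair)
  also have "\<dots> \<le> 1 / BETA * BETA" using le assms(1) by (intro mult_left_mono) auto
  finally show ?thesis using assms(1) by simp
qed

text \<open>The mean m satisfies m^2 \<ge> \<open>BETA\<close> / 4. The planted variance is at most
  5, namely 4 from the diagonal and 1 from the overlaps, so Chebyshev's inequality at distance (1 -
  c) m gives the constant 20; Markov's inequality for the square at level (c m)^2 gives 4.\<close>

lemma detection_error:
  assumes beta: "1 \<le> BETA" and n4: "4 * N\<^sup>2 \<le> n" and p4: "4 * N\<^sup>2 \<le> p"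
    and small: "20 * real N * \<mu> \<le> real n" and N1: "N \<ge> 1" and M: "mean_bound M" and overlap_error: "overlap_error M \<le> 1"
    and c: "0 < c" "c < 1"
  shows "measure PL {\<omega> \<in> space PL. stat \<omega> \<le> c * integral\<^sup>L PL stat} +
    measure QL {\<omega> \<in> space QL. stat \<omega> \<ge> c * integral\<^sup>L PL stat} \<le> (20 / (1 - c)\<^sup>2 + 4 / c\<^sup>2) / BETA"
proof -
  interpret P: prob_space PL by (rule prob_space_planted)
  interpret Q: prob_space QL by (rule prob_space_null)
  define m where "m = integral\<^sup>L PL stat"
  note B = sum_val_sq[OF n4 p4]
  have b: "0 < BETA" using beta by linarith
  have mB: "m = val_sq / sqrt BETA" unfolding m_def by (rule integral_PL_f_cycles)
  have m2: "BETA / 4 \<le> m\<^sup>2"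
  proof -
    have "(BETA / 2)\<^sup>2 \<le> val_sq\<^sup>2" using B(2) b by (intro power_mono) auto
    then have "(BETA / 2)\<^sup>2 / BETA \<le> val_sq\<^sup>2 / BETA" using b by (intro divide_right_mono) auto
    moreover have "m\<^sup>2 = val_sq\<^sup>2 / BETA" unfolding mB power_divide using b by simp
    moreover have "(BETA / 2)\<^sup>2 / BETA = BETA / 4" using b by (simp add: power2_eq_square)
    ultimately show ?thesis by simp
  qed
  have m0: "m > 0" unfolding mB using B(2) b by simp
  have sqP: "integrable PL (\<lambda>\<omega>. (stat \<omega>)\<^sup>2)" and sqQ: "integrable QL (\<lambda>\<omega>. (stat \<omega>)\<^sup>2)"
    using second_moments(1)[OF less_imp_le[OF b]] integrable_planted_pair integrable_null_pair by auto
  have meas: "stat \<in> borel_measurable PL" "stat \<in> borel_measurable QL"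
    using measurable_f_cycles by (simp_all add: measurable_cong_sets[OF sets_planted_law refl] measurable_cong_sets[OF sets_null_law refl])
  have var: "P.variance stat \<le> 5"
  proof -
    have "(\<integral>\<omega>. (stat \<omega>)\<^sup>2 \<partial>PL) \<le> 1 / BETA * (val_sq\<^sup>2 + 4 * val_sq + overlap_error M)"
      by (subst second_moments(2)[OF less_imp_le[OF b]], erule (1) integrable_planted_pair,
          rule mult_left_mono[OF second_moment_sum[OF M small N1]]) (use b in simp)
    also have "\<dots> \<le> 1 / BETA * (val_sq\<^sup>2 + 5 * BETA)"
      using B(1) overlap_error beta b by (intro mult_left_mono) auto
    also have "\<dots> = m\<^sup>2 + 5" unfolding mB power_divide using b by (simp add: field_simps)
    finally show ?thesis
      using P.variance_eq[OF integrable_PL_f_cycles sqP] by (simp add: m_def)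
  qed
  have P: "measure PL {\<omega> \<in> space PL. stat \<omega> \<le> c * m} \<le> 20 / (1 - c)\<^sup>2 / BETA"
  proof -
    let ?a = "(1 - c) * m"
    have a: "?a > 0" using c m0 by simp
    have "measure PL {\<omega> \<in> space PL. stat \<omega> \<le> c * m} \<le> measure PL {\<omega> \<in> space PL. ?a \<le> \<bar>stat \<omega> - m\<bar>}"
    proof (rule P.finite_measure_mono)
      show "{\<omega> \<in> space PL. stat \<omega> \<le> c * m} \<subseteq> {\<omega> \<in> space PL. ?a \<le> \<bar>stat \<omega> - m\<bar>}"
        by (auto simp: algebra_simps)
      show "{\<omega> \<in> space PL. ?a \<le> \<bar>stat \<omega> - m\<bar>} \<in> P.events" using meas(1) by measurable
    qed
    also have "\<dots> \<le> P.variance stat / ?a\<^sup>2"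
      unfolding m_def by (rule P.Chebyshev_inequality[OF meas(1) sqP]) (use a in \<open>simp add: m_def\<close>)
    also have "\<dots> \<le> 5 / ?a\<^sup>2" using var by (intro divide_right_mono) auto
    also have "\<dots> \<le> 5 / ((1 - c)\<^sup>2 * (BETA / 4))"
      unfolding power_mult_distrib using m2 b c m0 by (intro divide_left_mono mult_left_mono) auto
    finally show ?thesis by simp
  qed
  have Q: "measure QL {\<omega> \<in> space QL. stat \<omega> \<ge> c * m} \<le> 4 / c\<^sup>2 / BETA"
  proof -
    have cm: "0 < c * m" using c m0 by simp
    have "measure QL {\<omega> \<in> space QL. stat \<omega> \<ge> c * m} \<le> measure QL {\<omega> \<in> space QL. (stat \<omega>)\<^sup>2 \<ge> (c * m)\<^sup>2}"
    proof (rule Q.finite_measure_mono)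
      show "{\<omega> \<in> space QL. stat \<omega> \<ge> c * m} \<subseteq> {\<omega> \<in> space QL. (stat \<omega>)\<^sup>2 \<ge> (c * m)\<^sup>2}"
        using cm by (auto intro: power_mono)
      show "{\<omega> \<in> space QL. (stat \<omega>)\<^sup>2 \<ge> (c * m)\<^sup>2} \<in> Q.events" using meas(2) by measurable
    qed
    also have "\<dots> \<le> (\<integral>\<omega>. (stat \<omega>)\<^sup>2 \<partial>QL) / (c * m)\<^sup>2"
      by (rule integral_Markov_inequality_measure[OF sqQ, where A = "{}"]) (use cm in auto)
    also have "\<dots> \<le> 1 / (c * m)\<^sup>2"
      using null_second_moment[OF b B(1)] by (intro divide_right_mono) auto
    also have "\<dots> \<le> 1 / (c\<^sup>2 * (BETA / 4))"
      unfolding power_mult_distrib using m2 b c m0 by (intro divide_left_mono mult_left_mono) auto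
    finally show ?thesis by simp
  qed
  show ?thesis using P Q unfolding m_def by (simp add: add_divide_distrib)
qed

end

section \<open>Growth of the normalisation\<close>

text \<open>The recursive form avoids index arithmetic modulo the length while a closed walk is
  assembled from blocks.\<close>

fun path_edges :: "'a list \<Rightarrow> 'a set set" where
  "path_edges (x # y # xs) = insert {x, y} (path_edges (y # xs))"
| "path_edges _ = {}"

lemma path_edges_append: "path_edges (xs @ y # ys) = path_edges (xs @ [y]) \<union> path_edges (y # ys)"
proof (induction xs)
  case (Cons x xs)
  then show ?case by (cases xs) auto
qed simp

lemma path_edges_nth: "path_edges xs = {{xs ! i, xs ! (i + 1)} | i. i + 1 < length xs}"
proof (induction xs rule: path_edges.induct)
  case (1 x y xs)
  have "{{(x # y # xs) ! i, (x # y # xs) ! (i + 1)} | i. i + 1 < length (x # y # xs)} =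
    insert {x, y} {{(y # xs) ! i, (y # xs) ! (i + 1)} | i. i + 1 < length (y # xs)}"
  proof (intro equalityI subsetI)
    fix e assume "e \<in> {{(x # y # xs) ! i, (x # y # xs) ! (i + 1)} | i. i + 1 < length (x # y # xs)}"
    then obtain i where i: "e = {(x # y # xs) ! i, (x # y # xs) ! (i + 1)}" "i + 1 < length (x # y # xs)" by blast
    show "e \<in> insert {x, y} {{(y # xs) ! i, (y # xs) ! (i + 1)} | i. i + 1 < length (y # xs)}"
    proof (cases i)
      case (Suc j)
      then have "e = {(y # xs) ! j, (y # xs) ! (j + 1)}" "j + 1 < length (y # xs)" using i by auto
      then show ?thesis by blast
    qed (use i in simp)
  next
    fix e assume "e \<in> insert {x, y} {{(y # xs) ! i, (y # xs) ! (i + 1)} | i. i + 1 < length (y # xs)}"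
    then consider "e = {x, y}" | i where "e = {(y # xs) ! i, (y # xs) ! (i + 1)}" "i + 1 < length (y # xs)" by blast
    then show "e \<in> {{(x # y # xs) ! i, (x # y # xs) ! (i + 1)} | i. i + 1 < length (x # y # xs)}"
    proof cases
      case 1
      then have "e = {(x # y # xs) ! 0, (x # y # xs) ! (0 + 1)}" "0 + 1 < length (x # y # xs)" by auto
      then show ?thesis by blast
    next
      case 2
      then have "e = {(x # y # xs) ! (i + 1), (x # y # xs) ! (i + 1 + 1)}" "i + 1 + 1 < length (x # y # xs)" by auto
      then show ?thesis by blast
    qed
  qed
  then show ?case using 1 by simp
qed auto

text \<open>Repeating the first vertex at the end replaces the modulus by an open path.\<close>

lemma cycle_edges_path_edges:
  assumes "vs \<noteq> []"
  shows "{{vs ! i, vs ! ((i + 1) mod length vs)} | i. i < length vs} = path_edges (vs @ [hd vs])"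
proof -
  have "{vs ! i, vs ! ((i + 1) mod length vs)} = {(vs @ [hd vs]) ! i, (vs @ [hd vs]) ! (i + 1)}" if "i < length vs" for i
  proof (cases "i + 1 < length vs")
    case False
    then have "i + 1 = length vs" using that by simp
    then show ?thesis using assms that by (simp add: nth_append hd_conv_nth)
  qed (simp add: nth_append)
  then show ?thesis unfolding path_edges_nth by auto
qed

section \<open>Cycles described by cyclic words\<close>

locale words =
  fixes L n p N :: nat
  assumes N3: "N \<ge> 3" and nN: "N \<le> n" and pN: "N \<le> p"
begin

definition nxt :: "nat \<Rightarrow> nat" where
  "nxt i = (if i + 1 = N then 0 else i + 1)"

text \<open>Letter w i tells how the cycle passes from \<open>VA i\<close> to
  \<open>VA (nxt i)\<close>: along an edge of layer w i or, if w i = 0, through the vertex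
  \<open>VB i\<close>.\<close>

definition words :: "(nat \<Rightarrow> nat) set" where
  "words = {..<N} \<rightarrow>\<^sub>E {0..L}"

definition blk :: "(nat \<Rightarrow> nat) \<Rightarrow> nat \<Rightarrow> vertex list" where
  "blk w i = (if w i = 0 then [VA i, VB i] else [VA i])"

definition vlist :: "(nat \<Rightarrow> nat) \<Rightarrow> nat \<Rightarrow> vertex list" where
  "vlist w j = concat (map (blk w) [0..<j])"

text \<open>The successor \<open>v\<close> is a parameter, so inner steps and the step that closes
  the cycle share one form.\<close>

definition blk_edges :: "(nat \<Rightarrow> nat) \<Rightarrow> nat \<Rightarrow> vertex \<Rightarrow> vertex set set" where
  "blk_edges w i v = (if w i = 0 then {{VA i, VB i}, {VB i, v}} else {{VA i, v}})"

definition wedges :: "(nat \<Rightarrow> nat) \<Rightarrow> vertex set set" where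
  "wedges w = (\<Union>i<N. blk_edges w i (VA (nxt i)))"

text \<open>An edge with a b-end has layer 0; for any other edge the description picks its step,
  which is unique by \<open>VA_pair_inj\<close>.\<close>

definition wgraph :: "(nat \<Rightarrow> nat) \<Rightarrow> dgraph" where
  "wgraph w = \<lparr>verts = VA ` {..<N} \<union> VB ` {i. i < N \<and> w i = 0}, edges = wedges w,
     dec = (\<lambda>e\<in>wedges w. if \<exists>k. VB k \<in> e then 0 else w (THE i. i < N \<and> e = {VA i, VA (nxt i)}))\<rparr>"

lemma nxt_less: "i < N \<Longrightarrow> nxt i < N"
  using N3 by (auto simp: nxt_def)

lemma nxt_neq: "i < N \<Longrightarrow> nxt i \<noteq> i"
  using N3 by (auto simp: nxt_def)

lemma nxt_inj: "i < N \<Longrightarrow> j < N \<Longrightarrow> nxt i = nxt j \<Longrightarrow> i = j"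
  by (auto simp: nxt_def split: if_splits)

lemma nxt_image: "nxt ` {..<N} = {..<N}"
  by (rule endo_inj_surj) (auto intro: nxt_less simp: inj_on_def dest: nxt_inj)

text \<open>Here N \<ge> 3 is essential: for N = 2 both steps would join the same two
  vertices.\<close>

lemma nxt_pair_inj:
  assumes "i < N" "j < N" "{i, nxt i} = {j, nxt j}"
  shows "i = j"
proof (rule ccontr)
  assume "i \<noteq> j"
  then have "i = nxt j" "j = nxt i" using assms by (auto simp: doubleton_eq_iff)
  then show False using N3 assms(1,2) by (auto simp: nxt_def split: if_splits)
qed

lemma VA_pair_inj: "i < N \<Longrightarrow> j < N \<Longrightarrow> {VA i, VA (nxt i)} = {VA j, VA (nxt j)} \<Longrightarrow> i = j"
  by (rule nxt_pair_inj) (auto simp: doubleton_eq_iff)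

lemma set_vlist: "set (vlist w j) = VA ` {..<j} \<union> VB ` {i. i < j \<and> w i = 0}"
  by (induction j) (auto simp: vlist_def blk_def less_Suc_eq)

lemma distinct_vlist: "distinct (vlist w j)"
proof (induction j)
  case (Suc j)
  have "vlist w (Suc j) = vlist w j @ blk w j" by (simp add: vlist_def)
  then show ?case using Suc set_vlist[of w j] by (auto simp: blk_def)
qed (simp add: vlist_def)

lemma length_vlist: "j \<le> length (vlist w j)"
  by (induction j) (auto simp: vlist_def blk_def)

lemma path_edges_vlist_Suc:
  "path_edges (vlist w (Suc j) @ [v]) = path_edges (vlist w j @ [VA j]) \<union> blk_edges w j v"
proof -
  have eq: "vlist w (Suc j) @ [v] = vlist w j @ (VA j # (if w j = 0 then [VB j, v] else [v]))"
    by (simp add: vlist_def blk_def)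
  have "path_edges (vlist w (Suc j) @ [v]) = path_edges (vlist w j @ [VA j]) \<union>
      path_edges (VA j # (if w j = 0 then [VB j, v] else [v]))"
    unfolding eq by (rule path_edges_append)
  also have "path_edges (VA j # (if w j = 0 then [VB j, v] else [v])) = blk_edges w j v"
    by (simp add: blk_edges_def)
  finally show ?thesis .
qed

lemma path_edges_vlist: "path_edges (vlist w j @ [VA j]) = (\<Union>i<j. blk_edges w i (VA (i + 1)))"
proof (induction j)
  case (Suc j)
  then show ?case unfolding path_edges_vlist_Suc by (auto simp: lessThan_Suc)
qed (simp add: vlist_def)

text \<open>The blocks of the first N - 1 steps form a path, and the last block leads back to
  \<open>VA 0\<close>.\<close>

lemma is_cycle_wgraph: "is_cycle (wgraph w)"
  unfolding is_cycle_def
proof (intro exI conjI)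
  let ?vs = "vlist w N"
  obtain M where M: "N = Suc M" using N3 by (cases N) auto
  have len: "3 \<le> length ?vs" using N3 length_vlist[of N w] by simp
  then show "3 \<le> length ?vs" .
  show "distinct ?vs" by (rule distinct_vlist)
  show "verts (wgraph w) = set ?vs" by (simp add: wgraph_def set_vlist)
  have hd: "hd ?vs = VA 0"
  proof -
    have "[0..<N] = 0 # [1..<N]" using N3 by (simp add: upt_conv_Cons)
    then show ?thesis by (simp add: vlist_def blk_def)
  qed
  have "path_edges (?vs @ [hd ?vs]) = (\<Union>i<M. blk_edges w i (VA (i + 1))) \<union> blk_edges w M (VA 0)"
    unfolding hd unfolding M path_edges_vlist_Suc path_edges_vlist ..
  also have "(\<Union>i<M. blk_edges w i (VA (i + 1))) = (\<Union>i<M. blk_edges w i (VA (nxt i)))"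
  proof (rule SUP_cong[OF refl])
    fix i assume "i \<in> {..<M}"
    then have "nxt i = i + 1" unfolding nxt_def using M by simp
    then show "blk_edges w i (VA (i + 1)) = blk_edges w i (VA (nxt i))" by simp
  qed
  also have "VA 0 = VA (nxt M)" unfolding nxt_def using M by simp
  also have "(\<Union>i<M. blk_edges w i (VA (nxt i))) \<union> blk_edges w M (VA (nxt M)) = wedges w"
  proof -
    have "{..<N} = insert M {..<M}" using M by auto
    then show ?thesis unfolding wedges_def by auto
  qed
  finally show "edges (wgraph w) = {{?vs ! i, ?vs ! ((i + 1) mod length ?vs)} | i. i < length ?vs}"
    using len by (subst cycle_edges_path_edges) (auto simp: wgraph_def)
qed

lemma wedges_cases:
  assumes "e \<in> wedges w"
  obtains (A) i where "i < N" "w i \<noteq> 0" "e = {VA i, VA (nxt i)}"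
  | (B1) i where "i < N" "w i = 0" "e = {VA i, VB i}"
  | (B2) i where "i < N" "w i = 0" "e = {VA (nxt i), VB i}"
  using assms by (auto simp: wedges_def blk_edges_def insert_commute split: if_splits)

lemma wedgesI:
  "i < N \<Longrightarrow> w i \<noteq> 0 \<Longrightarrow> {VA i, VA (nxt i)} \<in> wedges w"
  "i < N \<Longrightarrow> w i = 0 \<Longrightarrow> {VA i, VB i} \<in> wedges w"
  "i < N \<Longrightarrow> w i = 0 \<Longrightarrow> {VA (nxt i), VB i} \<in> wedges w"
  unfolding wedges_def blk_edges_def by (force simp: insert_commute)+

lemma dec_wgraph_A: "i < N \<Longrightarrow> w i \<noteq> 0 \<Longrightarrow> dec (wgraph w) {VA i, VA (nxt i)} = w i"
proof -
  assume i: "i < N" "w i \<noteq> 0"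
  have "(THE j. j < N \<and> {VA i, VA (nxt i)} = {VA j, VA (nxt j)}) = i"
    by (rule the_equality) (use i VA_pair_inj in auto)
  then show ?thesis using wedgesI(1)[of i w, OF i] by (simp add: wgraph_def)
qed

lemma dec_wgraph_B: "e \<in> wedges w \<Longrightarrow> VB k \<in> e \<Longrightarrow> dec (wgraph w) e = 0"
  by (auto simp: wgraph_def)

lemma edges_wgraph: "edges (wgraph w) = wedges w"
  by (simp add: wgraph_def)

lemma verts_wgraph: "verts (wgraph w) = VA ` {..<N} \<union> VB ` {i. i < N \<and> w i = 0}"
  by (simp add: wgraph_def)

lemma decorated_wgraph:
  assumes w: "w \<in> words"
  shows "decorated_graph L n p (wgraph w)"
  unfolding decorated_graph_def
proof (intro conjI ballI)
  show "verts (wgraph w) \<subseteq> KVa n \<union> KVb p"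
    unfolding verts_wgraph using nN pN by (auto simp: KVa_def KVb_def)
  show "edges (wgraph w) \<subseteq> KEa n \<union> KEb n p"
    unfolding edges_wgraph
  proof
    fix e assume "e \<in> wedges w"
    then show "e \<in> KEa n \<union> KEb n p"
    proof (cases rule: wedges_cases)
      case (A i)
      then show ?thesis using KEaI[of i "nxt i" n] nxt_neq[of i] nxt_less[of i] nN by auto
    next
      case (B1 i)
      then have "i < n" "i < p" using nN pN by auto
      then show ?thesis using B1(3) unfolding KEb_def by blast
    next
      case (B2 i)
      then have "nxt i < n" "i < p" using nN pN nxt_less[of i] by auto
      then show ?thesis using B2(3) unfolding KEb_def by blast
    qed
  qed
  show "e \<subseteq> verts (wgraph w)" if "e \<in> edges (wgraph w)" for e
    using that unfolding edges_wgraph verts_wgraph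
    by (cases rule: wedges_cases) (auto intro: nxt_less)
  have d: "dec (wgraph w) e \<in> {0..L} \<and> (dec (wgraph w) e = 0 \<longleftrightarrow> e \<in> KEb n p)" if "e \<in> wedges w" for e
    using that
  proof (cases rule: wedges_cases)
    case (A i)
    have "e \<notin> KEb n p" using A by (auto simp: KEb_def doubleton_eq_iff)
    moreover have "w i \<in> {0..L}" using w A(1) unfolding words_def by blast
    ultimately show ?thesis using A(2,3) dec_wgraph_A[of i w, OF A(1,2)] by simp
  next
    case (B1 i)
    then have "i < n" "i < p" using nN pN by auto
    then have "e \<in> KEb n p" using B1(3) unfolding KEb_def by blast
    then show ?thesis using dec_wgraph_B[OF that, of i] B1(3) by simp
  next
    case (B2 i)
    then have "nxt i < n" "i < p" using nN pN nxt_less[of i] by auto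
    then have "e \<in> KEb n p" using B2(3) unfolding KEb_def by blast
    then show ?thesis using dec_wgraph_B[OF that, of i] B2(3) by simp
  qed
  have ext: "dec (wgraph w) \<in> extensional (edges (wgraph w))"
    by (simp add: wgraph_def)
  show "dec (wgraph w) \<in> edges (wgraph w) \<rightarrow>\<^sub>E {0..L}"
    using d ext unfolding edges_wgraph by (auto simp: PiE_def)
  show "(dec (wgraph w) e = 0) = (e \<in> KEb n p)" if "e \<in> edges (wgraph w)" for e
    using d that unfolding edges_wgraph by auto
qed

lemma Va_wgraph: "Va (wgraph w) = VA ` {..<N}"
  unfolding Va_def verts_wgraph by auto

lemma wgraph_cycles: "w \<in> words \<Longrightarrow> wgraph w \<in> cycles L n p N"
  using decorated_wgraph is_cycle_wgraph Va_wgraph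
  by (simp add: cycles_def card_image inj_on_def)

lemma wedges_AA:
  assumes "{VA a, VA b} \<in> wedges w"
  obtains r where "r < N" "w r \<noteq> 0" "{a, b} = {r, nxt r}" "dec (wgraph w) {VA a, VA b} = w r"
  using assms
proof (cases rule: wedges_cases)
  case (A i)
  then have "{a, b} = {i, nxt i}" by (auto simp: doubleton_eq_iff)
  then show thesis using that[of i] A dec_wgraph_A[of i w] by simp
qed (auto simp: doubleton_eq_iff)

lemma wedges_AB:
  assumes "{VA a, VB k} \<in> wedges w"
  shows "k < N" "w k = 0" "a \<in> {k, nxt k}"
  using assms by (cases rule: wedges_cases; auto simp: doubleton_eq_iff)+

section \<open>Isomorphisms between word graphs\<close>

context
  fixes w0 w \<psi>
  assumes w0: "w0 \<in> words" and w: "w \<in> words" and iso: "is_iso \<psi> (wgraph w0) (wgraph w)"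
begin

lemma wiso_VA:
  assumes "i < N"
  obtains j where "j < N" "\<psi> (VA i) = VA j"
proof -
  note f = iso_facts[OF decorated_wgraph[OF w0] decorated_wgraph[OF w] iso]
  have "VA i \<in> verts (wgraph w0)" using assms by (simp add: verts_wgraph)
  then have "\<psi> (VA i) \<in> verts (wgraph w)" "\<psi> (VA i) \<in> range VA" using f(2,3) by blast+
  then show thesis using that by (auto simp: verts_wgraph)
qed

lemma wiso_VA_inj:
  assumes "i < N" "j < N" "\<psi> (VA i) = \<psi> (VA j)"
  shows "i = j"
proof -
  note f = iso_facts[OF decorated_wgraph[OF w0] decorated_wgraph[OF w] iso]
  have "VA i = VA j" by (rule inj_onD[OF f(1) assms(3)]) (use assms in \<open>auto simp: verts_wgraph\<close>)
  then show ?thesis by simp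
qed

text \<open>A step is mapped onto a step with the same letter, possibly in the opposite direction.
  For letter 0 the image of the b-vertex names the target step, because \<open>VB r\<close> is
  adjacent only to \<open>VA r\<close> and \<open>VA (nxt r)\<close>.\<close>

lemma wiso_step:
  assumes i: "i < N" and a: "\<psi> (VA i) = VA a" and b: "\<psi> (VA (nxt i)) = VA b"
  obtains r where "r < N" "{a, b} = {r, nxt r}" "w r = w0 i" "w0 i = 0 \<Longrightarrow> \<psi> (VB i) = VB r"
proof -
  note f = iso_facts[OF decorated_wgraph[OF w0] decorated_wgraph[OF w] iso]
  have e: "\<psi> ` e \<in> wedges w" if "e \<in> wedges w0" for e
    using f(4) that by (simp add: edges_wgraph)
  have ab: "a \<noteq> b" using wiso_VA_inj[OF i nxt_less[OF i]] nxt_neq[OF i] a b by auto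
  show thesis
  proof (cases "w0 i = 0")
    case False
    have e0: "{VA i, VA (nxt i)} \<in> wedges w0" by (rule wedgesI(1)[of i w0, OF i False])
    then have e1: "{VA a, VA b} \<in> wedges w" using e[OF e0] a b by simp
    have "dec (wgraph w) {VA a, VA b} = w0 i"
      using f(5)[of "{VA i, VA (nxt i)}"] e0 dec_wgraph_A[of i w0, OF i False] a b by (simp add: edges_wgraph)
    moreover obtain r where "r < N" "{a, b} = {r, nxt r}" "dec (wgraph w) {VA a, VA b} = w r"
      using wedges_AA[OF e1] by metis
    ultimately show thesis using that[of r] False by simp
  next
    case True
    have "VB i \<in> verts (wgraph w0)" using i True by (simp add: verts_wgraph)
    then have "\<psi> (VB i) \<notin> range VA" using f(3)[of "VB i"] by auto
    then obtain k where k: "\<psi> (VB i) = VB k" by (cases "\<psi> (VB i)") auto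
    have "{VA a, VB k} \<in> wedges w" "{VA b, VB k} \<in> wedges w"
      using e[OF wedgesI(2)[of i w0, OF i True]] e[OF wedgesI(3)[of i w0, OF i True]] a b k by auto
    then have "k < N" "w k = 0" "a \<in> {k, nxt k}" "b \<in> {k, nxt k}" using wedges_AB by blast+
    then show thesis using that[of k] ab True k by auto
  qed
qed

end

text \<open>Walking along the cycle, the images of the first two \<open>a\<close>-vertices determine everything.\<close>

lemma wiso_determined:
  assumes w0: "w0 \<in> words" and w: "w \<in> words" "w' \<in> words"
    and iso: "is_iso \<psi> (wgraph w0) (wgraph w)" "is_iso \<psi>' (wgraph w0) (wgraph w')"
    and eq0: "\<psi> (VA 0) = \<psi>' (VA 0)" and eq1: "\<psi> (VA 1) = \<psi>' (VA 1)"
  shows "w = w'" and "\<And>v. v \<in> verts (wgraph w0) \<Longrightarrow> \<psi> v = \<psi>' v"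
proof -
  have two: "\<psi> (VA i) = \<psi>' (VA i) \<and> \<psi> (VA (i + 1)) = \<psi>' (VA (i + 1))" if "i + 1 < N" for i
    using that
  proof (induction i)
    case 0
    then show ?case using eq0 eq1 by simp
  next
    case (Suc i)
    have i: "i < N" "i + 1 < N" "i + 2 < N" using Suc.prems by auto
    have nx: "nxt i = i + 1" "nxt (i + 1) = i + 2" using i by (auto simp: nxt_def)
    obtain a where a: "a < N" "\<psi> (VA i) = VA a" using wiso_VA[OF w0 w(1) iso(1) i(1)] .
    obtain m where m: "m < N" "\<psi> (VA (i + 1)) = VA m" using wiso_VA[OF w0 w(1) iso(1) i(2)] .
    obtain b where b: "b < N" "\<psi> (VA (i + 2)) = VA b" using wiso_VA[OF w0 w(1) iso(1) i(3)] .
    obtain b' where b': "b' < N" "\<psi>' (VA (i + 2)) = VA b'" using wiso_VA[OF w0 w(2) iso(2) i(3)] .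
    have a': "\<psi>' (VA i) = VA a" "\<psi>' (VA (i + 1)) = VA m" using Suc.IH i(2) a m by auto
    have ne: "a \<noteq> b" "a \<noteq> b'"
      using wiso_VA_inj[OF w0 w(1) iso(1) i(1,3)] a b wiso_VA_inj[OF w0 w(2) iso(2) i(1,3)] a' b' by auto
    obtain r where r: "r < N" "{a, m} = {r, nxt r}"
      by (rule wiso_step[OF w0 w(1) iso(1) i(1), of a m]) (use nx a m in auto)
    obtain q where q: "q < N" "{m, b} = {q, nxt q}"
      by (rule wiso_step[OF w0 w(1) iso(1) i(2), of m b]) (use nx m b in auto)
    obtain q' where q': "q' < N" "{m, b'} = {q', nxt q'}"
      by (rule wiso_step[OF w0 w(2) iso(2) i(2), of m b']) (use nx a' b' in auto)
    have nb: "j = nxt m \<or> m = nxt j" if "{m, j} = {r, nxt r}" for j r using that by (auto simp: doubleton_eq_iff)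
    have "a = nxt m \<or> m = nxt a" by (rule nb[of a r]) (use r in \<open>simp add: insert_commute\<close>)
    moreover have "b = nxt m \<or> m = nxt b" by (rule nb[OF q(2)])
    moreover have "b' = nxt m \<or> m = nxt b'" by (rule nb[OF q'(2)])
    \<comment> \<open>The position m has only two cyclic neighbours; a is one of them, so b and b'
      are both the other one.\<close>
    ultimately have "b = b'" using ne nxt_inj[of a b] nxt_inj[of a b'] nxt_inj[of b b'] a(1) b(1) b'(1) by auto
    then show ?case using a' m b b' by simp
  qed
  have VAeq: "\<psi> (VA i) = \<psi>' (VA i)" if "i < N" for i
  proof (cases "i + 1 < N")
    case False
    then have "i - 1 + 1 = i" "i - 1 + 1 < N" using that N3 by auto
    then show ?thesis using two[of "i - 1"] by simp
  qed (use two in blast)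
  have step: "\<exists>r<N. w r = w0 i \<and> w' r = w0 i \<and> (w0 i = 0 \<longrightarrow> \<psi> (VB i) = VB r \<and> \<psi>' (VB i) = VB r) \<and>
      \<psi> ` {VA i, VA (nxt i)} = {VA r, VA (nxt r)}" if i: "i < N" for i
  proof -
    obtain a where a: "a < N" "\<psi> (VA i) = VA a" using wiso_VA[OF w0 w(1) iso(1) i] .
    obtain b where b: "b < N" "\<psi> (VA (nxt i)) = VA b" using wiso_VA[OF w0 w(1) iso(1) nxt_less[OF i]] .
    have a': "\<psi>' (VA i) = VA a" "\<psi>' (VA (nxt i)) = VA b" using VAeq[OF i] VAeq[OF nxt_less[OF i]] a b by auto
    obtain r where r: "r < N" "{a, b} = {r, nxt r}" "w r = w0 i" "w0 i = 0 \<Longrightarrow> \<psi> (VB i) = VB r"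
      using wiso_step[OF w0 w(1) iso(1) i a(2) b(2)] by metis
    obtain r' where r': "r' < N" "{a, b} = {r', nxt r'}" "w' r' = w0 i" "w0 i = 0 \<Longrightarrow> \<psi>' (VB i) = VB r'"
      using wiso_step[OF w0 w(2) iso(2) i a'] by metis
    have "r = r'" by (rule nxt_pair_inj[OF r(1) r'(1)]) (use r(2) r'(2) in simp)
    moreover have "\<psi> ` {VA i, VA (nxt i)} = {VA r, VA (nxt r)}"
    proof -
      have "VA ` {a, b} = VA ` {r, nxt r}" using r(2) by simp
      then show ?thesis using a b by simp
    qed
    ultimately show ?thesis using r r' by (intro exI[of _ r]) auto
  qed
  \<comment> \<open>R sends steps of \<open>w0\<close> to steps of the target. It is injective
    because \<psi> is, hence a permutation, and along it both w and w' copy the letters of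
    \<open>w0\<close>.\<close>
  then obtain R where R: "\<And>i. i < N \<Longrightarrow> R i < N \<and> w (R i) = w0 i \<and> w' (R i) = w0 i \<and>
      (w0 i = 0 \<longrightarrow> \<psi> (VB i) = VB (R i) \<and> \<psi>' (VB i) = VB (R i)) \<and>
      \<psi> ` {VA i, VA (nxt i)} = {VA (R i), VA (nxt (R i))}" by metis
  have injR: "inj_on R {..<N}"
  proof (rule inj_onI)
    fix i j assume ij: "i \<in> {..<N}" "j \<in> {..<N}" "R i = R j"
    then have im: "\<psi> ` {VA i, VA (nxt i)} = \<psi> ` {VA j, VA (nxt j)}" using R[of i] R[of j] by simp
    note f = iso_facts[OF decorated_wgraph[OF w0] decorated_wgraph[OF w(1)] iso(1)]
    have "{VA i, VA (nxt i)} = {VA j, VA (nxt j)}"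
    proof (rule inj_on_image_eq_iff[OF f(1), THEN iffD1, OF _ _ im])
      show "{VA i, VA (nxt i)} \<subseteq> verts (wgraph w0)" "{VA j, VA (nxt j)} \<subseteq> verts (wgraph w0)"
        using ij nxt_less by (auto simp: verts_wgraph)
    qed
    then show "i = j" using VA_pair_inj ij by auto
  qed
  have surjR: "R ` {..<N} = {..<N}"
    by (rule endo_inj_surj) (use R injR in auto)
  have "w r = w' r" for r
  proof (cases "r < N")
    case True
    then obtain i where "i < N" "r = R i" using surjR by blast
    then show ?thesis using R by simp
  next
    case False
    then show ?thesis using w by (auto simp: words_def PiE_def extensional_def)
  qed
  then show "w = w'" by (rule ext)
  show "\<psi> v = \<psi>' v" if "v \<in> verts (wgraph w0)" for v
    using that VAeq R by (auto simp: verts_wgraph)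
qed

lemma finite_words: "finite words"
  unfolding words_def by (rule finite_PiE) auto

lemma finite_Aut:
  assumes "decorated_graph L n p H"
  shows "finite (Aut H)"
proof (rule finite_subset)
  show "Aut H \<subseteq> verts H \<rightarrow>\<^sub>E verts H"
    by (auto simp: Aut_def is_iso_def PiE_def dest: bij_betwE)
  show "finite (verts H \<rightarrow>\<^sub>E verts H)"
    by (rule finite_PiE) (simp_all add: finite_verts[OF assms])
qed

lemma Aut_nonempty: "decorated_graph L n p H \<Longrightarrow> Aut H \<noteq> {}"
proof -
  assume H: "decorated_graph L n p H"
  have "restrict (\<lambda>v. v) (verts H) \<in> Aut H" by (simp add: Aut_def is_iso_restrict[OF H] is_iso_id)
  then show ?thesis by blast
qed

text \<open>A word together with an isomorphism from the representative onto its graph is determined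
  by the images of two consecutive a-vertices (\<open>wiso_determined\<close>), for which there are
  at most N^2 choices. Each word of the class occurs with |Aut| isomorphisms.\<close>

lemma card_words_in_class:
  assumes C: "C \<in> cycle_classes L n p N"
  shows "card {w \<in> words. wgraph w \<in> C} * card (Aut (rep C)) \<le> N\<^sup>2"
proof (cases "{w \<in> words. wgraph w \<in> C} = {}")
  case True
  show ?thesis unfolding True by simp
next
  case False
  let ?R = "rep C" and ?W = "{w \<in> words. wgraph w \<in> C}"
  note r = cycle_class_eq[OF C rep_in_class[OF C]]
  have dR: "decorated_graph L n p ?R" using r(1) by (simp add: cycles_def)
  let ?I = "\<lambda>w. {\<psi> \<in> extensional (verts ?R). is_iso \<psi> ?R (wgraph w)}"
  have cI: "card (?I w) = card (Aut ?R)" if "w \<in> ?W" for w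
  proof -
    have "isomorphic ?R (wgraph w)" "decorated_graph L n p (wgraph w)" using that r(2) by auto
    then show ?thesis using card_Isos[OF dR] by (auto simp: isomorphic_def)
  qed
  obtain w0 where w0: "w0 \<in> words" "wgraph w0 \<in> C" using False by blast
  then obtain \<phi>0 where \<phi>0: "is_iso \<phi>0 ?R (wgraph w0)" using r(2) by (auto simp: isomorphic_def)
  \<comment> \<open>A reference word graph in the class singles out two consecutive a-vertices of
    the representative.\<close>
  define \<theta> where "\<theta> = inv_into (verts ?R) \<phi>0"
  have \<theta>: "is_iso \<theta> (wgraph w0) ?R" unfolding \<theta>_def by (rule is_iso_inv[OF dR \<phi>0])
  have \<theta>im: "\<theta> ` verts (wgraph w0) = verts ?R" using \<theta> by (simp add: is_iso_def bij_betw_def)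
  let ?f = "\<lambda>(w, \<psi>). (\<psi> (\<theta> (VA 0)), \<psi> (\<theta> (VA 1)))"
  have inj: "inj_on ?f (SIGMA w:?W. ?I w)"
  proof (rule inj_onI)
    fix P P' assume P: "P \<in> (SIGMA w:?W. ?I w)" "P' \<in> (SIGMA w:?W. ?I w)" "?f P = ?f P'"
    obtain w \<psi> where p: "P = (w, \<psi>)" by (cases P)
    obtain w' \<psi>' where p': "P' = (w', \<psi>')" by (cases P')
    have 1: "w \<in> words" "w' \<in> words" "\<psi> \<in> extensional (verts ?R)" "\<psi>' \<in> extensional (verts ?R)"
      "is_iso \<psi> ?R (wgraph w)" "is_iso \<psi>' ?R (wgraph w')" using P(1,2) by (auto simp: p p')
    have 2: "(\<psi> \<circ> \<theta>) (VA 0) = (\<psi>' \<circ> \<theta>) (VA 0)" "(\<psi> \<circ> \<theta>) (VA 1) = (\<psi>' \<circ> \<theta>) (VA 1)" using P(3) by (auto simp: p p')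
    note det = wiso_determined[OF w0(1) 1(1,2) is_iso_comp[OF \<theta> 1(5)] is_iso_comp[OF \<theta> 1(6)] 2]
    have "\<psi> v = \<psi>' v" for v
    proof (cases "v \<in> verts ?R")
      case True
      then obtain u where "u \<in> verts (wgraph w0)" "v = \<theta> u" using \<theta>im by blast
      then show ?thesis using det(2)[of u] by simp
    next
      case False
      then show ?thesis using 1(3,4) by (auto simp: extensional_def)
    qed
    then show "P = P'" using det(1) by (auto simp: p p')
  qed
  have im: "?f ` (SIGMA w:?W. ?I w) \<subseteq> VA ` {..<N} \<times> VA ` {..<N}"
  proof -
    have "\<psi> (\<theta> (VA i)) \<in> VA ` {..<N}" if *: "w \<in> ?W" "\<psi> \<in> ?I w" "i < N" for w \<psi> i
    proof -
      have 1: "w \<in> words" using *(1) by blast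
      have 2: "is_iso (\<psi> \<circ> \<theta>) (wgraph w0) (wgraph w)" using * is_iso_comp[OF \<theta>] by blast
      obtain j where "j < N" "(\<psi> \<circ> \<theta>) (VA i) = VA j" by (rule wiso_VA[OF w0(1) 1 2 *(3)])
      then show ?thesis by simp
    qed
    then show ?thesis using N3 by auto
  qed
  have "card (SIGMA w:?W. ?I w) \<le> card (VA ` {..<N} \<times> VA ` {..<N})"
    by (rule card_inj_on_le[OF inj im]) auto
  also have "\<dots> = N\<^sup>2" by (simp add: card_cartesian_product card_image inj_on_def power2_eq_square)
  finally have le: "card (SIGMA w:?W. ?I w) \<le> N\<^sup>2" .
  have "card (SIGMA w:?W. ?I w) = (\<Sum>w\<in>?W. card (?I w))"
  proof (rule card_SigmaI)
    show "\<forall>w\<in>?W. finite (?I w)"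
    proof
      fix w assume "w \<in> ?W"
      then have "card (?I w) > 0" using cI finite_Aut[OF dR] Aut_nonempty[OF dR] by (simp add: card_gt_0_iff)
      then show "finite (?I w)" by (rule card_ge_0_finite)
    qed
  qed (use finite_words in auto)
  also have "\<dots> = card ?W * card (Aut ?R)" using cI by simp
  finally show ?thesis using le by simp
qed

lemma sum_words_le_beta:
  "(\<Sum>w\<in>words. (Xi L \<mu> \<rho> \<gamma> lam eps (wgraph w))\<^sup>2) \<le> (real N)\<^sup>2 * beta L \<mu> \<rho> \<gamma> lam eps n p N"
proof -
  let ?X = "\<lambda>H. (Xi L \<mu> \<rho> \<gamma> lam eps H)\<^sup>2" and ?CC = "cycle_classes L n p N"
  define cl where "cl w = {S. decorated_graph L n p S \<and> isomorphic (wgraph w) S}" for w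
  have cl: "cl w \<in> ?CC" if "w \<in> words" for w
    unfolding cl_def by (rule cycle_class_of[OF wgraph_cycles[OF that]])
  have cl_iff: "cl w = C \<longleftrightarrow> wgraph w \<in> C" if "w \<in> words" "C \<in> ?CC" for w C
    using cycle_class_eq(2)[OF that(2), of "wgraph w"] decorated_wgraph[OF that(1)] isomorphic_refl
    unfolding cl_def by blast
  have finC: "finite ?CC"
  proof -
    have "?CC \<subseteq> Pow (cycles L n p N)" using cycle_class_eq(1) by blast
    then show ?thesis by (rule finite_subset) (simp add: finite_cycles)
  qed
  have "(\<Sum>w\<in>words. ?X (wgraph w)) = (\<Sum>C\<in>?CC. \<Sum>w\<in>{w\<in>words. cl w = C}. ?X (wgraph w))"
    by (rule sum.group[symmetric]) (use finite_words finC cl in auto)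
  also have "\<dots> \<le> (\<Sum>C\<in>?CC. (real N)\<^sup>2 * (?X (rep C) / real (card (Aut (rep C)))))"
  proof (rule sum_mono)
    fix C assume C: "C \<in> ?CC"
    let ?R = "rep C"
    note r = cycle_class_eq[OF C rep_in_class[OF C]]
    have dR: "decorated_graph L n p ?R" using r(1) by (simp add: cycles_def)
    have A: "real (card (Aut ?R)) > 0" using finite_Aut[OF dR] Aut_nonempty[OF dR] by (simp add: card_gt_0_iff)
    have eq: "{w\<in>words. cl w = C} = {w\<in>words. wgraph w \<in> C}" using cl_iff[OF _ C] by blast
    have "(\<Sum>w\<in>{w\<in>words. cl w = C}. ?X (wgraph w)) = (\<Sum>w\<in>{w\<in>words. wgraph w \<in> C}. ?X ?R)"
      unfolding eq
    proof (rule sum.cong[OF refl])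
      fix w assume "w \<in> {w\<in>words. wgraph w \<in> C}"
      then have "decorated_graph L n p (wgraph w)" "isomorphic ?R (wgraph w)" using r(2) by auto
      then show "?X (wgraph w) = ?X ?R" using iso_Xi[OF dR] by (auto simp: isomorphic_def)
    qed
    also have "\<dots> = real (card {w\<in>words. wgraph w \<in> C}) * ?X ?R" by simp
    also have "\<dots> \<le> ((real N)\<^sup>2 / real (card (Aut ?R))) * ?X ?R"
    proof (rule mult_right_mono)
      have "real (card {w\<in>words. wgraph w \<in> C} * card (Aut ?R)) \<le> real (N\<^sup>2)"
        using card_words_in_class[OF C] by (simp only: of_nat_le_iff)
      then show "real (card {w\<in>words. wgraph w \<in> C}) \<le> (real N)\<^sup>2 / real (card (Aut ?R))"
        using A by (simp add: field_simps)
    qed simp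
    finally show "(\<Sum>w\<in>{w\<in>words. cl w = C}. ?X (wgraph w)) \<le> (real N)\<^sup>2 * (?X ?R / real (card (Aut ?R)))" by simp
  qed
  also have "\<dots> = (real N)\<^sup>2 * beta L \<mu> \<rho> \<gamma> lam eps n p N"
    unfolding beta_def by (rule sum_distrib_left[symmetric])
  finally show ?thesis .
qed

end

section \<open>Transfer matrices\<close>

definition chain_sum :: "'a set \<Rightarrow> ('a \<Rightarrow> real) \<Rightarrow> ('a \<Rightarrow> 'a \<Rightarrow> real) \<Rightarrow> nat \<Rightarrow> 'a \<Rightarrow> real" where
  "chain_sum A x t m a = (\<Sum>w\<in>{..<m} \<rightarrow>\<^sub>E A. (\<Prod>i<m. x (w i)) * (\<Prod>i<m. t (w i) (if i + 1 = m then a else w (i + 1))))"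

lemma chain_sum_0: "chain_sum A x t 0 a = 1"
  by (simp add: chain_sum_def)

text \<open>Splitting off the last letter is a matrix-vector product: \<open>chain_sum\<close> is
  the m-th power of the matrix with entries x b * t b a, applied to the constant vector 1.\<close>

lemma chain_sum_Suc: "chain_sum A x t (Suc m) a = (\<Sum>b\<in>A. x b * t b a * chain_sum A x t m b)"
proof -
  let ?g = "\<lambda>w. (\<Prod>i<Suc m. x (w i)) * (\<Prod>i<Suc m. t (w i) (if i + 1 = Suc m then a else w (i + 1)))"
  have "chain_sum A x t (Suc m) a = sum ?g ((\<lambda>(y, g). g(m := y)) ` (A \<times> ({..<m} \<rightarrow>\<^sub>E A)))"
    unfolding chain_sum_def lessThan_Suc PiE_insert_eq ..
  also have "\<dots> = (\<Sum>(b, w)\<in>A \<times> ({..<m} \<rightarrow>\<^sub>E A). ?g (w(m := b)))"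
    by (subst sum.reindex[OF inj_combinator]) (simp_all add: case_prod_unfold)
  also have "\<dots> = (\<Sum>b\<in>A. \<Sum>w\<in>{..<m} \<rightarrow>\<^sub>E A. ?g (w(m := b)))"
    by (rule sum.cartesian_product[symmetric])
  also have "\<dots> = (\<Sum>b\<in>A. x b * t b a * chain_sum A x t m b)"
  proof (rule sum.cong[OF refl])
    fix b assume "b \<in> A"
    have "?g (w(m := b)) = x b * t b a * ((\<Prod>i<m. x (w i)) * (\<Prod>i<m. t (w i) (if i + 1 = m then b else w (i + 1))))" for w
    proof -
      have "(\<Prod>i<m. x ((w(m := b)) i)) = (\<Prod>i<m. x (w i))" by (rule prod.cong) auto
      moreover have "(\<Prod>i<m. t ((w(m := b)) i) (if i + 1 = Suc m then a else (w(m := b)) (i + 1))) =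
        (\<Prod>i<m. t (w i) (if i + 1 = m then b else w (i + 1)))" by (rule prod.cong) auto
      ultimately show ?thesis by (simp only: prod.lessThan_Suc) simp
    qed
    then show "(\<Sum>w\<in>{..<m} \<rightarrow>\<^sub>E A. ?g (w(m := b))) = x b * t b a * chain_sum A x t m b"
      unfolding chain_sum_def sum_distrib_left by (rule sum.cong[OF refl])
  qed
  finally show ?thesis .
qed

text \<open>Subinvariance: \<kappa> v lies below the starting vector 1, the matrix is nonnegative
  and expands v by at least \<theta>, so monotonicity carries the factor through all m
  steps.\<close>

lemma chain_sum_lower:
  fixes x v :: "'a \<Rightarrow> real"
  assumes x: "\<And>b. b \<in> A \<Longrightarrow> 0 \<le> x b" and t: "\<And>a b. 0 \<le> t a b"
    and v: "\<And>a. a \<in> A \<Longrightarrow> \<kappa> * v a \<le> 1" and "0 \<le> \<kappa>" "0 \<le> \<theta>"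
    and sub: "\<And>a. a \<in> A \<Longrightarrow> \<theta> * v a \<le> (\<Sum>b\<in>A. x b * t b a * v b)"
    and a: "a \<in> A"
  shows "\<kappa> * \<theta> ^ m * v a \<le> chain_sum A x t m a"
  using a
proof (induction m arbitrary: a)
  case 0
  then show ?case using v by (simp add: chain_sum_0)
next
  case (Suc m)
  have "\<kappa> * \<theta> ^ Suc m * v a = \<kappa> * \<theta> ^ m * (\<theta> * v a)" by simp
  also have "\<dots> \<le> \<kappa> * \<theta> ^ m * (\<Sum>b\<in>A. x b * t b a * v b)"
    using sub[OF Suc.prems] assms(4,5) by (intro mult_left_mono) auto
  also have "\<dots> = (\<Sum>b\<in>A. x b * t b a * (\<kappa> * \<theta> ^ m * v b))"
    by (simp add: sum_distrib_left mult_ac)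
  also have "\<dots> \<le> (\<Sum>b\<in>A. x b * t b a * chain_sum A x t m b)"
    using Suc.IH x t by (intro sum_mono mult_left_mono mult_nonneg_nonneg) auto
  finally show ?case by (simp only: chain_sum_Suc)
qed

definition letter_weight :: "real \<Rightarrow> real \<Rightarrow> (nat \<Rightarrow> real) \<Rightarrow> (nat \<Rightarrow> real) \<Rightarrow> nat \<Rightarrow> real" where
  "letter_weight \<mu> \<gamma> lam eps l = (if l = 0 then \<mu>\<^sup>2 / \<gamma> else (eps l)\<^sup>2 * lam l)"

text \<open>Factor of Xi^2 at the a-vertex between two consecutive letters: layer 0 next to a graph
  layer puts the vertex into \<open>dif0\<close>, two different graph layers put it into
  \<open>dif\<close>.\<close>

definition link_weight :: "real \<Rightarrow> nat \<Rightarrow> nat \<Rightarrow> real" where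
  "link_weight \<rho> a b = (if a = b then 1 else if a = 0 \<or> b = 0 then \<rho>\<^sup>2 else \<rho> ^ 4)"

section \<open>The weight of a word graph as a product over adjacent letters\<close>

context words
begin

text \<open>Writing a-vertices as \<open>nxt i\<close> places each between its two letters, w i
  behind it and w (nxt i) ahead.\<close>

lemma Vl_wgraph:
  assumes i: "i < N"
  shows "VA (nxt i) \<in> Vl (wgraph w) l \<longleftrightarrow> w i = l \<or> w (nxt i) = l"
proof
  assume "VA (nxt i) \<in> Vl (wgraph w) l"
  then obtain e where e: "e \<in> wedges w" "dec (wgraph w) e = l" "VA (nxt i) \<in> e" by (auto simp: Vl_def El_def edges_wgraph)
  from e(1) show "w i = l \<or> w (nxt i) = l"
  proof (cases rule: wedges_cases)
    case (A j)
    have "w j = l" using e(2) dec_wgraph_A[of j w, OF A(1,2)] A(3) by simp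
    moreover have "nxt i = j \<or> nxt i = nxt j" using e(3) A(3) by auto
    ultimately show ?thesis using nxt_inj[OF i A(1)] by auto
  next
    case (B1 j)
    have "l = 0" using e(2) dec_wgraph_B[OF e(1), of j] B1(3) by simp
    then show ?thesis using e(3) B1 by auto
  next
    case (B2 j)
    have "l = 0" using e(2) dec_wgraph_B[OF e(1), of j] B2(3) by simp
    moreover have "nxt i = nxt j" using e(3) B2(3) by auto
    ultimately show ?thesis using nxt_inj[OF i B2(1)] B2(2) by auto
  qed
next
  have ex: "\<exists>e\<in>wedges w. dec (wgraph w) e = w j \<and> VA k \<in> e" if "j < N" "k = j \<or> k = nxt j" for j k
  proof (cases "w j = 0")
    case False
    then show ?thesis using wedgesI(1)[of j w] dec_wgraph_A[of j w] that by (intro bexI[of _ "{VA j, VA (nxt j)}"]) auto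
  next
    case True
    note e = wedgesI(2)[of j w, OF that(1) True] wedgesI(3)[of j w, OF that(1) True]
    show ?thesis
    proof (cases "k = j")
      case True
      show ?thesis using e(1) dec_wgraph_B[OF e(1), of j] True \<open>w j = 0\<close> by (intro bexI[of _ "{VA j, VB j}"]) auto
    next
      case False
      then have "k = nxt j" using that(2) by simp
      then show ?thesis using e(2) dec_wgraph_B[OF e(2), of j] \<open>w j = 0\<close> by (intro bexI[of _ "{VA (nxt j), VB j}"]) auto
    qed
  qed
  assume "w i = l \<or> w (nxt i) = l"
  then have "\<exists>e\<in>wedges w. dec (wgraph w) e = l \<and> VA (nxt i) \<in> e"
    using ex[OF i, of "nxt i"] ex[OF nxt_less[OF i], of "nxt i"] by auto
  then show "VA (nxt i) \<in> Vl (wgraph w) l"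
    using nxt_less[OF i] by (auto simp: Vl_def El_def edges_wgraph verts_wgraph)
qed

lemma card_nxt_image: "card ((\<lambda>i. VA (nxt i)) ` {i. i < N \<and> P i}) = card {i. i < N \<and> P i}"
  by (rule card_image) (auto simp: inj_on_def dest: nxt_inj)

lemma Vl_pos_nxt:
  assumes w: "w \<in> words" and v: "v \<in> Vl (wgraph w) l" "l \<ge> 1"
  obtains i where "i < N" "v = VA (nxt i)"
proof -
  have "v \<in> VA ` {..<n}" by (rule Vl_pos_VA[OF wgraph_cycles[OF w] v])
  moreover have "v \<in> verts (wgraph w)" using v(1) by (simp add: Vl_def)
  ultimately obtain j where j: "j < N" "v = VA j" by (auto simp: verts_wgraph)
  then have "j \<in> nxt ` {..<N}" unfolding nxt_image by simp
  then show thesis using that j by auto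
qed

lemma word_le: "w \<in> words \<Longrightarrow> i < N \<Longrightarrow> w i \<le> L"
  using PiE_mem[of w "{..<N}" "\<lambda>_. {0..L}" i] by (simp add: words_def)

lemma dif0_wgraph:
  assumes w: "w \<in> words"
  shows "dif0 L (wgraph w) = (\<lambda>i. VA (nxt i)) ` {i. i < N \<and> (w i = 0) \<noteq> (w (nxt i) = 0)}"
proof (intro equalityI subsetI)
  fix v assume "v \<in> dif0 L (wgraph w)"
  then obtain l where l: "1 \<le> l" "v \<in> Vl (wgraph w) 0" "v \<in> Vl (wgraph w) l" by (auto simp: dif0_def)
  obtain i where i: "i < N" "v = VA (nxt i)" by (rule Vl_pos_nxt[OF w l(3,1)])
  then have "(w i = 0) \<noteq> (w (nxt i) = 0)" using l Vl_wgraph[OF i(1), of w] by auto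
  then show "v \<in> (\<lambda>i. VA (nxt i)) ` {i. i < N \<and> (w i = 0) \<noteq> (w (nxt i) = 0)}" using i by blast
next
  fix v assume "v \<in> (\<lambda>i. VA (nxt i)) ` {i. i < N \<and> (w i = 0) \<noteq> (w (nxt i) = 0)}"
  then obtain i where i: "i < N" "v = VA (nxt i)" "(w i = 0) \<noteq> (w (nxt i) = 0)" by blast
  \<comment> \<open>One of the two letters is 0, so the sum is the other one.\<close>
  define l where "l = w i + w (nxt i)"
  have "1 \<le> l" "l \<le> L" "w i = 0 \<or> w (nxt i) = 0" "w i = l \<or> w (nxt i) = l"
    using i(3) word_le[OF w i(1)] word_le[OF w nxt_less[OF i(1)]] by (auto simp: l_def)
  then have "l \<in> {1..L}" "VA (nxt i) \<in> Vl (wgraph w) 0" "VA (nxt i) \<in> Vl (wgraph w) l"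
    using Vl_wgraph[OF i(1), of w] by auto
  then show "v \<in> dif0 L (wgraph w)" unfolding dif0_def i(2) by blast
qed

lemma dif_wgraph:
  assumes w: "w \<in> words"
  shows "dif L (wgraph w) = (\<lambda>i. VA (nxt i)) ` {i. i < N \<and> w i \<noteq> w (nxt i) \<and> w i \<noteq> 0 \<and> w (nxt i) \<noteq> 0}"
proof (intro equalityI subsetI)
  fix v assume "v \<in> dif L (wgraph w)"
  then obtain l l' where l: "1 \<le> l" "l < l'" "v \<in> Vl (wgraph w) l" "v \<in> Vl (wgraph w) l'" by (auto simp: dif_def)
  obtain i where i: "i < N" "v = VA (nxt i)" by (rule Vl_pos_nxt[OF w l(3,1)])
  then have "w i \<noteq> w (nxt i) \<and> w i \<noteq> 0 \<and> w (nxt i) \<noteq> 0" using l Vl_wgraph[OF i(1), of w] by auto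
  then show "v \<in> (\<lambda>i. VA (nxt i)) ` {i. i < N \<and> w i \<noteq> w (nxt i) \<and> w i \<noteq> 0 \<and> w (nxt i) \<noteq> 0}" using i by blast
next
  fix v assume "v \<in> (\<lambda>i. VA (nxt i)) ` {i. i < N \<and> w i \<noteq> w (nxt i) \<and> w i \<noteq> 0 \<and> w (nxt i) \<noteq> 0}"
  then obtain i where i: "i < N" "v = VA (nxt i)" "w i \<noteq> w (nxt i)" "w i \<noteq> 0" "w (nxt i) \<noteq> 0" by blast
  have "VA (nxt i) \<in> Vl (wgraph w) (min (w i) (w (nxt i))) \<inter> Vl (wgraph w) (max (w i) (w (nxt i)))"
    using Vl_wgraph[OF i(1), of w] by (simp add: min_def max_def)
  moreover have "1 \<le> min (w i) (w (nxt i))" "min (w i) (w (nxt i)) < max (w i) (w (nxt i))" "max (w i) (w (nxt i)) \<le> L"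
    using i word_le[OF w i(1)] word_le[OF w nxt_less[OF i(1)]] by auto
  ultimately show "v \<in> dif L (wgraph w)" unfolding dif_def i(2) by blast
qed

text \<open>A letter 0 contributes the two edges at \<open>VB i\<close>, any other letter a single
  edge.\<close>

lemma card_El_wgraph:
  assumes w: "w \<in> words"
  shows "card (El (wgraph w) 0) = 2 * card {i. i < N \<and> w i = 0}"
    and "l \<ge> 1 \<Longrightarrow> card (El (wgraph w) l) = card {i. i < N \<and> w i = l}"
proof -
  note S = wgraph_cycles[OF w]
  have "verts (wgraph w) - Va (wgraph w) = VB ` {i. i < N \<and> w i = 0}"
    unfolding Va_wgraph verts_wgraph by auto
  then have "card (verts (wgraph w) - Va (wgraph w)) = card {i. i < N \<and> w i = 0}"
    by (simp add: card_image inj_on_def)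
  then show "card (El (wgraph w) 0) = 2 * card {i. i < N \<and> w i = 0}"
    unfolding card_El_code_of[OF S] card_layer0[OF S] by simp
  assume l: "l \<ge> 1"
  have "El (wgraph w) l = (\<lambda>i. {VA i, VA (nxt i)}) ` {i. i < N \<and> w i = l}"
  proof (intro equalityI subsetI)
    fix e assume "e \<in> El (wgraph w) l"
    then have e: "e \<in> wedges w" "dec (wgraph w) e = l" by (auto simp: El_def edges_wgraph)
    from e(1) show "e \<in> (\<lambda>i. {VA i, VA (nxt i)}) ` {i. i < N \<and> w i = l}"
    proof (cases rule: wedges_cases)
      case (A i)
      then show ?thesis using e(2) dec_wgraph_A[of i w] by auto
    next
      case (B1 i)
      then show ?thesis using e l dec_wgraph_B[OF e(1), of i] by auto
    next
      case (B2 i)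
      then show ?thesis using e l dec_wgraph_B[OF e(1), of i] by auto
    qed
  next
    fix e assume "e \<in> (\<lambda>i. {VA i, VA (nxt i)}) ` {i. i < N \<and> w i = l}"
    then show "e \<in> El (wgraph w) l" using l wedgesI(1)[of _ w] dec_wgraph_A[of _ w] by (auto simp: El_def edges_wgraph)
  qed
  then show "card (El (wgraph w) l) = card {i. i < N \<and> w i = l}"
    by (simp add: card_image inj_on_def VA_pair_inj)
qed

text \<open>Every factor of Xi^2 is local: the edge powers count letters and the \<rho>-powers count
  junctions between different letters. A letter 0 stands for two edges, so the exponent |E_0| / 4 is
  half the number of such letters, as for the other layers.\<close>

lemma Xi_wgraph:
  assumes w: "w \<in> words" and pos: "\<mu> > 0" "\<gamma> > 0" "\<And>l. l \<in> {1..L} \<Longrightarrow> lam l > 0" "\<And>l. l \<in> {1..L} \<Longrightarrow> eps l > 0"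
  shows "(Xi L \<mu> \<rho> \<gamma> lam eps (wgraph w))\<^sup>2 =
    (\<Prod>i<N. letter_weight \<mu> \<gamma> lam eps (w i)) * (\<Prod>i<N. link_weight \<rho> (w i) (w (nxt i)))"
proof -
  let ?x = "letter_weight \<mu> \<gamma> lam eps"
  define e where "e l = card {i. i < N \<and> w i = l}" for l
  define c0 where "c0 = card {i. i < N \<and> (w i = 0) \<noteq> (w (nxt i) = 0)}"
  define c1 where "c1 = card {i. i < N \<and> w i \<noteq> w (nxt i) \<and> w i \<noteq> 0 \<and> w (nxt i) \<noteq> 0}"
  have x: "?x l > 0" if "l \<in> {0..L}" for l
    using that pos(1,2) pos(3)[of l] pos(4)[of l] by (auto simp: letter_weight_def)
  have sq: "(y powr (real m / 2))\<^sup>2 = y ^ m" if "y > 0" for y :: real and m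
    using that by (simp add: powr_half_nat flip: power_mult) (simp add: power_mult mult.commute[of m])
  have "Xi L \<mu> \<rho> \<gamma> lam eps (wgraph w) = \<rho> ^ (c0 + 2 * c1) * (?x 0 powr (real (e 0) / 2)) * (\<Prod>l\<in>{1..L}. ?x l powr (real (e l) / 2))"
    unfolding Xi_def dif0_wgraph[OF w] dif_wgraph[OF w] card_nxt_image card_El_wgraph(1)[OF w]
    by (auto simp: c0_def c1_def e_def letter_weight_def card_El_wgraph(2)[OF w] intro!: prod.cong)
  then have "(Xi L \<mu> \<rho> \<gamma> lam eps (wgraph w))\<^sup>2 = (\<rho> ^ (c0 + 2 * c1))\<^sup>2 * ((?x 0 powr (real (e 0) / 2))\<^sup>2 * (\<Prod>l\<in>{1..L}. (?x l powr (real (e l) / 2))\<^sup>2))"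
    by (simp add: power_mult_distrib prod_power_distrib)
  also have "(?x 0 powr (real (e 0) / 2))\<^sup>2 * (\<Prod>l\<in>{1..L}. (?x l powr (real (e l) / 2))\<^sup>2) = (\<Prod>l\<in>{0..L}. ?x l ^ e l)"
  proof -
    have "{0..L} = insert 0 {1..L}" by auto
    then have "(\<Prod>l\<in>{0..L}. ?x l ^ e l) = ?x 0 ^ e 0 * (\<Prod>l\<in>{1..L}. ?x l ^ e l)" by simp
    moreover have "(\<Prod>l\<in>{1..L}. (?x l powr (real (e l) / 2))\<^sup>2) = (\<Prod>l\<in>{1..L}. ?x l ^ e l)"
      using x by (intro prod.cong refl sq) auto
    ultimately show ?thesis using sq[OF x[of 0]] by simp
  qed
  also have "(\<Prod>l\<in>{0..L}. ?x l ^ e l) = (\<Prod>i<N. ?x (w i))"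
  proof -
    have "(\<Prod>i<N. ?x (w i)) = (\<Prod>l\<in>{0..L}. \<Prod>i\<in>{i\<in>{..<N}. w i = l}. ?x (w i))"
      by (rule prod.group[symmetric]) (use word_le[OF w] in auto)
    also have "\<dots> = (\<Prod>l\<in>{0..L}. ?x l ^ e l)"
      by (rule prod.cong[OF refl]) (simp add: e_def)
    finally show ?thesis by simp
  qed
  also have "(\<rho> ^ (c0 + 2 * c1))\<^sup>2 = (\<Prod>i<N. link_weight \<rho> (w i) (w (nxt i)))"
  proof -
    have "(\<Prod>i<N. link_weight \<rho> (w i) (w (nxt i))) =
      (\<Prod>i<N. (if (w i = 0) \<noteq> (w (nxt i) = 0) then \<rho>\<^sup>2 else 1) * (if w i \<noteq> w (nxt i) \<and> w i \<noteq> 0 \<and> w (nxt i) \<noteq> 0 then \<rho> ^ 4 else 1))"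
      by (rule prod.cong[OF refl]) (auto simp: link_weight_def)
    also have "\<dots> = (\<rho>\<^sup>2) ^ c0 * (\<rho> ^ 4) ^ c1"
      unfolding prod.distrib c0_def c1_def by (simp add: prod.inter_filter[symmetric])
    also have "\<dots> = (\<rho> ^ (c0 + 2 * c1))\<^sup>2"
      by (simp add: power_add algebra_simps flip: power_mult)
    finally show ?thesis by simp
  qed
  finally show ?thesis by (simp only: mult.commute)
qed

text \<open>Closing the chain replaces the final link to the fixed letter \<open>a\<close> by the
  link to w 0. Since \<tau> t(w M, a) \<le> \<tau> \<le> t(w M, w 0) for M = N - 1, this costs at
  most a factor \<tau>.\<close>

lemma cyclic_sum_lower:
  fixes x :: "nat \<Rightarrow> real"
  assumes x: "\<And>b. b \<in> {0..L} \<Longrightarrow> 0 \<le> x b" and t: "\<And>a b. \<tau> \<le> t a b \<and> t a b \<le> 1" and tau: "0 \<le> \<tau>"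
  shows "\<tau> * chain_sum {0..L} x t N a \<le> (\<Sum>w\<in>words. (\<Prod>i<N. x (w i)) * (\<Prod>i<N. t (w i) (w (nxt i))))"
  unfolding chain_sum_def sum_distrib_left words_def
proof (rule sum_mono)
  fix w assume w: "w \<in> {..<N} \<rightarrow>\<^sub>E {0..L}"
  obtain M where M: "N = Suc M" using N3 by (cases N) auto
  have t0: "0 \<le> t a b" for a b using t[of a b] tau by linarith
  have p0: "0 \<le> (\<Prod>i<M. t (w i) (w (i + 1)))" by (rule prod_nonneg) (simp add: t0)
  have "(\<Prod>i<N. t (w i) (if i + 1 = N then a else w (i + 1))) = (\<Prod>i<M. t (w i) (w (i + 1))) * t (w M) a"
    unfolding M by simp
  moreover have "(\<Prod>i<N. t (w i) (w (nxt i))) = (\<Prod>i<M. t (w i) (w (i + 1))) * t (w M) (w 0)"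
  proof -
    have 1: "nxt i = i + 1" if "i < M" for i using that M unfolding nxt_def by simp
    have 2: "nxt M = 0" unfolding nxt_def using M by simp
    have "{..<N} = insert M {..<M}" using M by auto
    then have "(\<Prod>i<N. t (w i) (w (nxt i))) = t (w M) (w (nxt M)) * (\<Prod>i<M. t (w i) (w (nxt i)))" by simp
    also have "(\<Prod>i<M. t (w i) (w (nxt i))) = (\<Prod>i<M. t (w i) (w (i + 1)))"
      by (rule prod.cong) (auto simp: 1)
    finally show ?thesis by (simp add: 2)
  qed
  moreover have "\<tau> * t (w M) a \<le> t (w M) (w 0)"
  proof -
    have "\<tau> * t (w M) a \<le> \<tau> * 1" using t[of "w M" a] tau by (intro mult_left_mono) auto
    then show ?thesis using t[of "w M" "w 0"] by linarith
  qed
  ultimately have "\<tau> * (\<Prod>i<N. t (w i) (if i + 1 = N then a else w (i + 1))) \<le> (\<Prod>i<N. t (w i) (w (nxt i)))"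
    using mult_left_mono[OF _ p0, of "\<tau> * t (w M) a" "t (w M) (w 0)"] by (simp add: mult_ac)
  moreover have "0 \<le> (\<Prod>i<N. x (w i))" by (rule prod_nonneg) (use x PiE_mem[OF w] in blast)
  ultimately have "(\<Prod>i<N. x (w i)) * (\<tau> * (\<Prod>i<N. t (w i) (if i + 1 = N then a else w (i + 1)))) \<le> (\<Prod>i<N. x (w i)) * (\<Prod>i<N. t (w i) (w (nxt i)))"
    by (rule mult_left_mono)
  then show "\<tau> * ((\<Prod>i<N. x (w i)) * (\<Prod>i<N. t (w i) (if i + 1 = N then a else w (i + 1)))) \<le> (\<Prod>i<N. x (w i)) * (\<Prod>i<N. t (w i) (w (nxt i)))"
    by (simp only: mult_ac)
qed

text \<open>
  With \<open>q = (1, \<rho>\<^sup>2, \<dots>, \<rho>\<^sup>2)\<close> and \<open>d = (0, 1 - \<rho>\<^sup>4, \<dots>)\<close> the link weights are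
  \<open>diag d + q q\<^sup>T\<close>, so \<open>v\<^sub>l = q\<^sub>l / (1 - d\<^sub>l x\<^sub>l)\<close> is a subinvariant vector of the
  transfer matrix as soon as the signal-to-noise condition holds.
\<close>

lemma beta_growth:
  assumes pos: "\<mu> > 0" "\<gamma> > 0" "\<And>l. l \<in> {1..L} \<Longrightarrow> lam l > 0" "\<And>l. l \<in> {1..L} \<Longrightarrow> eps l > 0"
    and rho: "0 < \<rho>" "\<rho> \<le> 1" and le1: "\<And>l. l \<in> {1..L} \<Longrightarrow> (eps l)\<^sup>2 * lam l \<le> 1" and \<epsilon>: "\<epsilon> > 0"
    and snr: "\<mu>\<^sup>2 / \<gamma> + (\<Sum>l\<in>{1..L}. \<rho> ^ 4 * (eps l)\<^sup>2 * lam l / (1 - (1 - \<rho> ^ 4) * (eps l)\<^sup>2 * lam l)) > 1 + \<epsilon>"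
  shows "\<rho> ^ 6 * (1 + \<epsilon> * \<rho> ^ 4) ^ N \<le> (real N)\<^sup>2 * beta L \<mu> \<rho> \<gamma> lam eps n p N"
proof -
  let ?x = "letter_weight \<mu> \<gamma> lam eps" and ?t = "link_weight \<rho>"
  define q where "q l = (if l = (0::nat) then 1 else \<rho>\<^sup>2)" for l
  define d where "d l = (if l = (0::nat) then 0 else 1 - \<rho> ^ 4)" for l
  define v where "v l = q l / (1 - d l * ?x l)" for l
  define \<Lambda> where "\<Lambda> = (\<Sum>b\<in>{0..L}. q b * ?x b * v b)"
  have r4: "0 < \<rho> ^ 4" "\<rho> ^ 4 \<le> 1" "0 < \<rho>\<^sup>2" "\<rho>\<^sup>2 \<le> 1" "\<rho> ^ 4 \<le> \<rho>\<^sup>2" using rho by (auto intro: power_le_one power_decreasing)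
  have r22: "\<rho>\<^sup>2 * \<rho>\<^sup>2 = \<rho> ^ 4" by (simp flip: power_add)
  have x0: "0 \<le> ?x l" if "l \<in> {0..L}" for l
    using that pos(1,2) pos(3)[of l] pos(4)[of l] by (auto simp: letter_weight_def less_imp_le)
  have D: "\<rho> ^ 4 \<le> 1 - d l * ?x l" if "l \<in> {0..L}" for l
  proof (cases "l = 0")
    case False
    then have "?x l \<le> 1" using le1[of l] that by (simp add: letter_weight_def)
    then have "(1 - \<rho> ^ 4) * ?x l \<le> (1 - \<rho> ^ 4) * 1" using r4 by (intro mult_left_mono) auto
    then show ?thesis using False by (simp add: d_def)
  qed (use r4 in \<open>simp add: d_def\<close>)
  have Dpos: "0 < 1 - d l * ?x l" if "l \<in> {0..L}" for l using D[OF that] r4 by linarith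
  have v0: "0 \<le> v l" if "l \<in> {0..L}" for l using Dpos[OF that] r4 by (simp add: v_def q_def)
  have v1: "\<rho>\<^sup>2 * v l \<le> 1" if "l \<in> {0..L}" for l
  proof (cases "l = 0")
    case True
    then show ?thesis using r4 by (simp add: v_def q_def d_def)
  next
    case False
    have "\<rho> ^ 4 / (1 - d l * ?x l) \<le> 1" using D[OF that] Dpos[OF that] by simp
    then show ?thesis using False by (simp add: v_def q_def r22)
  qed
  have \<Lambda>: "\<Lambda> > 1 + \<epsilon>"
  proof -
    have "{0..L} = insert 0 {1..L}" by auto
    then have "\<Lambda> = q 0 * ?x 0 * v 0 + (\<Sum>b\<in>{1..L}. q b * ?x b * v b)" unfolding \<Lambda>_def by simp
    also have "q 0 * ?x 0 * v 0 = \<mu>\<^sup>2 / \<gamma>" by (simp add: q_def v_def d_def letter_weight_def)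
    also have "(\<Sum>b\<in>{1..L}. q b * ?x b * v b) = (\<Sum>l\<in>{1..L}. \<rho> ^ 4 * (eps l)\<^sup>2 * lam l / (1 - (1 - \<rho> ^ 4) * (eps l)\<^sup>2 * lam l))"
    proof (rule sum.cong[OF refl])
      fix b assume "b \<in> {1..L}"
      then have b: "q b = \<rho>\<^sup>2" "d b = 1 - \<rho> ^ 4" "?x b = (eps b)\<^sup>2 * lam b" by (auto simp: q_def d_def letter_weight_def)
      have "q b * ?x b * v b = (q b * q b) * ?x b / (1 - d b * ?x b)" by (simp add: v_def)
      then show "q b * ?x b * v b = \<rho> ^ 4 * (eps b)\<^sup>2 * lam b / (1 - (1 - \<rho> ^ 4) * (eps b)\<^sup>2 * lam b)"
        unfolding b r22 by (simp only: mult.assoc)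
    qed
    finally show ?thesis using snr by simp
  qed
  have t: "?t a b = (if a = b then d a else 0) + q a * q b" for a b
    using r22 by (simp add: link_weight_def d_def q_def)
  have sub: "(1 + \<epsilon> * \<rho> ^ 4) * v a \<le> (\<Sum>b\<in>{0..L}. ?x b * ?t b a * v b)" if a: "a \<in> {0..L}" for a
  proof -
    have "(\<Sum>b\<in>{0..L}. ?x b * ?t b a * v b) = (\<Sum>b\<in>{0..L}. (if b = a then d a * ?x a * v a else 0) + q a * (q b * ?x b * v b))"
      by (rule sum.cong[OF refl]) (auto simp: t algebra_simps)
    also have "\<dots> = d a * ?x a * v a + q a * \<Lambda>"
      using a by (simp add: sum.distrib \<Lambda>_def sum_distrib_left)
    \<comment> \<open>Substituting for q a makes v a a common factor and exposes the excess
      (\<Lambda> - 1) (1 - d a x a) of the growth rate over 1.\<close>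
    also have "q a = v a * (1 - d a * ?x a)" using Dpos[OF a] by (simp add: v_def)
    also have "d a * ?x a * v a + v a * (1 - d a * ?x a) * \<Lambda> = v a * (1 + (\<Lambda> - 1) * (1 - d a * ?x a))"
      by (simp add: algebra_simps)
    finally have eq: "(\<Sum>b\<in>{0..L}. ?x b * ?t b a * v b) = v a * (1 + (\<Lambda> - 1) * (1 - d a * ?x a))" .
    have "\<epsilon> * \<rho> ^ 4 \<le> (\<Lambda> - 1) * (1 - d a * ?x a)"
      using \<Lambda> D[OF a] \<epsilon> r4 by (intro mult_mono) auto
    then have "v a * (1 + \<epsilon> * \<rho> ^ 4) \<le> v a * (1 + (\<Lambda> - 1) * (1 - d a * ?x a))"
      using v0[OF a] by (intro mult_left_mono) auto
    then show ?thesis unfolding eq by (simp only: mult.commute)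
  qed
  have t01: "\<rho> ^ 4 \<le> ?t a b \<and> ?t a b \<le> 1" for a b using r4 by (simp add: link_weight_def)
  have t0: "0 \<le> ?t a b" for a b using t01[of a b] r4 by linarith
  \<comment> \<open>The start vector bound \<open>v1\<close> accounts for \<rho>^2; closing the
    chain then costs the least link weight \<rho>^4, so that \<rho>^6 results.\<close>
  have "\<rho>\<^sup>2 * (1 + \<epsilon> * \<rho> ^ 4) ^ N * v 0 \<le> chain_sum {0..L} ?x ?t N 0"
    by (rule chain_sum_lower[where a = 0, OF x0 t0 v1 _ _ sub]) (use r4 \<epsilon> in auto)
  moreover have "v 0 = 1" by (simp add: v_def q_def d_def)
  ultimately have "\<rho> ^ 4 * (\<rho>\<^sup>2 * (1 + \<epsilon> * \<rho> ^ 4) ^ N) \<le> \<rho> ^ 4 * chain_sum {0..L} ?x ?t N 0"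
    using r4 by (intro mult_left_mono) auto
  also have "\<dots> \<le> (\<Sum>w\<in>words. (\<Prod>i<N. ?x (w i)) * (\<Prod>i<N. ?t (w i) (w (nxt i))))"
    by (rule cyclic_sum_lower[OF x0 t01]) (use r4 in auto)
  also have "\<dots> = (\<Sum>w\<in>words. (Xi L \<mu> \<rho> \<gamma> lam eps (wgraph w))\<^sup>2)"
    by (rule sum.cong[OF refl], rule Xi_wgraph[symmetric, OF _ pos])
  also have "\<dots> \<le> (real N)\<^sup>2 * beta L \<mu> \<rho> \<gamma> lam eps n p N" by (rule sum_words_le_beta)
  finally show ?thesis by (simp flip: power_add mult.assoc)
qed

end

section \<open>The detection theorem\<close>

lemma eventually_admissible_pdim:
  assumes "\<gamma> > 0"
  shows "eventually (\<lambda>n. real (pdim \<gamma> n) = real n / \<gamma>) (admissible \<gamma>)"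
  unfolding admissible_def eventually_inf_principal
proof (intro always_eventually allI impI)
  fix n assume "n \<in> {n. real n / \<gamma> \<in> \<nat>}"
  then obtain k where "real n / \<gamma> = real k" by (auto elim: Nats_cases)
  then show "real (pdim \<gamma> n) = real n / \<gamma>" by (simp add: pdim_def)
qed

text \<open>With l = ln n, eventually a \<le> l / ((k + 1) ln l) and hence ln a \<le> ln l;
  multiplying the two gives k a ln a \<le> l.\<close>

lemma eventually_power_le:
  fixes a :: "nat \<Rightarrow> nat"
  assumes F: "F \<le> sequentially" and a: "filterlim a at_top F"
    and small: "(\<lambda>n. real (a n)) \<in> o[F](\<lambda>n. ln (real n) / ln (ln (real n)))"
  shows "eventually (\<lambda>n. real (a n) ^ (k * a n) \<le> real n) F"
proof -
  have "eventually (\<lambda>n. norm (real (a n)) \<le> 1 / real (k + 1) * norm (ln (real n) / ln (ln (real n)))) F"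
    by (rule landau_o.smallD[OF small]) simp
  moreover have "eventually (\<lambda>n. exp 1 \<le> ln (real n)) F"
    by (rule filter_leD[OF F]) real_asymp
  moreover have "eventually (\<lambda>n. 1 \<le> a n) F"
    using a unfolding filterlim_at_top by blast
  ultimately show ?thesis
  proof eventually_elim
    case (elim n)
    define l where "l = ln (real n)"
    have l: "exp 1 \<le> l" using elim(2) by (simp add: l_def)
    then have l0: "l > 0" using exp_gt_zero[of "1::real"] by linarith
    have n0: "real n > 0" using l0 unfolding l_def by (cases "n = 0") auto
    have ll: "1 \<le> ln l" using l l0 by (simp add: ln_ge_iff)
    have "norm (l / ln l) = l / ln l" using l0 ll by simp
    then have A: "real (a n) \<le> l / ln l / real (k + 1)"
      using elim(1) unfolding l_def[symmetric] by (simp add: mult.commute)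
    have "l * 1 \<le> l * ln l" using l0 ll by (intro mult_left_mono) auto
    then have "l / ln l \<le> l" using ll by (simp add: pos_divide_le_eq)
    moreover have "l / ln l / real (k + 1) \<le> l / ln l / 1"
    proof (rule divide_left_mono)
      show "0 \<le> l / ln l" using l0 ll by (intro divide_nonneg_nonneg) linarith+
    qed auto
    ultimately have "real (a n) \<le> l" using A by linarith
    then have "ln (real (a n)) \<le> ln l" using elim(3) by simp
    moreover have "0 \<le> ln (real (a n))" using elim(3) by simp
    ultimately have "real (a n) * ln (real (a n)) \<le> (l / ln l / real (k + 1)) * ln l"
      using A l0 ll by (intro mult_mono) auto
    also have "\<dots> = l / real (k + 1)" using ll by simp
    finally have "real k * (real (a n) * ln (real (a n))) \<le> real k * (l / real (k + 1))"
      by (intro mult_left_mono) auto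
    also have "\<dots> \<le> l" using l0 by (simp add: field_simps)
    finally have "real (k * a n) * ln (real (a n)) \<le> ln (real n)" by (simp add: l_def mult.assoc)
    then have "ln (real (a n) ^ (k * a n)) \<le> ln (real n)"
      using elim(3) by (simp add: ln_realpow)
    then show ?case using n0 elim(3) by (subst (asm) ln_le_cancel_iff) auto
  qed
qed

text \<open>The sequence is the square of m s^m with s = 1 / sqrt \<theta> < 1.\<close>

lemma tendsto_square_over_power:
  fixes \<theta> :: real
  assumes "\<theta> > 1"
  shows "(\<lambda>m. (real m)\<^sup>2 / \<theta> ^ m) \<longlonglongrightarrow> 0"
proof -
  define s where "s = 1 / sqrt \<theta>"
  have s: "0 < s" "s < 1" "s\<^sup>2 = 1 / \<theta>" using assms by (auto simp: s_def power_divide)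
  have "(\<lambda>m. real m * s ^ m) \<longlonglongrightarrow> 0"
    by (rule powser_times_n_limit_0) (use s in simp)
  then have "(\<lambda>m. (real m * s ^ m)\<^sup>2) \<longlonglongrightarrow> 0\<^sup>2" by (rule tendsto_power)
  moreover have "(real m * s ^ m)\<^sup>2 = (real m)\<^sup>2 / \<theta> ^ m" for m
  proof -
    have "(s ^ m)\<^sup>2 = (s\<^sup>2) ^ m" by (simp add: power_mult[symmetric] mult.commute)
    then show ?thesis by (simp add: power_mult_distrib s(3) power_divide)
  qed
  ultimately show ?thesis by simp
qed

context planted_cycles
begin

text \<open>The square of \<open>within_bound\<close> contributes N^(8 N). What remains is bounded
  by a constant to the power N, which the hypothesis on N turns into N^N, so the numerator is at
  most N^(9 N).\<close>

lemma overlap_error_le: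
  assumes M: "mean_bound M" and N1: "N \<ge> 1"
    and D: "(2 * M\<^sup>2 * gauss_const) ^ 4 * 5 * (1 + 1 / \<gamma>) ^ 4 * 9 * (16 * real (L + 1)) ^ 4 \<le> real N"
    and n: "real N ^ (9 * N) \<le> real n"
  shows "overlap_error M \<le> 1"
proof -
  have M1: "M \<ge> 1" using M by (simp add: mean_bound_def)
  have gc: "gauss_const \<ge> 1" by (rule gauss_const_ge_1)
  \<comment> \<open>Bernoulli's inequality absorbs the linear factors 4 N + 1 and 2 N + 1 into
    powers of constants.\<close>
  have "1 + real N * 4 \<le> (1 + 4) ^ N" by (rule Bernoulli_inequality) simp
  then have a: "real (2 * (2 * N) + 1) \<le> 5 ^ N" by simp
  have "1 + real N * 2 \<le> (1 + 2) ^ N" by (rule Bernoulli_inequality) simp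
  then have b: "real (2 * N + 1) \<le> 3 ^ N" by simp
  have "real within_bound \<le> 3 ^ N * (real (L + 1) * (16 * (real N)\<^sup>2)) ^ (2 * N)"
  proof -
    have "real within_bound = real (2 * N + 1) * (real (L + 1) * (16 * (real N)\<^sup>2)) ^ (2 * N)"
    proof -
      have "(4 * N)\<^sup>2 = 16 * N\<^sup>2" by (simp add: power_mult_distrib)
      then show ?thesis unfolding within_bound_def by (simp only: of_nat_mult of_nat_power of_nat_numeral)
    qed
    then show ?thesis using b by (simp add: mult_right_mono)
  qed
  then have "(real within_bound)\<^sup>2 \<le> (3 ^ N * (real (L + 1) * (16 * (real N)\<^sup>2)) ^ (2 * N))\<^sup>2"
    by (intro power_mono) auto
  also have "\<dots> = (3 ^ 2) ^ N * ((real (L + 1) * (16 * (real N)\<^sup>2)) ^ 4) ^ N"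
  proof -
    define X where "X = real (L + 1) * (16 * (real N)\<^sup>2)"
    have "(X ^ (2 * N))\<^sup>2 = (X ^ 4) ^ N" "(3 ^ N)\<^sup>2 = ((3 :: real) ^ 2) ^ N"
      unfolding power_mult[symmetric] by (rule arg_cong[where f = "power _"], simp)+
    then show ?thesis unfolding X_def[symmetric] power_mult_distrib by (simp only:)
  qed
  also have "(real (L + 1) * (16 * (real N)\<^sup>2)) ^ 4 = (16 * real (L + 1)) ^ 4 * real N ^ 8"
  proof -
    have "((real N)\<^sup>2) ^ 4 = real N ^ 8" by (simp flip: power_mult)
    then show ?thesis by (simp only: power_mult_distrib mult_ac)
  qed
  finally have c: "(real within_bound)\<^sup>2 \<le> 9 ^ N * ((16 * real (L + 1)) ^ 4 * real N ^ 8) ^ N" by simp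
  have g: "0 \<le> 1 + 1 / \<gamma>" using gamma_pos by simp
  have "(2 * M\<^sup>2 * gauss_const) ^ (4 * N) * (real (2 * (2 * N) + 1) * (1 + 1 / \<gamma>) ^ (2 * (2 * N)) * (real within_bound)\<^sup>2)
    \<le> (2 * M\<^sup>2 * gauss_const) ^ (4 * N) * (5 ^ N * (1 + 1 / \<gamma>) ^ (2 * (2 * N)) * (9 ^ N * ((16 * real (L + 1)) ^ 4 * real N ^ 8) ^ N))"
    using a c g M1 gc by (intro mult_left_mono mult_mono) auto
  also have "\<dots> = ((2 * M\<^sup>2 * gauss_const) ^ 4 * 5 * (1 + 1 / \<gamma>) ^ 4 * 9 * (16 * real (L + 1)) ^ 4) ^ N * real N ^ (8 * N)"
  proof -
    have eq: "2 * (2 * N) = 4 * N" by simp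
    show ?thesis unfolding eq by (simp only: power_mult[symmetric] power_mult_distrib mult_ac)
  qed
  also have "\<dots> \<le> real N ^ N * real N ^ (8 * N)"
    using D g M1 gc by (intro mult_right_mono power_mono) auto
  also have "\<dots> = real N ^ (9 * N)" by (simp flip: power_add)
  also have "\<dots> \<le> real n" by (rule n)
  finally show ?thesis using n_pos by (simp add: overlap_error_def)
qed

end

theorem theorem3p5:
  fixes L :: nat
    and \<mu> \<rho> \<gamma> \<epsilon> c :: real
    and lam eps :: "nat \<Rightarrow> real"
    and aleph :: "nat \<Rightarrow> nat"
  assumes "L \<ge> 1"
    and "\<mu> > 0"
    and "0 < \<rho>" "\<rho> \<le> 1"
    and "\<gamma> > 0"
    and "\<forall>l\<in>{1..L}. lam l > 0"
    and "\<forall>l\<in>{1..L}. 0 < eps l \<and> eps l < 1"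
    and "\<mu>\<^sup>2 / \<gamma> \<le> 1"
    and "\<forall>l\<in>{1..L}. (eps l)\<^sup>2 * lam l \<le> 1"
    and "\<epsilon> > 0"
    and "\<mu>\<^sup>2 / \<gamma> +
         (\<Sum>l\<in>{1..L}. \<rho> ^ 4 * (eps l)\<^sup>2 * lam l / (1 - (1 - \<rho> ^ 4) * (eps l)\<^sup>2 * lam l)) > 1 + \<epsilon>"
    and "filterlim aleph at_top (admissible \<gamma>)"
    and "(\<lambda>n. real (aleph n)) \<in> o[admissible \<gamma>](\<lambda>n. ln (real n) / ln (ln (real n)))"
    and "0 < c" "c < 1"
  shows "let P = (\<lambda>n. planted_law L \<mu> \<rho> lam eps n (pdim \<gamma> n));
             Q = (\<lambda>n. null_law L lam n (pdim \<gamma> n));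
             f = (\<lambda>n. f_cycles L \<mu> \<rho> \<gamma> lam eps n (pdim \<gamma> n) (aleph n));
             \<tau> = (\<lambda>n. c * (\<integral>\<omega>. f n \<omega> \<partial>P n))
         in ((\<lambda>n. measure (P n) {\<omega> \<in> space (P n). f n \<omega> \<le> \<tau> n} +
                  measure (Q n) {\<omega> \<in> space (Q n). f n \<omega> \<ge> \<tau> n}) \<longlongrightarrow> 0) (admissible \<gamma>) \<and>
            strong_detection (admissible \<gamma>) P Q (\<lambda>n \<omega>. if f n \<omega> \<ge> \<tau> n then 1 else 0)"
proof -
  let ?F = "admissible \<gamma>"
  define P where "P = (\<lambda>n. planted_law L \<mu> \<rho> lam eps n (pdim \<gamma> n))"
  define Q where "Q = (\<lambda>n. null_law L lam n (pdim \<gamma> n))"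
  define f where "f = (\<lambda>n. f_cycles L \<mu> \<rho> \<gamma> lam eps n (pdim \<gamma> n) (aleph n))"
  define \<tau> where "\<tau> = (\<lambda>n. c * (\<integral>\<omega>. f n \<omega> \<partial>P n))"
  define E where "E n = measure (P n) {\<omega> \<in> space (P n). f n \<omega> \<le> \<tau> n} + measure (Q n) {\<omega> \<in> space (Q n). f n \<omega> \<ge> \<tau> n}" for n
  define T where "T = (\<lambda>n \<omega>. if f n \<omega> \<ge> \<tau> n then 1 else 0 :: nat)"
  \<comment> \<open>A sum of nonnegative terms, so it dominates every quantity in
    \<open>mean_bound\<close>, uniformly in n.\<close>
  define M where "M = 1 + sqrt \<mu> + (\<Sum>l\<in>{1..L}. eps l * sqrt (lam l))"
  define D where "D = (2 * M\<^sup>2 * gauss_const) ^ 4 * 5 * (1 + 1 / \<gamma>) ^ 4 * 9 * (16 * real (L + 1)) ^ 4"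
  define \<theta> where "\<theta> = 1 + \<epsilon> * \<rho> ^ 4"
  \<comment> \<open>The bound of \<open>detection_error\<close> with \<open>BETA\<close> replaced by
    its lower estimate \<rho>^6 \<theta>^m / m^2 from \<open>beta_growth\<close>.\<close>
  define h where "h m = (20 / (1 - c)\<^sup>2 + 4 / c\<^sup>2) / \<rho> ^ 6 * ((real m)\<^sup>2 / \<theta> ^ m)" for m
  have lam: "lam l > 0" and eps: "0 < eps l" "eps l < 1" and le1: "(eps l)\<^sup>2 * lam l \<le> 1" if "l \<in> {1..L}" for l
    using assms(6,7,9) that by auto
  have \<theta>: "\<theta> > 1" using assms(3,10) by (simp add: \<theta>_def)
  have terms: "0 \<le> eps l * sqrt (lam l)" if "l \<in> {1..L}" for l using lam[OF that] eps[OF that] by simp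
  have M1: "M \<ge> 1" "sqrt \<mu> \<le> M"
    using assms(2) sum_nonneg[of "{1..L}" "\<lambda>l. eps l * sqrt (lam l)", OF terms] by (auto simp: M_def)
  have Ml: "eps l * sqrt (lam l) \<le> M" if "l \<in> {1..L}" for l
  proof -
    have "eps l * sqrt (lam l) \<le> (\<Sum>l\<in>{1..L}. eps l * sqrt (lam l))"
      by (rule member_le_sum[OF that]) (use terms in auto)
    moreover have "0 \<le> sqrt \<mu>" using assms(2) by simp
    ultimately show ?thesis unfolding M_def by linarith
  qed
  \<comment> \<open>The exponent 9 is the one required by \<open>overlap_error_le\<close>.\<close>
  have pw: "eventually (\<lambda>n. real (aleph n) ^ (9 * aleph n) \<le> real n) ?F"
    by (rule eventually_power_le[OF _ assms(12,13)]) (simp add: admissible_def)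
  have big: "eventually (\<lambda>n. C \<le> real (aleph n)) ?F" for C
  proof -
    have "filterlim (\<lambda>n. real (aleph n)) at_top ?F"
      by (rule filterlim_compose[OF filterlim_real_sequentially assms(12)])
    then show ?thesis unfolding filterlim_at_top by blast
  qed
  have ratio: "eventually (\<lambda>n. (real (aleph n))\<^sup>2 / \<theta> ^ aleph n < \<rho> ^ 6) ?F"
  proof -
    have "((\<lambda>n. (real (aleph n))\<^sup>2 / \<theta> ^ aleph n) \<longlongrightarrow> 0) ?F"
      by (rule filterlim_compose[OF tendsto_square_over_power[OF \<theta>] assms(12)])
    then show ?thesis using assms(3) by (intro order_tendstoD(2)) auto
  qed
  have main: "eventually (\<lambda>n. E n \<le> h (aleph n) \<and> f n \<in> borel_measurable (P n) \<and> f n \<in> borel_measurable (Q n)) ?F"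
    \<comment> \<open>The thresholds for \<open>aleph n\<close>, combined with N^3 \<le> n: 4 and 4
      \<gamma> give 4 N^2 \<le> n and 4 N^2 \<le> p, 20 \<mu> controls the diagonal, D the overlaps,
      and the sum of the lam l keeps edge probabilities at most 1. \<open>ratio\<close> yields
      \<open>BETA\<close> \<ge> 1.\<close>
    using eventually_admissible_pdim[OF assms(5)] pw big[of 4] big[of "4 * \<gamma>"] big[of "20 * \<mu>"] big[of D] big[of "2 * (\<Sum>l\<in>{1..L}. lam l)"] ratio
  proof eventually_elim
    case (elim n)
    define N where "N = aleph n"
    define p where "p = pdim \<gamma> n"
    note elim = elim[folded N_def p_def]
    have N4: "N \<ge> 4" using elim(3) by simp
    have N1: "1 \<le> real N" using N4 by simp
    have n3: "real N ^ 3 \<le> real n"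
    proof -
      have "real N ^ 3 \<le> real N ^ (9 * N)" using N4 by (intro power_increasing) auto
      then show ?thesis using elim(2) by linarith
    qed
    have N2: "real N \<le> (real N)\<^sup>2" using N1 by (simp add: self_le_power)
    have cube: "C * (real N)\<^sup>2 \<le> real n" if "C \<le> real N" for C
    proof -
      have "C * (real N)\<^sup>2 \<le> real N * (real N)\<^sup>2" using that by (intro mult_right_mono) auto
      also have "\<dots> = real N ^ 3" by (simp add: power2_eq_square power3_eq_cube)
      finally show ?thesis using n3 by linarith
    qed
    have lin: "C * real N \<le> real n" if "C \<le> real N" "0 \<le> C" for C
      using cube[OF that(1)] mult_left_mono[OF N2 that(2)] by linarith
    have Nn: "real N \<le> real n" using lin[of 1] N1 by simp
    have n4: "4 * N\<^sup>2 \<le> n"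
    proof -
      have "real (4 * N\<^sup>2) \<le> real n" using cube[of 4] elim(3) by simp
      then show ?thesis by (simp only: of_nat_le_iff)
    qed
    have p4: "4 * N\<^sup>2 \<le> p"
    proof -
      have "4 * \<gamma> * (real N)\<^sup>2 \<le> real n" by (rule cube) (rule elim(4))
      also have "real n = \<gamma> * real p" using elim(1) assms(5) by simp
      finally have "\<gamma> * (4 * (real N)\<^sup>2) \<le> \<gamma> * real p" by (simp only: mult_ac)
      then have "4 * (real N)\<^sup>2 \<le> real p" by (rule mult_left_le_imp_le[OF _ assms(5)])
      then have "real (4 * N\<^sup>2) \<le> real p" by simp
      then show ?thesis by (simp only: of_nat_le_iff)
    qed
    have small: "20 * real N * \<mu> \<le> real n"
      using lin[of "20 * \<mu>"] elim(5) assms(2) by (simp add: mult_ac)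
    have mun: "\<mu> \<le> real n" using elim(5) assms(2) Nn by linarith
    have lamn: "(1 + eps l) * lam l \<le> real n" if "l \<in> {1..L}" for l
    proof -
      have "(1 + eps l) * lam l \<le> 2 * lam l" using eps[OF that] lam[OF that] by (intro mult_right_mono) auto
      also have "lam l \<le> (\<Sum>l\<in>{1..L}. lam l)" using lam that by (intro member_le_sum) (auto simp: less_imp_le)
      finally show ?thesis using elim(7) Nn by linarith
    qed
    interpret planted_cycles L n p \<mu> \<rho> lam eps \<gamma> N
      by unfold_locales (use N4 Nn assms(2-5) lam eps lamn mun elim(1) in auto)
    interpret W: words L n p N
    proof
      show "3 \<le> N" using N4 by simp
      have "N \<le> 4 * N\<^sup>2" by (simp add: power2_eq_square)
      then show "N \<le> n" "N \<le> p" using n4 p4 by linarith+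
    qed
    have mean_bound: "mean_bound M" using M1 Ml by (simp add: mean_bound_def)
    have overlap_error: "overlap_error M \<le> 1"
      by (rule overlap_error_le[OF mean_bound _ _ elim(2)]) (use N4 elim(6) in \<open>simp_all add: D_def\<close>)
    have growth: "\<rho> ^ 6 * \<theta> ^ N \<le> (real N)\<^sup>2 * BETA"
      unfolding \<theta>_def by (rule W.beta_growth[OF assms(2,5) lam eps(1) assms(3,4) le1 assms(10,11)])
    have r6: "0 < \<rho> ^ 6" and \<theta>N: "0 < \<theta> ^ N" using assms(3) \<theta> by auto
    have NN: "0 < (real N)\<^sup>2" using N1 by simp
    have q: "\<rho> ^ 6 / ((real N)\<^sup>2 / \<theta> ^ N) \<le> BETA"
      using growth NN \<theta>N by (simp add: field_simps)
    have "1 < \<rho> ^ 6 / ((real N)\<^sup>2 / \<theta> ^ N)" using elim(8) NN \<theta>N r6 by (simp add: field_simps)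
    then have beta1: "1 \<le> BETA" using q by linarith
    have "E n \<le> (20 / (1 - c)\<^sup>2 + 4 / c\<^sup>2) / BETA"
      unfolding E_def \<tau>_def P_def Q_def f_def N_def[symmetric] p_def[symmetric]
      by (rule detection_error[OF beta1 n4 p4 small _ mean_bound overlap_error assms(14,15)]) (use N4 in simp)
    also have "\<dots> \<le> (20 / (1 - c)\<^sup>2 + 4 / c\<^sup>2) / (\<rho> ^ 6 / ((real N)\<^sup>2 / \<theta> ^ N))"
      using q NN \<theta>N r6 beta1 by (intro divide_left_mono mult_pos_pos) auto
    also have "\<dots> = h N" by (simp add: h_def)
    finally have "E n \<le> h N" .
    moreover have "f n \<in> borel_measurable (P n)" "f n \<in> borel_measurable (Q n)"
      unfolding P_def Q_def f_def N_def[symmetric] p_def[symmetric]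
      using measurable_f_cycles
      by (simp_all add: measurable_cong_sets[OF sets_planted_law refl] measurable_cong_sets[OF sets_null_law refl])
    ultimately show ?case by (simp add: N_def)
  qed
  have h0: "((\<lambda>n. h (aleph n)) \<longlongrightarrow> 0) ?F"
  proof -
    have "((\<lambda>n. (real (aleph n))\<^sup>2 / \<theta> ^ aleph n) \<longlongrightarrow> 0) ?F"
      by (rule filterlim_compose[OF tendsto_square_over_power[OF \<theta>] assms(12)])
    from tendsto_mult_left[OF this, of "(20 / (1 - c)\<^sup>2 + 4 / c\<^sup>2) / \<rho> ^ 6"] show ?thesis
      by (simp add: h_def)
  qed
  have E0: "(E \<longlongrightarrow> 0) ?F"
  proof (rule tendsto_sandwich[OF _ _ tendsto_const h0])
    show "eventually (\<lambda>n. 0 \<le> E n) ?F" by (simp add: E_def)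
    show "eventually (\<lambda>n. E n \<le> h (aleph n)) ?F" using main by eventually_elim simp
  qed
  have "strong_detection ?F P Q T"
    unfolding strong_detection_def
  proof
    show "\<forall>\<^sub>F n in ?F. T n \<in> measurable (P n) (count_space {0, 1}) \<and> T n \<in> measurable (Q n) (count_space {0, 1})"
      using main
    proof eventually_elim
      case (elim n)
      have "T n \<in> measurable M' (count_space {0, 1})" if [measurable]: "f n \<in> borel_measurable M'" for M'
        unfolding T_def by (intro measurable_If) auto
      then show ?case using elim by blast
    qed
    show "((\<lambda>n. measure (P n) {\<omega> \<in> space (P n). T n \<omega> = 0} + measure (Q n) {\<omega> \<in> space (Q n). T n \<omega> = 1}) \<longlongrightarrow> 0) ?F"
    proof (rule tendsto_sandwich[OF _ _ tendsto_const E0])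
      show "eventually (\<lambda>n. 0 \<le> measure (P n) {\<omega> \<in> space (P n). T n \<omega> = 0} + measure (Q n) {\<omega> \<in> space (Q n). T n \<omega> = 1}) ?F" by simp
      show "eventually (\<lambda>n. measure (P n) {\<omega> \<in> space (P n). T n \<omega> = 0} + measure (Q n) {\<omega> \<in> space (Q n). T n \<omega> = 1} \<le> E n) ?F"
        using main
      proof eventually_elim
        case (elim n)
        interpret Pn: prob_space "P n" unfolding P_def by (rule prob_space_planted)
        have [measurable]: "f n \<in> borel_measurable (P n)" using elim by blast
        \<comment> \<open>Output 0 means f < \<tau> strictly, an event contained in f \<le> \<tau>,
          so the error of the test is at most E n.\<close>
        have "measure (P n) {\<omega> \<in> space (P n). T n \<omega> = 0} \<le> measure (P n) {\<omega> \<in> space (P n). f n \<omega> \<le> \<tau> n}"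
        proof (rule Pn.finite_measure_mono)
          show "{\<omega> \<in> space (P n). T n \<omega> = 0} \<subseteq> {\<omega> \<in> space (P n). f n \<omega> \<le> \<tau> n}"
            by (auto simp: T_def split: if_splits)
          show "{\<omega> \<in> space (P n). f n \<omega> \<le> \<tau> n} \<in> Pn.events" by measurable
        qed
        moreover have "{\<omega> \<in> space (Q n). T n \<omega> = 1} = {\<omega> \<in> space (Q n). f n \<omega> \<ge> \<tau> n}"
          by (auto simp: T_def split: if_splits)
        ultimately show ?case by (simp add: E_def)
      qed
    qed
  qed
  then show ?thesis
    using E0 unfolding Let_def E_def T_def \<tau>_def f_def P_def Q_def by blast
qed

end
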